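(* Let $k$ be a commutative unital ring and $\mathcal{C}$ an essentially small category. There is a one-to-one correspondence between equivalence classes of epireflective and coreflective subcategories of $\mathcal{C}\text{-mod}$ (i.e. full subcategories that are both epireflective and coreflective) and isomorphism classes of Yoneda bifunctors for $\mathcal{C}$.
   Context: $\mathcal{C}\text{-mod}$ is the category of covariant functors $\mathcal{C}\to k\text{-mod}$. A full subcategory $A$ of a category $B$ is epireflective if the inclusion $i:A\to B$ admits a left adjoint such that the unit of the adjunction is an epimorphism; it is coreflective if the inclusion admits a right adjoint. Two such full subcategories of $\mathcal{C}\text{-mod}$ are regarded as equivalent when each object of one is isomorphic in $\mathcal{C}\text{-mod}$ to an object of the other. A Yoneda bifunctor for $\mathcal{C}$ is a functor $T:\mathcal{C}^{op}\times\mathcal{C}\to k\text{-mod}$ together with a surjective natural transformation $\mu$ from the bifunctor $(x,y)\mapsto k[\operatorname{Hom}_{\mathcal{C}}(x,y)]$ (free $k$-module on the Hom set) to $T$, such that, writing $T_a=T(a,-)$, the canonical morphism $$\varphi_{(a,b)}:\operatorname{Hom}_{\mathcal{C}\text{-mod}}(T_b,T_a)\to T(a,b),\qquad F\mapsto F_b(\mu_{b,b}(\mathbf{1}_b)),$$ is an isomorphism for all objects $a,b$. *)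

theory Defs
  imports "HOL-Algebra.Module" "HOL-Library.Equipollence"
begin

section \<open>Categories, functors, natural transformations\<close>

text \<open>
  Arrows are indexed by their source and target: the sets \<open>Hom C x y\<close> need not be disjoint, and
  \<open>cmp C x y z g f\<close> is the composite of \<open>f\<close> from \<open>x\<close> to \<open>y\<close> with \<open>g\<close> from \<open>y\<close> to \<open>z\<close>. Accordingly the
  arrow part of a functor takes the source and the target as arguments.
\<close>

record ('o, 'a) category =
  Obj :: "'o set"
  Hom :: "'o \<Rightarrow> 'o \<Rightarrow> 'a set"
  idt :: "'o \<Rightarrow> 'a"
  cmp :: "'o \<Rightarrow> 'o \<Rightarrow> 'o \<Rightarrow> 'a \<Rightarrow> 'a \<Rightarrow> 'a"

locale category =
  fixes C :: "('o, 'a) category"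
  assumes idt_in: "x \<in> Obj C \<Longrightarrow> idt C x \<in> Hom C x x"
    and cmp_in: "\<lbrakk>x \<in> Obj C; y \<in> Obj C; z \<in> Obj C; f \<in> Hom C x y; g \<in> Hom C y z\<rbrakk>
      \<Longrightarrow> cmp C x y z g f \<in> Hom C x z"
    and cmp_idt_left: "\<lbrakk>x \<in> Obj C; y \<in> Obj C; f \<in> Hom C x y\<rbrakk> \<Longrightarrow> cmp C x y y (idt C y) f = f"
    and cmp_idt_right: "\<lbrakk>x \<in> Obj C; y \<in> Obj C; f \<in> Hom C x y\<rbrakk> \<Longrightarrow> cmp C x x y f (idt C x) = f"
    and cmp_assoc: "\<lbrakk>w \<in> Obj C; x \<in> Obj C; y \<in> Obj C; z \<in> Obj C;
        f \<in> Hom C w x; g \<in> Hom C x y; h \<in> Hom C y z\<rbrakk>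
      \<Longrightarrow> cmp C w y z h (cmp C w x y g f) = cmp C w x z (cmp C x y z h g) f"

definition is_iso :: "('o, 'a) category \<Rightarrow> 'o \<Rightarrow> 'o \<Rightarrow> 'a \<Rightarrow> bool" where
  "is_iso C x y f \<longleftrightarrow> f \<in> Hom C x y \<and>
     (\<exists>g \<in> Hom C y x. cmp C x y x g f = idt C x \<and> cmp C y x y f g = idt C y)"

definition isomorphic :: "('o, 'a) category \<Rightarrow> 'o \<Rightarrow> 'o \<Rightarrow> bool" where
  "isomorphic C x y \<longleftrightarrow> (\<exists>f. is_iso C x y f)"

definition is_epi :: "('o, 'a) category \<Rightarrow> 'o \<Rightarrow> 'o \<Rightarrow> 'a \<Rightarrow> bool" where
  "is_epi C x y f \<longleftrightarrow> f \<in> Hom C x y \<and>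
     (\<forall>z \<in> Obj C. \<forall>g \<in> Hom C y z. \<forall>h \<in> Hom C y z.
        cmp C x y z g f = cmp C x y z h f \<longrightarrow> g = h)"

definition opposite :: "('o, 'a) category \<Rightarrow> ('o, 'a) category" where
  "opposite C = \<lparr>Obj = Obj C, Hom = (\<lambda>x y. Hom C y x), idt = idt C,
     cmp = (\<lambda>x y z g f. cmp C z y x f g)\<rparr>"

definition product_category ::
  "('o, 'a) category \<Rightarrow> ('p, 'b) category \<Rightarrow> ('o \<times> 'p, 'a \<times> 'b) category" where
  "product_category C D = \<lparr>Obj = Obj C \<times> Obj D,
     Hom = (\<lambda>x y. Hom C (fst x) (fst y) \<times> Hom D (snd x) (snd y)),
     idt = (\<lambda>x. (idt C (fst x), idt D (snd x))),
     cmp = (\<lambda>x y z g f. (cmp C (fst x) (fst y) (fst z) (fst g) (fst f),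
                          cmp D (snd x) (snd y) (snd z) (snd g) (snd f)))\<rparr>"

record ('o, 'a, 'p, 'b) cat_functor =
  obj_map :: "'o \<Rightarrow> 'p"
  arr_map :: "'o \<Rightarrow> 'o \<Rightarrow> 'a \<Rightarrow> 'b"

definition is_functor ::
  "('o, 'a) category \<Rightarrow> ('p, 'b) category \<Rightarrow> ('o, 'a, 'p, 'b) cat_functor \<Rightarrow> bool" where
  "is_functor C D F \<longleftrightarrow>
     (\<forall>x \<in> Obj C. obj_map F x \<in> Obj D) \<and>
     (\<forall>x \<in> Obj C. \<forall>y \<in> Obj C. \<forall>f \<in> Hom C x y.
        arr_map F x y f \<in> Hom D (obj_map F x) (obj_map F y)) \<and>
     (\<forall>x \<in> Obj C. arr_map F x x (idt C x) = idt D (obj_map F x)) \<and>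
     (\<forall>x \<in> Obj C. \<forall>y \<in> Obj C. \<forall>z \<in> Obj C. \<forall>f \<in> Hom C x y. \<forall>g \<in> Hom C y z.
        arr_map F x z (cmp C x y z g f) =
        cmp D (obj_map F x) (obj_map F y) (obj_map F z) (arr_map F y z g) (arr_map F x y f))"

definition id_functor :: "('o, 'a, 'o, 'a) cat_functor" where
  "id_functor = \<lparr>obj_map = (\<lambda>x. x), arr_map = (\<lambda>x y f. f)\<rparr>"

definition comp_functor ::
  "('p, 'b, 'q, 'c) cat_functor \<Rightarrow> ('o, 'a, 'p, 'b) cat_functor
   \<Rightarrow> ('o, 'a, 'q, 'c) cat_functor" where
  "comp_functor G F = \<lparr>obj_map = (\<lambda>x. obj_map G (obj_map F x)),
     arr_map = (\<lambda>x y f. arr_map G (obj_map F x) (obj_map F y) (arr_map F x y f))\<rparr>"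

definition nat_trans ::
  "('o, 'a) category \<Rightarrow> ('p, 'b) category \<Rightarrow> ('o, 'a, 'p, 'b) cat_functor
   \<Rightarrow> ('o, 'a, 'p, 'b) cat_functor \<Rightarrow> ('o \<Rightarrow> 'b) set" where
  "nat_trans C D F G =
     {\<eta> \<in> \<Pi>\<^sub>E x \<in> Obj C. Hom D (obj_map F x) (obj_map G x).
        \<forall>x \<in> Obj C. \<forall>y \<in> Obj C. \<forall>f \<in> Hom C x y.
          cmp D (obj_map F x) (obj_map F y) (obj_map G y) (\<eta> y) (arr_map F x y f) =
          cmp D (obj_map F x) (obj_map G x) (obj_map G y) (arr_map G x y f) (\<eta> x)}"

definition functor_category ::
  "('o, 'a) category \<Rightarrow> ('p, 'b) category
   \<Rightarrow> (('o, 'a, 'p, 'b) cat_functor, 'o \<Rightarrow> 'b) category" where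
  "functor_category C D = \<lparr>Obj = {F. is_functor C D F}, Hom = nat_trans C D,
     idt = (\<lambda>F. \<lambda>x \<in> Obj C. idt D (obj_map F x)),
     cmp = (\<lambda>F G H \<beta> \<alpha>. \<lambda>x \<in> Obj C.
       cmp D (obj_map F x) (obj_map G x) (obj_map H x) (\<beta> x) (\<alpha> x))\<rparr>"


section \<open>Epireflective and coreflective full subcategories\<close>

definition adjunction ::
  "('o, 'a) category \<Rightarrow> ('p, 'b) category
   \<Rightarrow> ('o, 'a, 'p, 'b) cat_functor \<Rightarrow> ('p, 'b, 'o, 'a) cat_functor
   \<Rightarrow> ('o \<Rightarrow> 'a) \<Rightarrow> ('p \<Rightarrow> 'b) \<Rightarrow> bool" where
  \<comment> \<open>\<open>L\<close> is left adjoint to \<open>G\<close>, with unit \<open>\<eta>\<close> and counit \<open>\<epsilon>\<close>\<close>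
  "adjunction C D L G \<eta> \<epsilon> \<longleftrightarrow>
     is_functor C D L \<and> is_functor D C G \<and>
     \<eta> \<in> nat_trans C C id_functor (comp_functor G L) \<and>
     \<epsilon> \<in> nat_trans D D (comp_functor L G) id_functor \<and>
     (\<forall>x \<in> Obj C.
        cmp D (obj_map L x) (obj_map L (obj_map G (obj_map L x))) (obj_map L x)
          (\<epsilon> (obj_map L x)) (arr_map L x (obj_map G (obj_map L x)) (\<eta> x))
        = idt D (obj_map L x)) \<and>
     (\<forall>y \<in> Obj D.
        cmp C (obj_map G y) (obj_map G (obj_map L (obj_map G y))) (obj_map G y)
          (arr_map G (obj_map L (obj_map G y)) y (\<epsilon> y)) (\<eta> (obj_map G y))
        = idt C (obj_map G y))"

definition full_subcategory :: "('o, 'a) category \<Rightarrow> 'o set \<Rightarrow> ('o, 'a) category" where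
  "full_subcategory B A = B\<lparr>Obj := A\<rparr>"

text \<open>
  A full subcategory is given by its set of objects; its inclusion functor is then \<open>id_functor\<close>.
\<close>

definition epireflective :: "('o, 'a) category \<Rightarrow> 'o set \<Rightarrow> bool" where
  "epireflective B A \<longleftrightarrow> A \<subseteq> Obj B \<and>
     (\<exists>L \<eta> \<epsilon>. adjunction B (full_subcategory B A) L id_functor \<eta> \<epsilon> \<and>
        (\<forall>x \<in> Obj B. is_epi B x (obj_map L x) (\<eta> x)))"

definition coreflective :: "('o, 'a) category \<Rightarrow> 'o set \<Rightarrow> bool" where
  "coreflective B A \<longleftrightarrow> A \<subseteq> Obj B \<and>
     (\<exists>G \<eta> \<epsilon>. adjunction (full_subcategory B A) B id_functor G \<eta> \<epsilon>)"

definition epi_coreflectives :: "('o, 'a) category \<Rightarrow> 'o set set" where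
  "epi_coreflectives B = {A. epireflective B A \<and> coreflective B A}"

definition subcategory_equiv :: "('o, 'a) category \<Rightarrow> ('o set \<times> 'o set) set" where
  "subcategory_equiv B =
     {(A, A'). A \<in> epi_coreflectives B \<and> A' \<in> epi_coreflectives B \<and>
        (\<forall>x \<in> A. \<exists>y \<in> A'. isomorphic B x y) \<and> (\<forall>y \<in> A'. \<exists>x \<in> A. isomorphic B y x)}"


section \<open>Size\<close>

text \<open>
  The universe that makes \<open>k-mod\<close> and ``essentially small'' precise is a family \<open>\<U>\<close> of subsets of
  a type. Of the closure properties of a Grothendieck universe only those below are required; in
  particular closure under power sets is not, so that besides the sets of cardinality less than
  an inaccessible cardinal also the family of all subsets of an infinite type is admitted.
\<close>

definition universe :: "'u set set \<Rightarrow> bool" where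
  "universe \<U> \<longleftrightarrow> (\<exists>X \<in> \<U>. infinite X) \<and>
     (\<forall>X \<in> \<U>. \<forall>Y. Y \<subseteq> X \<longrightarrow> Y \<in> \<U>) \<and>
     (\<forall>X \<in> \<U>. \<forall>f :: 'u \<Rightarrow> 'u. f ` X \<in> \<U>) \<and>
     (\<forall>X \<in> \<U>. \<forall>F :: 'u \<Rightarrow> 'u set. (\<forall>x \<in> X. F x \<in> \<U>) \<longrightarrow> (\<Union>x \<in> X. F x) \<in> \<U>)"

definition small :: "'u set set \<Rightarrow> 'b set \<Rightarrow> bool" where
  "small \<U> X \<longleftrightarrow> (\<exists>Y \<in> \<U>. X \<lesssim> Y)"

definition essentially_small :: "'u set set \<Rightarrow> ('o, 'a) category \<Rightarrow> bool" where
  "essentially_small \<U> C \<longleftrightarrow>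
     (\<forall>x \<in> Obj C. \<forall>y \<in> Obj C. small \<U> (Hom C x y)) \<and>
     (\<exists>S \<subseteq> Obj C. small \<U> S \<and> (\<forall>x \<in> Obj C. \<exists>s \<in> S. isomorphic C x s))"


section \<open>Modules\<close>

definition mod_hom ::
  "'r ring \<Rightarrow> ('r, 'm) module \<Rightarrow> ('r, 'n) module \<Rightarrow> ('m \<Rightarrow> 'n) set" where
  "mod_hom R M N = {f \<in> carrier M \<rightarrow>\<^sub>E carrier N.
     (\<forall>u \<in> carrier M. \<forall>v \<in> carrier M. f (u \<oplus>\<^bsub>M\<^esub> v) = f u \<oplus>\<^bsub>N\<^esub> f v) \<and>
     (\<forall>r \<in> carrier R. \<forall>u \<in> carrier M. f (r \<odot>\<^bsub>M\<^esub> u) = r \<odot>\<^bsub>N\<^esub> f u)}"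

definition mod_iso ::
  "'r ring \<Rightarrow> ('r, 'm) module \<Rightarrow> ('r, 'n) module \<Rightarrow> ('m \<Rightarrow> 'n) set" where
  "mod_iso R M N = {f \<in> mod_hom R M N. bij_betw f (carrier M) (carrier N)}"

definition module_category ::
  "'r ring \<Rightarrow> 'u set set \<Rightarrow> (('r, 'u) module, 'u \<Rightarrow> 'u) category" where
  "module_category R \<U> = \<lparr>Obj = {M. module R M \<and> carrier M \<in> \<U>}, Hom = mod_hom R,
     idt = (\<lambda>M. \<lambda>u \<in> carrier M. u),
     cmp = (\<lambda>M N P g f. compose (carrier M) g f)\<rparr>"

text \<open>
  The free module on \<open>X\<close> consists of the finitely supported functions that vanish outside \<open>X\<close>.
  The fields \<open>mult\<close> and \<open>one\<close>, which the module record inherits from the ring record, play no role.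
\<close>

definition free_module :: "'r ring \<Rightarrow> 'x set \<Rightarrow> ('r, 'x \<Rightarrow> 'r) module" where
  "free_module R X =
     \<lparr>carrier = {c. (\<forall>x. c x \<in> carrier R) \<and> (\<forall>x. x \<notin> X \<longrightarrow> c x = \<zero>\<^bsub>R\<^esub>) \<and>
                    finite {x. c x \<noteq> \<zero>\<^bsub>R\<^esub>}},
      mult = undefined, one = undefined,
      zero = (\<lambda>x. \<zero>\<^bsub>R\<^esub>), add = (\<lambda>c d x. c x \<oplus>\<^bsub>R\<^esub> d x), smult = (\<lambda>r c x. r \<otimes>\<^bsub>R\<^esub> c x)\<rparr>"

definition free_gen :: "'r ring \<Rightarrow> 'x \<Rightarrow> 'x \<Rightarrow> 'r" where
  "free_gen R x = (\<lambda>y. if y = x then \<one>\<^bsub>R\<^esub> else \<zero>\<^bsub>R\<^esub>)"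

definition free_map ::
  "'r ring \<Rightarrow> 'x set \<Rightarrow> ('x \<Rightarrow> 'y) \<Rightarrow> ('x \<Rightarrow> 'r) \<Rightarrow> ('y \<Rightarrow> 'r)" where
  \<comment> \<open>the linear map induced by \<open>h\<close>, with \<open>x \<in> X\<close> sent to \<open>h x\<close>\<close>
  "free_map R X h = (\<lambda>c \<in> carrier (free_module R X).
     \<lambda>y. \<Oplus>\<^bsub>R\<^esub>x \<in> {x. c x \<noteq> \<zero>\<^bsub>R\<^esub> \<and> h x = y}. c x)"


section \<open>The category of functors to modules, and Yoneda bifunctors\<close>

type_synonym ('o, 'a, 'r, 'u) mod_functor = "('o, 'a, ('r, 'u) module, 'u \<Rightarrow> 'u) cat_functor"

definition functor_mod ::
  "'r ring \<Rightarrow> 'u set set \<Rightarrow> ('o, 'a) category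
   \<Rightarrow> (('o, 'a, 'r, 'u) mod_functor, 'o \<Rightarrow> 'u \<Rightarrow> 'u) category" where
  "functor_mod R \<U> C = functor_category C (module_category R \<U>)"

definition functor_mod_hom ::
  "'r ring \<Rightarrow> 'u set set \<Rightarrow> ('o, 'a) category
   \<Rightarrow> ('o, 'a, 'r, 'u) mod_functor \<Rightarrow> ('o, 'a, 'r, 'u) mod_functor
   \<Rightarrow> ('r, 'o \<Rightarrow> 'u \<Rightarrow> 'u) module" where
  \<comment> \<open>the pointwise module structure on the set of arrows from \<open>F\<close> to \<open>G\<close>\<close>
  "functor_mod_hom R \<U> C F G =
     \<lparr>carrier = Hom (functor_mod R \<U> C) F G, mult = undefined, one = undefined,
      zero = (\<lambda>x \<in> Obj C. \<lambda>u \<in> carrier (obj_map F x). \<zero>\<^bsub>obj_map G x\<^esub>),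
      add = (\<lambda>\<alpha> \<beta>. \<lambda>x \<in> Obj C. \<lambda>u \<in> carrier (obj_map F x). \<alpha> x u \<oplus>\<^bsub>obj_map G x\<^esub> \<beta> x u),
      smult = (\<lambda>r \<alpha>. \<lambda>x \<in> Obj C. \<lambda>u \<in> carrier (obj_map F x). r \<odot>\<^bsub>obj_map G x\<^esub> \<alpha> x u)\<rparr>"

type_synonym ('o, 'a, 'r, 'u) mod_bifunctor = "('o \<times> 'o, 'a \<times> 'a, 'r, 'u) mod_functor"

definition free_hom :: "'r ring \<Rightarrow> ('o, 'a) category \<Rightarrow> ('o, 'a, 'r, 'a \<Rightarrow> 'r) mod_bifunctor" where
  \<comment> \<open>an arrow from \<open>(x, y)\<close> to \<open>(x', y')\<close> of the source is a pair of \<open>f\<close> in \<open>Hom C x' x\<close> and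
    \<open>g\<close> in \<open>Hom C y y'\<close>; it acts by composing with \<open>f\<close> and \<open>g\<close>\<close>
  "free_hom R C =
     \<lparr>obj_map = (\<lambda>(x, y). free_module R (Hom C x y)),
      arr_map = (\<lambda>(x, y) (x', y') (f, g). free_map R (Hom C x y)
        (\<lambda>h. cmp C x' y y' g (cmp C x' x y h f)))\<rparr>"

text \<open>
  The modules \<open>free_hom R C\<close> takes as values and those of a bifunctor to \<open>module_category R \<U>\<close>
  have elements of different types, so a natural transformation between the two is spelled out
  with linear maps instead of \<open>nat_trans\<close>.
\<close>

definition nat_surjection ::
  "'r ring \<Rightarrow> ('o, 'a) category \<Rightarrow> ('o, 'a, 'r, 'm) mod_functor \<Rightarrow> ('o, 'a, 'r, 'n) mod_functor
   \<Rightarrow> ('o \<Rightarrow> 'm \<Rightarrow> 'n) \<Rightarrow> bool" where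
  "nat_surjection R D F G \<mu> \<longleftrightarrow>
     (\<forall>p \<in> Obj D. \<mu> p \<in> mod_hom R (obj_map F p) (obj_map G p) \<and>
        \<mu> p ` carrier (obj_map F p) = carrier (obj_map G p)) \<and>
     (\<forall>p \<in> Obj D. \<forall>q \<in> Obj D. \<forall>h \<in> Hom D p q. \<forall>c \<in> carrier (obj_map F p).
        \<mu> q (arr_map F p q h c) = arr_map G p q h (\<mu> p c))"

definition fix_left ::
  "('o, 'a) category \<Rightarrow> ('o, 'a, 'r, 'u) mod_bifunctor \<Rightarrow> 'o \<Rightarrow> ('o, 'a, 'r, 'u) mod_functor" where
  \<comment> \<open>\<open>T(a, -)\<close>\<close>
  "fix_left C T a = \<lparr>obj_map = (\<lambda>y. obj_map T (a, y)),
     arr_map = (\<lambda>y y' g. arr_map T (a, y) (a, y') (idt C a, g))\<rparr>"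

definition yoneda_map ::
  "'r ring \<Rightarrow> 'u set set \<Rightarrow> ('o, 'a) category
   \<Rightarrow> ('o, 'a, 'r, 'u) mod_bifunctor \<Rightarrow> ('o \<times> 'o \<Rightarrow> ('a \<Rightarrow> 'r) \<Rightarrow> 'u)
   \<Rightarrow> 'o \<Rightarrow> 'o \<Rightarrow> ('o \<Rightarrow> 'u \<Rightarrow> 'u) \<Rightarrow> 'u" where
  "yoneda_map R \<U> C T \<mu> a b =
     (\<lambda>F \<in> Hom (functor_mod R \<U> C) (fix_left C T b) (fix_left C T a).
        F b (\<mu> (b, b) (free_gen R (idt C b))))"

definition yoneda_bifunctors ::
  "'r ring \<Rightarrow> 'u set set \<Rightarrow> ('o, 'a) category
   \<Rightarrow> (('o, 'a, 'r, 'u) mod_bifunctor \<times> ('o \<times> 'o \<Rightarrow> ('a \<Rightarrow> 'r) \<Rightarrow> 'u)) set" where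
  "yoneda_bifunctors R \<U> C =
     {(T, \<mu>). T \<in> Obj (functor_mod R \<U> (product_category (opposite C) C)) \<and>
        nat_surjection R (product_category (opposite C) C) (free_hom R C) T \<mu> \<and>
        (\<forall>a \<in> Obj C. \<forall>b \<in> Obj C.
           yoneda_map R \<U> C T \<mu> a b
             \<in> mod_iso R (functor_mod_hom R \<U> C (fix_left C T b) (fix_left C T a))
                  (obj_map T (a, b)))}"

text \<open>
  Since \<open>\<mu>\<close> is part of the data, an isomorphism of Yoneda bifunctors has to be compatible with it.
\<close>

definition yoneda_isomorphism ::
  "'r ring \<Rightarrow> 'u set set \<Rightarrow> ('o, 'a) category
   \<Rightarrow> ((('o, 'a, 'r, 'u) mod_bifunctor \<times> ('o \<times> 'o \<Rightarrow> ('a \<Rightarrow> 'r) \<Rightarrow> 'u)) \<times>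
       (('o, 'a, 'r, 'u) mod_bifunctor \<times> ('o \<times> 'o \<Rightarrow> ('a \<Rightarrow> 'r) \<Rightarrow> 'u))) set" where
  "yoneda_isomorphism R \<U> C =
     {((T, \<mu>), (T', \<mu>')).
        (T, \<mu>) \<in> yoneda_bifunctors R \<U> C \<and> (T', \<mu>') \<in> yoneda_bifunctors R \<U> C \<and>
        (\<exists>\<theta>. is_iso (functor_mod R \<U> (product_category (opposite C) C)) T T' \<theta> \<and>
           (\<forall>p \<in> Obj (product_category (opposite C) C). \<forall>c \<in> carrier (obj_map (free_hom R C) p).
              \<theta> p (\<mu> p c) = \<mu>' p c))}"

end

theory Submission
  imports Defs
begin

text \<open>
  Both sides are classified by the two-sided ideals of the linearised category \<open>k[C]\<close>, whose arrows
  from \<open>x\<close> to \<open>y\<close> are the formal sums of arrows of \<open>C\<close>. Here an ideal is a family of submodules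
  \<open>I(x, y)\<close> of \<open>k[Hom(x, y)]\<close> that is closed under composition with arrows on either side, which is the same
  thing as a subfunctor of the bifunctor \<open>free_hom\<close>. Formal sums act on any functor \<open>F\<close> to modules
  (\<open>act\<close>), and so it makes sense to say that \<open>I\<close> annihilates \<open>F\<close>.

  Yoneda bifunctors. The kernel of a surjection \<open>\<mu>\<close> from \<open>free_hom\<close> onto \<open>T\<close> is an ideal \<open>I\<close>, and every
  ideal arises. A map from \<open>T(b, -)\<close> to a functor \<open>G\<close> amounts to an element of \<open>G b\<close> on which \<open>I\<close> acts by
  zero (\<open>yoneda_extend\<close>). Since \<open>I\<close> is two-sided, it annihilates \<open>T(a, -)\<close>, and hence every element of
  \<open>T(a, b)\<close> gives such a map: the Yoneda condition holds for every quotient (\<open>yoneda_bifunctors_iff\<close>).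
  An isomorphism compatible with \<open>\<mu>\<close> exists exactly when the kernels agree
  (\<open>yoneda_isomorphism_iff\<close>).

  Subcategories. The functors annihilated by an ideal \<open>I\<close> form an epireflective and coreflective
  subcategory: the reflection is the largest annihilated quotient and the coreflection the largest
  annihilated subfunctor. Its annihilator is \<open>I\<close> again, because the quotients \<open>T(a, -)\<close> of the
  representable functors by \<open>I\<close> belong to it (\<open>kernel_is_annihilator\<close>). Conversely let \<open>A\<close> be epireflective
  and coreflective with annihilator \<open>I\<close>. The reflection of \<open>T(a, -)\<close> in \<open>A\<close> is an isomorphism, since a
  formal sum that dies in it acts by zero on all of \<open>A\<close> and so lies in \<open>I\<close>. If \<open>I\<close> annihilates \<open>F\<close>,
  every element of \<open>F\<close> is reached by a map from some \<open>T(a, -)\<close>, so the counit from the coreflection of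
  \<open>F\<close> to \<open>F\<close> is surjective. It is also injective, as the inclusion of its kernel extends along an
  epimorphic reflection to a map that the counit sends to zero and that vanishes by the universal property
  of the counit (\<open>coreflection_injective\<close>). Hence \<open>A\<close> consists, up to isomorphism, of all functors that \<open>I\<close> annihilates (\<open>repletion_iff_annihilated\<close>) and is determined by \<open>I\<close>.

  The hypotheses on size serve to realise \<open>T\<close> inside the universe: the modules \<open>k[Hom(x, y)]\<close> are
  small (\<open>small_free_module\<close>), and hence so are their quotients (\<open>quotient_module_exists\<close>).
\<close>

section \<open>Linear maps and quotient modules\<close>

lemma mod_hom_closed:
  "f \<in> mod_hom R M N \<Longrightarrow> u \<in> carrier M \<Longrightarrow> f u \<in> carrier N"
  by (auto simp: mod_hom_def)

lemma mod_hom_add: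
  "f \<in> mod_hom R M N \<Longrightarrow> u \<in> carrier M \<Longrightarrow> v \<in> carrier M \<Longrightarrow>
    f (u \<oplus>\<^bsub>M\<^esub> v) = f u \<oplus>\<^bsub>N\<^esub> f v"
  by (auto simp: mod_hom_def)

lemma mod_hom_smult:
  "f \<in> mod_hom R M N \<Longrightarrow> r \<in> carrier R \<Longrightarrow> u \<in> carrier M \<Longrightarrow>
    f (r \<odot>\<^bsub>M\<^esub> u) = r \<odot>\<^bsub>N\<^esub> f u"
  by (auto simp: mod_hom_def)

lemma mod_homI:
  assumes "f \<in> extensional (carrier M)"
    and "\<And>u. u \<in> carrier M \<Longrightarrow> f u \<in> carrier N"
    and "\<And>u v. u \<in> carrier M \<Longrightarrow> v \<in> carrier M \<Longrightarrow> f (u \<oplus>\<^bsub>M\<^esub> v) = f u \<oplus>\<^bsub>N\<^esub> f v"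
    and "\<And>r u. r \<in> carrier R \<Longrightarrow> u \<in> carrier M \<Longrightarrow> f (r \<odot>\<^bsub>M\<^esub> u) = r \<odot>\<^bsub>N\<^esub> f u"
  shows "f \<in> mod_hom R M N"
  using assms by (auto simp: mod_hom_def PiE_def)

lemma mod_hom_ext:
  assumes "f \<in> mod_hom R M N" and "g \<in> mod_hom R M N'"
    and "\<And>u. u \<in> carrier M \<Longrightarrow> f u = g u"
  shows "f = g"
  by (rule extensionalityI[of _ "carrier M"]) (use assms in \<open>auto simp: mod_hom_def PiE_def\<close>)

lemma mod_hom_zero:
  assumes "module R M" and "module R N" and "f \<in> mod_hom R M N"
  shows "f \<zero>\<^bsub>M\<^esub> = \<zero>\<^bsub>N\<^esub>"
proof -
  interpret M: module R M by fact
  interpret N: module R N by fact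
  have "f \<zero>\<^bsub>M\<^esub> = f (\<zero>\<^bsub>R\<^esub> \<odot>\<^bsub>M\<^esub> \<zero>\<^bsub>M\<^esub>)"
    by simp
  also have "\<dots> = \<zero>\<^bsub>R\<^esub> \<odot>\<^bsub>N\<^esub> f \<zero>\<^bsub>M\<^esub>"
    by (rule mod_hom_smult[OF assms(3)]) auto
  also have "\<dots> = \<zero>\<^bsub>N\<^esub>"
    using mod_hom_closed[OF assms(3)] by simp
  finally show ?thesis .
qed

lemma mod_hom_minus:
  assumes "module R M" and "module R N" and f: "f \<in> mod_hom R M N"
    and u: "u \<in> carrier M" and v: "v \<in> carrier M"
  shows "f (u \<ominus>\<^bsub>M\<^esub> v) = f u \<ominus>\<^bsub>N\<^esub> f v"
proof -
  interpret M: module R M by fact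
  interpret N: module R N by fact
  have neg: "\<ominus>\<^bsub>M\<^esub> v = (\<ominus>\<^bsub>R\<^esub> \<one>\<^bsub>R\<^esub>) \<odot>\<^bsub>M\<^esub> v"
    using v by (simp add: M.smult_l_minus)
  have "f (\<ominus>\<^bsub>M\<^esub> v) = \<ominus>\<^bsub>N\<^esub> f v"
    unfolding neg using v mod_hom_closed[OF f v]
    by (simp add: mod_hom_smult[OF f] N.smult_l_minus)
  then show ?thesis
    using u v by (simp add: a_minus_def mod_hom_add[OF f])
qed

lemma restrict_mod_hom:
  assumes "module R M"
    and "\<And>u. u \<in> carrier M \<Longrightarrow> f u \<in> carrier N"
    and "\<And>u v. u \<in> carrier M \<Longrightarrow> v \<in> carrier M \<Longrightarrow> f (u \<oplus>\<^bsub>M\<^esub> v) = f u \<oplus>\<^bsub>N\<^esub> f v"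
    and "\<And>r u. r \<in> carrier R \<Longrightarrow> u \<in> carrier M \<Longrightarrow> f (r \<odot>\<^bsub>M\<^esub> u) = r \<odot>\<^bsub>N\<^esub> f u"
  shows "restrict f (carrier M) \<in> mod_hom R M N"
proof -
  interpret M: module R M by fact
  show ?thesis
    by (rule mod_homI) (use assms in auto)
qed

lemma compose_mod_hom:
  assumes "module R M" and f: "f \<in> mod_hom R M N" and g: "g \<in> mod_hom R N P"
  shows "compose (carrier M) g f \<in> mod_hom R M P"
  unfolding compose_def
  by (rule restrict_mod_hom[OF assms(1)])
     (simp_all add: mod_hom_closed[OF f] mod_hom_closed[OF g] mod_hom_add[OF f] mod_hom_add[OF g]
        mod_hom_smult[OF f] mod_hom_smult[OF g])

lemma submoduleI':
  assumes "module R M" and "H \<subseteq> carrier M" and "\<zero>\<^bsub>M\<^esub> \<in> H"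
    and "\<And>a b. a \<in> H \<Longrightarrow> b \<in> H \<Longrightarrow> a \<oplus>\<^bsub>M\<^esub> b \<in> H"
    and smult: "\<And>r a. r \<in> carrier R \<Longrightarrow> a \<in> H \<Longrightarrow> r \<odot>\<^bsub>M\<^esub> a \<in> H"
  shows "submodule H R M"
proof -
  interpret M: module R M by fact
  have "\<ominus>\<^bsub>M\<^esub> a \<in> H" if a: "a \<in> H" for a
    using smult[of "\<ominus>\<^bsub>R\<^esub> \<one>\<^bsub>R\<^esub>" a] a assms(2) by (simp add: M.smult_l_minus subset_iff)
  then show ?thesis
    using assms by (intro M.submoduleI) auto
qed

lemma common_kernel_submodule:
  assumes M: "module R M" and N: "\<And>i. i \<in> I \<Longrightarrow> module R (N i)"
    and f: "\<And>i. i \<in> I \<Longrightarrow> f i \<in> mod_hom R M (N i)"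
  shows "submodule {u \<in> carrier M. \<forall>i \<in> I. f i u = \<zero>\<^bsub>N i\<^esub>} R M" (is "submodule ?K R M")
proof (rule submoduleI'[OF M])
  interpret M: module R M by fact
  show "\<zero>\<^bsub>M\<^esub> \<in> ?K"
    using mod_hom_zero[OF M N f] by simp
  show "r \<odot>\<^bsub>M\<^esub> u \<in> ?K" if "r \<in> carrier R" "u \<in> ?K" for r u
    using that mod_hom_smult[OF f] module.smult_r_null[OF N] by simp
  show "u \<oplus>\<^bsub>M\<^esub> v \<in> ?K" if "u \<in> ?K" "v \<in> ?K" for u v
  proof -
    have "f i (u \<oplus>\<^bsub>M\<^esub> v) = \<zero>\<^bsub>N i\<^esub>" if i: "i \<in> I" for i
    proof -
      interpret Ni: module R "N i" by (rule N[OF i])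
      show ?thesis
        using \<open>u \<in> ?K\<close> \<open>v \<in> ?K\<close> i by (simp add: mod_hom_add[OF f[OF i]])
    qed
    then show ?thesis using that by simp
  qed
qed auto

lemma kernel_submodule:
  assumes "module R M" and "module R N" and "f \<in> mod_hom R M N"
  shows "submodule {u \<in> carrier M. f u = \<zero>\<^bsub>N\<^esub>} R M"
  using common_kernel_submodule[OF assms(1), of "{()}" "\<lambda>_. N" "\<lambda>_. f"] assms(2,3) by simp

lemma image_submodule:
  assumes "module R M" and "module R N" and f: "f \<in> mod_hom R M N"
  shows "submodule (f ` carrier M) R N"
proof -
  interpret M: module R M by fact
  interpret N: module R N by fact
  show ?thesis
  proof (rule submoduleI'[OF assms(2)])
    show "f ` carrier M \<subseteq> carrier N"
      using mod_hom_closed[OF f] by auto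
    show "\<zero>\<^bsub>N\<^esub> \<in> f ` carrier M"
      using mod_hom_zero[OF assms] M.zero_closed by (metis imageI)
  next
    fix a b assume "a \<in> f ` carrier M" "b \<in> f ` carrier M"
    then show "a \<oplus>\<^bsub>N\<^esub> b \<in> f ` carrier M"
      using mod_hom_add[OF f] by (auto simp: image_iff) (metis M.a_closed)
  next
    fix r a assume "r \<in> carrier R" "a \<in> f ` carrier M"
    then show "r \<odot>\<^bsub>N\<^esub> a \<in> f ` carrier M"
      using mod_hom_smult[OF f] by (auto simp: image_iff) (metis M.smult_closed)
  qed
qed

text \<open>
  A map out of a quotient is read off on arbitrarily chosen preimages; \<open>lift_along q M Q h\<close> is the
  linear map through which \<open>h\<close> factors along \<open>q\<close> as soon as the kernel of \<open>q\<close> lies in that of \<open>h\<close>.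
\<close>

definition lift_along ::
  "('m \<Rightarrow> 'q) \<Rightarrow> ('r, 'm) module \<Rightarrow> ('r, 'q) module \<Rightarrow> ('m \<Rightarrow> 'n) \<Rightarrow> 'q \<Rightarrow> 'n" where
  "lift_along q M Q h = (\<lambda>v \<in> carrier Q. h (SOME m. m \<in> carrier M \<and> q m = v))"

lemma lift_along:
  assumes "module R M" and "module R Q" and "module R N"
    and q: "q \<in> mod_hom R M Q" and surj: "q ` carrier M = carrier Q"
    and h: "h \<in> mod_hom R M N"
    and ker: "\<And>m. m \<in> carrier M \<Longrightarrow> q m = \<zero>\<^bsub>Q\<^esub> \<Longrightarrow> h m = \<zero>\<^bsub>N\<^esub>"
  shows "lift_along q M Q h \<in> mod_hom R Q N"
    and "\<And>m. m \<in> carrier M \<Longrightarrow> lift_along q M Q h (q m) = h m"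
proof -
  interpret M: module R M by fact
  interpret Q: module R Q by fact
  interpret N: module R N by fact
  have const: "h m = h m'" if m: "m \<in> carrier M" "m' \<in> carrier M" and eq: "q m = q m'" for m m'
  proof -
    have "q (m \<ominus>\<^bsub>M\<^esub> m') = \<zero>\<^bsub>Q\<^esub>"
      unfolding mod_hom_minus[OF assms(1,2) q m] eq
      using m mod_hom_closed[OF q] by (simp add: a_minus_def Q.r_neg)
    then have "h m \<ominus>\<^bsub>N\<^esub> h m' = \<zero>\<^bsub>N\<^esub>"
      using ker[of "m \<ominus>\<^bsub>M\<^esub> m'"] m by (simp add: mod_hom_minus[OF assms(1,3) h])
    then show ?thesis
      using N.minus_equality[of "h m" "\<ominus>\<^bsub>N\<^esub> h m'"] mod_hom_closed[OF h] m
      by (simp add: a_minus_def)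
  qed
  show eval: "lift_along q M Q h (q m) = h m" if m: "m \<in> carrier M" for m
  proof -
    have "(SOME m'. m' \<in> carrier M \<and> q m' = q m) \<in> carrier M \<and>
          q (SOME m'. m' \<in> carrier M \<and> q m' = q m) = q m"
      by (rule someI[of _ m]) (use m in auto)
    then have "h (SOME m'. m' \<in> carrier M \<and> q m' = q m) = h m"
      using const m by blast
    then show ?thesis
      using mod_hom_closed[OF q m] by (simp add: lift_along_def)
  qed
  show "lift_along q M Q h \<in> mod_hom R Q N"
  proof (rule mod_homI)
    show "lift_along q M Q h \<in> extensional (carrier Q)"
      by (simp add: lift_along_def)
  next
    fix u assume "u \<in> carrier Q"
    then obtain a where "a \<in> carrier M" "u = q a"
      using surj by blast
    then show "lift_along q M Q h u \<in> carrier N"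
      using eval mod_hom_closed[OF h] by simp
  next
    fix u v assume "u \<in> carrier Q" "v \<in> carrier Q"
    then obtain a b where "a \<in> carrier M" "u = q a" "b \<in> carrier M" "v = q b"
      using surj by blast
    then show "lift_along q M Q h (u \<oplus>\<^bsub>Q\<^esub> v) = lift_along q M Q h u \<oplus>\<^bsub>N\<^esub> lift_along q M Q h v"
      using eval[of "a \<oplus>\<^bsub>M\<^esub> b"] by (simp add: eval mod_hom_add[OF q] mod_hom_add[OF h])
  next
    fix r u assume "r \<in> carrier R" "u \<in> carrier Q"
    moreover then obtain a where "a \<in> carrier M" "u = q a"
      using surj by blast
    ultimately show "lift_along q M Q h (r \<odot>\<^bsub>Q\<^esub> u) = r \<odot>\<^bsub>N\<^esub> lift_along q M Q h u"
      using eval[of "r \<odot>\<^bsub>M\<^esub> a"] by (simp add: eval mod_hom_smult[OF q] mod_hom_smult[OF h])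
  qed
qed

lemma (in abelian_group) minus_minus_cancel:
  assumes "a \<in> carrier G" and "b \<in> carrier G" and "c \<in> carrier G"
  shows "(a \<ominus> c) \<oplus> (\<ominus> (b \<ominus> c)) = a \<ominus> b"
proof -
  have "(a \<ominus> c) \<oplus> (\<ominus> (b \<ominus> c)) = a \<oplus> (\<ominus> c \<oplus> (\<ominus> b \<oplus> c))"
    using assms by (simp add: a_minus_def minus_add a_assoc a_comm[of c "\<ominus> b"])
  also have "\<dots> = a \<ominus> b"
    using assms by (simp add: a_minus_def a_comm[of "\<ominus> b" c] r_neg1)
  finally show ?thesis .
qed

text \<open>
  The quotient has to be realised inside the universe, so cosets are not an option. A representative
  is chosen in every coset and the representatives are transported along an embedding of \<open>M\<close> into a
  member of the universe. Thus \<open>M\<close> itself may live in any type, which allows quotients of the free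
  modules on hom sets.
\<close>

lemma quotient_module_exists:
  fixes M :: "('r, 'm) module" and \<U> :: "'u set set"
  assumes "universe \<U>" and "module R M" and "submodule N R M" and "small \<U> (carrier M)"
  shows "\<exists>(Q :: ('r, 'u) module) q. module R Q \<and> carrier Q \<in> \<U> \<and> q \<in> mod_hom R M Q \<and>
    q ` carrier M = carrier Q \<and> (\<forall>m \<in> carrier M. q m = \<zero>\<^bsub>Q\<^esub> \<longleftrightarrow> m \<in> N)"
proof -
  interpret M: module R M by fact
  interpret N: submodule N R M by fact
  note subN = M.submoduleE[OF assms(3)]
  obtain Y e where Y: "Y \<in> \<U>" and inj: "inj_on e (carrier M)" and e: "e ` carrier M \<subseteq> Y"
    using assms(4) unfolding small_def lepoll_def by blast
  define rep where "rep m = (SOME m'. m' \<in> carrier M \<and> m \<ominus>\<^bsub>M\<^esub> m' \<in> N)" for m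
  have zeroN: "\<zero>\<^bsub>M\<^esub> \<in> N"
    using N.one_closed by simp
  have rep: "rep m \<in> carrier M \<and> m \<ominus>\<^bsub>M\<^esub> rep m \<in> N" if "m \<in> carrier M" for m
    unfolding rep_def
    by (rule someI[of _ m]) (use that zeroN in \<open>simp add: a_minus_def M.r_neg\<close>)
  have rep_cong: "rep m = rep m'"
    if m: "m \<in> carrier M" "m' \<in> carrier M" and d: "m \<ominus>\<^bsub>M\<^esub> m' \<in> N" for m m'
  proof -
    have "m \<ominus>\<^bsub>M\<^esub> z \<in> N \<longleftrightarrow> m' \<ominus>\<^bsub>M\<^esub> z \<in> N" if z: "z \<in> carrier M" for z
    proof
      assume "m \<ominus>\<^bsub>M\<^esub> z \<in> N"
      then have "(\<ominus>\<^bsub>M\<^esub> (m \<ominus>\<^bsub>M\<^esub> m')) \<oplus>\<^bsub>M\<^esub> (m \<ominus>\<^bsub>M\<^esub> z) \<in> N"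
        using d subN(3,5) by blast
      moreover have "(\<ominus>\<^bsub>M\<^esub> (m \<ominus>\<^bsub>M\<^esub> m')) \<oplus>\<^bsub>M\<^esub> (m \<ominus>\<^bsub>M\<^esub> z) = m' \<ominus>\<^bsub>M\<^esub> z"
        using m z by (simp add: a_minus_def M.minus_add M.a_ac M.r_neg1 M.r_neg2 M.l_neg)
      ultimately show "m' \<ominus>\<^bsub>M\<^esub> z \<in> N" by simp
    next
      assume "m' \<ominus>\<^bsub>M\<^esub> z \<in> N"
      then have "(m \<ominus>\<^bsub>M\<^esub> m') \<oplus>\<^bsub>M\<^esub> (m' \<ominus>\<^bsub>M\<^esub> z) \<in> N"
        using d subN(5) by blast
      moreover have "(m \<ominus>\<^bsub>M\<^esub> m') \<oplus>\<^bsub>M\<^esub> (m' \<ominus>\<^bsub>M\<^esub> z) = m \<ominus>\<^bsub>M\<^esub> z"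
        using m z by (simp add: a_minus_def M.a_ac M.r_neg1 M.r_neg2)
      ultimately show "m \<ominus>\<^bsub>M\<^esub> z \<in> N" by simp
    qed
    then show ?thesis
      unfolding rep_def by (auto intro: arg_cong[where f = Eps])
  qed
  define q where "q = (\<lambda>m \<in> carrier M. e (rep m))"
  have q_eq: "q m = q m' \<longleftrightarrow> m \<ominus>\<^bsub>M\<^esub> m' \<in> N"
    if m: "m \<in> carrier M" "m' \<in> carrier M" for m m'
  proof
    assume "q m = q m'"
    then have eq: "rep m = rep m'"
      using inj rep m by (auto simp: q_def inj_on_def)
    have "(m \<ominus>\<^bsub>M\<^esub> rep m) \<oplus>\<^bsub>M\<^esub> (\<ominus>\<^bsub>M\<^esub> (m' \<ominus>\<^bsub>M\<^esub> rep m')) \<in> N"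
      using rep m subN(3,5) by blast
    moreover have "(m \<ominus>\<^bsub>M\<^esub> rep m) \<oplus>\<^bsub>M\<^esub> (\<ominus>\<^bsub>M\<^esub> (m' \<ominus>\<^bsub>M\<^esub> rep m')) = m \<ominus>\<^bsub>M\<^esub> m'"
      using m rep[of m'] unfolding eq by (intro M.minus_minus_cancel) auto
    ultimately show "m \<ominus>\<^bsub>M\<^esub> m' \<in> N" by simp
  next
    assume "m \<ominus>\<^bsub>M\<^esub> m' \<in> N"
    then show "q m = q m'"
      using m rep_cong[OF m] by (simp add: q_def)
  qed
  define s where "s v = (SOME m. m \<in> carrier M \<and> q m = v)" for v
  have s: "s (q m) \<in> carrier M" "q (s (q m)) = q m" if "m \<in> carrier M" for m
    using someI[of "\<lambda>m'. m' \<in> carrier M \<and> q m' = q m" m] that by (auto simp: s_def)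
  have q_add: "q (s (q m) \<oplus>\<^bsub>M\<^esub> s (q m')) = q (m \<oplus>\<^bsub>M\<^esub> m')"
    if m: "m \<in> carrier M" "m' \<in> carrier M" for m m'
  proof -
    have "s (q m) \<ominus>\<^bsub>M\<^esub> m \<in> N" "s (q m') \<ominus>\<^bsub>M\<^esub> m' \<in> N"
      using s m q_eq by auto
    then have "(s (q m) \<ominus>\<^bsub>M\<^esub> m) \<oplus>\<^bsub>M\<^esub> (s (q m') \<ominus>\<^bsub>M\<^esub> m') \<in> N"
      by (rule subN(5))
    moreover have "(s (q m) \<ominus>\<^bsub>M\<^esub> m) \<oplus>\<^bsub>M\<^esub> (s (q m') \<ominus>\<^bsub>M\<^esub> m') =
      (s (q m) \<oplus>\<^bsub>M\<^esub> s (q m')) \<ominus>\<^bsub>M\<^esub> (m \<oplus>\<^bsub>M\<^esub> m')"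
      using s m by (simp add: a_minus_def M.minus_add M.a_ac)
    ultimately show ?thesis
      using s m by (subst q_eq) auto
  qed
  have q_smult: "q (r \<odot>\<^bsub>M\<^esub> s (q m)) = q (r \<odot>\<^bsub>M\<^esub> m)"
    if r: "r \<in> carrier R" and m: "m \<in> carrier M" for r m
  proof -
    have "s (q m) \<ominus>\<^bsub>M\<^esub> m \<in> N"
      using s m q_eq by auto
    then have "r \<odot>\<^bsub>M\<^esub> (s (q m) \<ominus>\<^bsub>M\<^esub> m) \<in> N"
      using r by (intro subN(4))
    moreover have "r \<odot>\<^bsub>M\<^esub> (s (q m) \<ominus>\<^bsub>M\<^esub> m) = (r \<odot>\<^bsub>M\<^esub> s (q m)) \<ominus>\<^bsub>M\<^esub> (r \<odot>\<^bsub>M\<^esub> m)"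
      using s m r by (simp add: a_minus_def M.smult_r_distr M.smult_r_minus)
    ultimately show ?thesis
      using s m r by (subst q_eq) auto
  qed
  define Q :: "('r, 'u) module" where
    "Q = \<lparr>carrier = q ` carrier M, mult = undefined, one = undefined, zero = q \<zero>\<^bsub>M\<^esub>,
      add = (\<lambda>u v. q (s u \<oplus>\<^bsub>M\<^esub> s v)), smult = (\<lambda>r u. q (r \<odot>\<^bsub>M\<^esub> s u))\<rparr>"
  have Qsimps [simp]: "carrier Q = q ` carrier M" "\<zero>\<^bsub>Q\<^esub> = q \<zero>\<^bsub>M\<^esub>"
    by (simp_all add: Q_def)
  have Qadd [simp]: "q m \<oplus>\<^bsub>Q\<^esub> q m' = q (m \<oplus>\<^bsub>M\<^esub> m')"
    if "m \<in> carrier M" "m' \<in> carrier M" for m m'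
    using q_add that by (simp add: Q_def)
  have Qsmult [simp]: "r \<odot>\<^bsub>Q\<^esub> q m = q (r \<odot>\<^bsub>M\<^esub> m)"
    if "r \<in> carrier R" "m \<in> carrier M" for r m
    using q_smult that by (simp add: Q_def)
  have "module R Q"
  proof (rule moduleI)
    show "cring R" by (rule M.is_cring)
    show "abelian_group Q"
    proof (rule abelian_groupI)
      fix x assume "x \<in> carrier Q"
      then obtain m where m: "m \<in> carrier M" "x = q m" by auto
      show "\<exists>y\<in>carrier Q. y \<oplus>\<^bsub>Q\<^esub> x = \<zero>\<^bsub>Q\<^esub>"
        by (rule bexI[of _ "q (\<ominus>\<^bsub>M\<^esub> m)"]) (use m in \<open>auto simp: M.l_neg\<close>)
    qed (auto simp: M.a_ac)
  qed (auto simp: M.smult_l_distr M.smult_r_distr M.smult_assoc1)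
  moreover have "carrier Q \<in> \<U>"
  proof -
    have "carrier Q \<subseteq> Y"
      using rep e by (auto simp: q_def)
    then show ?thesis
      using assms(1) Y unfolding universe_def by blast
  qed
  moreover have "q \<in> mod_hom R M Q"
  proof (rule mod_homI)
    show "q \<in> extensional (carrier M)" by (simp add: q_def)
  qed auto
  moreover have "\<forall>m \<in> carrier M. q m = \<zero>\<^bsub>Q\<^esub> \<longleftrightarrow> m \<in> N"
  proof
    fix m assume m: "m \<in> carrier M"
    then have "m \<ominus>\<^bsub>M\<^esub> \<zero>\<^bsub>M\<^esub> = m"
      using M.add.inv_one by (simp add: a_minus_def a_inv_def)
    then show "q m = \<zero>\<^bsub>Q\<^esub> \<longleftrightarrow> m \<in> N"
      using m by (simp add: q_eq)
  qed
  ultimately show ?thesis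
    by (intro exI[of _ Q] exI[of _ q]) auto
qed

section \<open>Free modules\<close>

lemma carrier_free_moduleD:
  assumes "c \<in> carrier (free_module R X)"
  shows "c x \<in> carrier R" and "finite {x. c x \<noteq> \<zero>\<^bsub>R\<^esub>}" and "{x. c x \<noteq> \<zero>\<^bsub>R\<^esub>} \<subseteq> X"
    and "x \<notin> X \<Longrightarrow> c x = \<zero>\<^bsub>R\<^esub>"
  using assms by (auto simp: free_module_def)

lemma carrier_free_moduleI:
  assumes "\<And>x. c x \<in> carrier R" and "\<And>x. x \<notin> X \<Longrightarrow> c x = \<zero>\<^bsub>R\<^esub>"
    and "finite S" and "\<And>x. x \<notin> S \<Longrightarrow> c x = \<zero>\<^bsub>R\<^esub>"
  shows "c \<in> carrier (free_module R X)"
proof -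
  have "finite {x. c x \<noteq> \<zero>\<^bsub>R\<^esub>}"
    by (rule finite_subset[OF _ assms(3)]) (use assms(4) in auto)
  then show ?thesis
    using assms(1,2) by (auto simp: free_module_def)
qed

lemma free_module_simps:
  "\<zero>\<^bsub>free_module R X\<^esub> = (\<lambda>x. \<zero>\<^bsub>R\<^esub>)"
  "c \<oplus>\<^bsub>free_module R X\<^esub> d = (\<lambda>x. c x \<oplus>\<^bsub>R\<^esub> d x)"
  "r \<odot>\<^bsub>free_module R X\<^esub> c = (\<lambda>x. r \<otimes>\<^bsub>R\<^esub> c x)"
  by (simp_all add: free_module_def)

lemma module_free_module:
  assumes "cring R"
  shows "module R (free_module R X)"
proof -
  let ?F = "free_module R X"
  interpret R: cring R by fact
  note D = carrier_free_moduleD[where R = R and X = X]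
  have add: "(\<lambda>x. c x \<oplus>\<^bsub>R\<^esub> d x) \<in> carrier ?F"
    if "c \<in> carrier ?F" "d \<in> carrier ?F" for c d
    by (rule carrier_free_moduleI[where S = "{x. c x \<noteq> \<zero>\<^bsub>R\<^esub>} \<union> {x. d x \<noteq> \<zero>\<^bsub>R\<^esub>}"])
       (use D[OF that(1)] D[OF that(2)] in auto)
  have smult: "(\<lambda>x. r \<otimes>\<^bsub>R\<^esub> c x) \<in> carrier ?F"
    if "r \<in> carrier R" "c \<in> carrier ?F" for r c
    by (rule carrier_free_moduleI[where S = "{x. c x \<noteq> \<zero>\<^bsub>R\<^esub>}"]) (use that D[OF that(2)] in auto)
  have neg: "(\<lambda>x. \<ominus>\<^bsub>R\<^esub> c x) \<in> carrier ?F"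
    if "c \<in> carrier ?F" for c
    by (rule carrier_free_moduleI[where S = "{x. c x \<noteq> \<zero>\<^bsub>R\<^esub>}"]) (use that D[OF that] in auto)
  have zero: "(\<lambda>x. \<zero>\<^bsub>R\<^esub>) \<in> carrier ?F"
    by (rule carrier_free_moduleI[where S = "{}"]) auto
  show ?thesis
  proof (rule moduleI)
    show "abelian_group ?F"
    proof (rule abelian_groupI)
      fix c assume c: "c \<in> carrier ?F"
      show "\<exists>d\<in>carrier ?F. d \<oplus>\<^bsub>?F\<^esub> c = \<zero>\<^bsub>?F\<^esub>"
        by (rule bexI[OF _ neg[OF c]]) (use D(1)[OF c] in \<open>simp add: free_module_simps R.l_neg\<close>)
      show "\<zero>\<^bsub>?F\<^esub> \<oplus>\<^bsub>?F\<^esub> c = c"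
        using D(1)[OF c] by (simp add: free_module_simps)
      fix d assume d: "d \<in> carrier ?F"
      show "c \<oplus>\<^bsub>?F\<^esub> d \<in> carrier ?F"
        using add[OF c d] by (simp add: free_module_simps)
      show "c \<oplus>\<^bsub>?F\<^esub> d = d \<oplus>\<^bsub>?F\<^esub> c"
        using D(1)[OF c] D(1)[OF d] by (simp add: free_module_simps R.a_comm)
      fix e assume e: "e \<in> carrier ?F"
      show "c \<oplus>\<^bsub>?F\<^esub> d \<oplus>\<^bsub>?F\<^esub> e = c \<oplus>\<^bsub>?F\<^esub> (d \<oplus>\<^bsub>?F\<^esub> e)"
        using D(1)[OF c] D(1)[OF d] D(1)[OF e] by (simp add: free_module_simps R.a_assoc)
    qed (use zero in \<open>simp add: free_module_simps\<close>)
  next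
    fix r c assume r: "r \<in> carrier R" and c: "c \<in> carrier ?F"
    show "r \<odot>\<^bsub>?F\<^esub> c \<in> carrier ?F"
      using smult[OF r c] by (simp add: free_module_simps)
    fix s assume s: "s \<in> carrier R"
    show "(r \<oplus>\<^bsub>R\<^esub> s) \<odot>\<^bsub>?F\<^esub> c =
      r \<odot>\<^bsub>?F\<^esub> c \<oplus>\<^bsub>?F\<^esub> s \<odot>\<^bsub>?F\<^esub> c"
      using D(1)[OF c] r s by (simp add: free_module_simps R.l_distr)
    show "(r \<otimes>\<^bsub>R\<^esub> s) \<odot>\<^bsub>?F\<^esub> c =
      r \<odot>\<^bsub>?F\<^esub> (s \<odot>\<^bsub>?F\<^esub> c)"
      using D(1)[OF c] r s by (simp add: free_module_simps R.m_assoc)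
  next
    fix c assume c: "c \<in> carrier ?F"
    show "\<one>\<^bsub>R\<^esub> \<odot>\<^bsub>?F\<^esub> c = c"
      using D(1)[OF c] by (simp add: free_module_simps)
  next
    fix r c d assume r: "r \<in> carrier R" and c: "c \<in> carrier ?F"
      and d: "d \<in> carrier ?F"
    show "r \<odot>\<^bsub>?F\<^esub> (c \<oplus>\<^bsub>?F\<^esub> d) =
      r \<odot>\<^bsub>?F\<^esub> c \<oplus>\<^bsub>?F\<^esub> r \<odot>\<^bsub>?F\<^esub> d"
      using D(1)[OF c] D(1)[OF d] r by (simp add: free_module_simps R.r_distr)
  qed (fact assms)
qed

lemma free_gen_in:
  assumes "cring R" and "x \<in> X"
  shows "free_gen R x \<in> carrier (free_module R X)"
proof -
  interpret R: cring R by fact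
  show ?thesis
    by (rule carrier_free_moduleI[where S = "{x}"]) (use assms in \<open>auto simp: free_gen_def\<close>)
qed

text \<open>
  Induction on the size of the support: \<open>c\<close> is its value at a point times the generator plus an
  element with one point less in its support.
\<close>

lemma free_module_induct [consumes 2, case_names zero add smult gen]:
  fixes R :: "'r ring" and X :: "'x set"
  assumes "cring R" and "c \<in> carrier (free_module R X)"
    and zero: "P \<zero>\<^bsub>free_module R X\<^esub>"
    and add: "\<And>c d. c \<in> carrier (free_module R X) \<Longrightarrow> d \<in> carrier (free_module R X) \<Longrightarrow>
      P c \<Longrightarrow> P d \<Longrightarrow> P (c \<oplus>\<^bsub>free_module R X\<^esub> d)"
    and smult: "\<And>r c. r \<in> carrier R \<Longrightarrow> c \<in> carrier (free_module R X) \<Longrightarrow> P c \<Longrightarrow>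
      P (r \<odot>\<^bsub>free_module R X\<^esub> c)"
    and gen: "\<And>x. x \<in> X \<Longrightarrow> P (free_gen R x)"
  shows "P c"
proof -
  let ?F = "free_module R X"
  interpret R: cring R by fact
  have "\<forall>c \<in> carrier ?F. {x. c x \<noteq> \<zero>\<^bsub>R\<^esub>} = S \<longrightarrow> P c" if "finite S" for S
    using that
  proof (induction S rule: finite_induct)
    case empty
    show ?case
    proof (intro ballI impI)
      fix c :: "'x \<Rightarrow> 'r" assume "{x. c x \<noteq> \<zero>\<^bsub>R\<^esub>} = {}"
      then have "c = \<zero>\<^bsub>?F\<^esub>"
        by (auto simp: free_module_simps)
      then show "P c" using zero by simp
    qed
  next
    case (insert y S)
    show ?case
    proof (intro ballI impI)
      fix c assume c: "c \<in> carrier ?F" and supp: "{x. c x \<noteq> \<zero>\<^bsub>R\<^esub>} = insert y S"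
      note D = carrier_free_moduleD[OF c]
      define d where "d = c(y := \<zero>\<^bsub>R\<^esub>)"
      have y: "y \<in> X"
        using supp D(3) by blast
      have d: "d \<in> carrier ?F"
        by (rule carrier_free_moduleI[where S = "{x. c x \<noteq> \<zero>\<^bsub>R\<^esub>}"]) (use D in \<open>auto simp: d_def\<close>)
      have "{x. d x \<noteq> \<zero>\<^bsub>R\<^esub>} = S"
        using supp insert.hyps by (auto simp: d_def)
      then have "P d"
        using insert.IH d by blast
      moreover have "P (c y \<odot>\<^bsub>?F\<^esub> free_gen R y)"
        using D(1) y by (intro smult gen free_gen_in assms(1))
      moreover have "c = (c y \<odot>\<^bsub>?F\<^esub> free_gen R y) \<oplus>\<^bsub>?F\<^esub> d"
        using D(1) by (auto simp: free_module_simps free_gen_def d_def)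
      moreover have "c y \<odot>\<^bsub>?F\<^esub> free_gen R y \<in> carrier ?F"
        using D(1) y
        by (intro module.smult_closed[OF module_free_module[OF assms(1)]] free_gen_in assms(1))
      ultimately show "P c"
        using add[of "c y \<odot>\<^bsub>?F\<^esub> free_gen R y" d] d by simp
    qed
  qed
  then show ?thesis
    using assms(2) carrier_free_moduleD(2)[OF assms(2)] by blast
qed

lemma mod_hom_free_ext:
  assumes "cring R" and "module R M"
    and f: "f \<in> mod_hom R (free_module R X) M" and g: "g \<in> mod_hom R (free_module R X) M"
    and "\<And>x. x \<in> X \<Longrightarrow> f (free_gen R x) = g (free_gen R x)"
  shows "f = g"
proof (rule mod_hom_ext[OF f g])
  note free = module_free_module[OF assms(1)]
  fix c assume "c \<in> carrier (free_module R X)"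
  with \<open>cring R\<close> show "f c = g c"
  proof (induction rule: free_module_induct)
    case zero
    show ?case by (simp add: mod_hom_zero[OF free assms(2) f] mod_hom_zero[OF free assms(2) g])
  next
    case (add c d)
    then show ?case by (simp add: mod_hom_add[OF f] mod_hom_add[OF g])
  next
    case (smult r c)
    then show ?case by (simp add: mod_hom_smult[OF f] mod_hom_smult[OF g])
  qed (fact assms)
qed

definition free_lift ::
  "'r ring \<Rightarrow> 'x set \<Rightarrow> ('r, 'm) module \<Rightarrow> ('x \<Rightarrow> 'm) \<Rightarrow> ('x \<Rightarrow> 'r) \<Rightarrow> 'm" where
  "free_lift R X M h = (\<lambda>c \<in> carrier (free_module R X).
     \<Oplus>\<^bsub>M\<^esub>x \<in> {x. c x \<noteq> \<zero>\<^bsub>R\<^esub>}. c x \<odot>\<^bsub>M\<^esub> h x)"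

lemma free_lift:
  assumes "module R M" and h: "h \<in> X \<rightarrow> carrier M"
  shows "free_lift R X M h \<in> mod_hom R (free_module R X) M"
    and "\<And>x. x \<in> X \<Longrightarrow> free_lift R X M h (free_gen R x) = h x"
proof -
  let ?F = "free_module R X"
  interpret M: module R M by fact
  note D = carrier_free_moduleD
  have R: "cring R" by (rule M.is_cring)
  interpret F: module R "free_module R X" by (rule module_free_module[OF R])
  have summand: "c x \<odot>\<^bsub>M\<^esub> h x \<in> carrier M" if "c \<in> carrier ?F" "x \<in> X" for c x
    using h that(2) D(1)[OF that(1)] by auto
  have expand: "free_lift R X M h c = (\<Oplus>\<^bsub>M\<^esub>x \<in> S. c x \<odot>\<^bsub>M\<^esub> h x)"
    if c: "c \<in> carrier ?F" and S: "finite S" "S \<subseteq> X" "{x. c x \<noteq> \<zero>\<^bsub>R\<^esub>} \<subseteq> S" for c S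
  proof -
    have hS: "h x \<in> carrier M" if "x \<in> S" for x
      using that S h by auto
    have "(\<Oplus>\<^bsub>M\<^esub>x \<in> {x. c x \<noteq> \<zero>\<^bsub>R\<^esub>}. c x \<odot>\<^bsub>M\<^esub> h x) = (\<Oplus>\<^bsub>M\<^esub>x \<in> S. c x \<odot>\<^bsub>M\<^esub> h x)"
      by (rule M.add.finprod_mono_neutral_cong_left) (use S hS D(1)[OF c] in auto)
    then show ?thesis
      by (simp add: free_lift_def c)
  qed
  show "free_lift R X M h (free_gen R x) = h x" if x: "x \<in> X" for x
  proof -
    have "free_lift R X M h (free_gen R x) = (\<Oplus>\<^bsub>M\<^esub>y \<in> {x}. free_gen R x y \<odot>\<^bsub>M\<^esub> h y)"
      by (rule expand[OF free_gen_in[OF R x]]) (use x in \<open>auto simp: free_gen_def\<close>)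
    also have "\<dots> = h x"
      using funcset_mem[OF h x] by (simp add: free_gen_def)
    finally show ?thesis .
  qed
  show "free_lift R X M h \<in> mod_hom R ?F M"
  proof (rule mod_homI)
    show "free_lift R X M h \<in> extensional (carrier ?F)"
      by (simp add: free_lift_def)
  next
    fix c assume c: "c \<in> carrier ?F"
    show "free_lift R X M h c \<in> carrier M"
      using summand[OF c] D(3)[OF c] by (simp add: free_lift_def c) (intro M.finsum_closed, auto)
  next
    fix c d assume c: "c \<in> carrier ?F" and d: "d \<in> carrier ?F"
    define S where "S = {x. c x \<noteq> \<zero>\<^bsub>R\<^esub>} \<union> {x. d x \<noteq> \<zero>\<^bsub>R\<^esub>}"
    have S: "finite S" "S \<subseteq> X"
      using D(2,3)[OF c] D(2,3)[OF d] by (auto simp: S_def)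
    have hS: "h x \<in> carrier M" if "x \<in> S" for x
      using that S h by auto
    have "free_lift R X M h (c \<oplus>\<^bsub>?F\<^esub> d) =
      (\<Oplus>\<^bsub>M\<^esub>x \<in> S. (c \<oplus>\<^bsub>?F\<^esub> d) x \<odot>\<^bsub>M\<^esub> h x)"
      by (rule expand[OF F.M.a_closed[OF c d] S])
         (use D(1)[OF c] D(1)[OF d] in \<open>auto simp: free_module_simps S_def\<close>)
    also have "\<dots> = (\<Oplus>\<^bsub>M\<^esub>x \<in> S. c x \<odot>\<^bsub>M\<^esub> h x \<oplus>\<^bsub>M\<^esub> d x \<odot>\<^bsub>M\<^esub> h x)"
      using hS D(1)[OF c] D(1)[OF d]
      by (intro M.finsum_cong') (auto simp: free_module_simps M.smult_l_distr)
    also have "\<dots> = (\<Oplus>\<^bsub>M\<^esub>x \<in> S. c x \<odot>\<^bsub>M\<^esub> h x) \<oplus>\<^bsub>M\<^esub> (\<Oplus>\<^bsub>M\<^esub>x \<in> S. d x \<odot>\<^bsub>M\<^esub> h x)"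
      using hS D(1)[OF c] D(1)[OF d] by (intro M.finsum_addf) auto
    also have "\<dots> = free_lift R X M h c \<oplus>\<^bsub>M\<^esub> free_lift R X M h d"
      using c d S expand[of c S] expand[of d S] by (auto simp: S_def)
    finally show "free_lift R X M h (c \<oplus>\<^bsub>?F\<^esub> d) =
      free_lift R X M h c \<oplus>\<^bsub>M\<^esub> free_lift R X M h d" .
  next
    fix r c assume r: "r \<in> carrier R" and c: "c \<in> carrier ?F"
    define S where "S = {x. c x \<noteq> \<zero>\<^bsub>R\<^esub>}"
    have S: "finite S" "S \<subseteq> X"
      using D(2,3)[OF c] by (auto simp: S_def)
    have hS: "h x \<in> carrier M" if "x \<in> S" for x
      using that S h by auto
    have "free_lift R X M h (r \<odot>\<^bsub>?F\<^esub> c) =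
      (\<Oplus>\<^bsub>M\<^esub>x \<in> S. (r \<odot>\<^bsub>?F\<^esub> c) x \<odot>\<^bsub>M\<^esub> h x)"
      by (rule expand[OF F.smult_closed[OF r c] S])
         (use r D(1)[OF c] in \<open>auto simp: free_module_simps S_def\<close>)
    also have "\<dots> = (\<Oplus>\<^bsub>M\<^esub>x \<in> S. r \<odot>\<^bsub>M\<^esub> (c x \<odot>\<^bsub>M\<^esub> h x))"
      using hS D(1)[OF c] r by (intro M.finsum_cong') (auto simp: free_module_simps M.smult_assoc1)
    also have "\<dots> = r \<odot>\<^bsub>M\<^esub> (\<Oplus>\<^bsub>M\<^esub>x \<in> S. c x \<odot>\<^bsub>M\<^esub> h x)"
      using hS D(1)[OF c] r S by (intro M.finsum_smult_ldistr[symmetric]) auto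
    also have "\<dots> = r \<odot>\<^bsub>M\<^esub> free_lift R X M h c"
      using c S expand[of c S] by (auto simp: S_def)
    finally show "free_lift R X M h (r \<odot>\<^bsub>?F\<^esub> c) = r \<odot>\<^bsub>M\<^esub> free_lift R X M h c" .
  qed
qed

lemma finsum_free_module_apply:
  assumes "cring R" and "finite S" and "g \<in> S \<rightarrow> carrier (free_module R Y)"
  shows "(\<Oplus>\<^bsub>free_module R Y\<^esub>x \<in> S. g x) y = (\<Oplus>\<^bsub>R\<^esub>x \<in> S. g x y)"
proof -
  interpret R: cring R by fact
  interpret F: module R "free_module R Y" by (rule module_free_module) fact
  show ?thesis
    using assms(2,3)
  proof (induction S rule: finite_induct)
    case empty
    then show ?case by (simp add: free_module_simps)
  next
    case (insert x S)
    then show ?case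
      using carrier_free_moduleD(1)[where R = R and X = Y]
      by (simp add: free_module_simps Pi_iff)
  qed
qed

text \<open>
  The functoriality of free modules becomes an instance of their universal property, so that equations
  between such maps can be checked on generators.
\<close>

lemma free_map_eq_free_lift:
  assumes "cring R" and h: "h \<in> X \<rightarrow> Y"
  shows "free_map R X h = free_lift R X (free_module R Y) (\<lambda>x. free_gen R (h x))"
proof (rule ext)
  interpret R: cring R by fact
  interpret F: module R "free_module R Y" by (rule module_free_module) fact
  fix c
  show "free_map R X h c = free_lift R X (free_module R Y) (\<lambda>x. free_gen R (h x)) c"
  proof (cases "c \<in> carrier (free_module R X)")
    case False
    then show ?thesis by (simp add: free_map_def free_lift_def)
  next
    case True
    note D = carrier_free_moduleD[OF True]
    have in_X: "x \<in> X" if "c x \<noteq> \<zero>\<^bsub>R\<^esub>" for x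
      using that D(4) by blast
    show ?thesis
    proof (rule ext)
      fix y
      have "(\<Oplus>\<^bsub>free_module R Y\<^esub>x \<in> {x. c x \<noteq> \<zero>\<^bsub>R\<^esub>}. c x \<odot>\<^bsub>free_module R Y\<^esub> free_gen R (h x)) y
        = (\<Oplus>\<^bsub>R\<^esub>x \<in> {x. c x \<noteq> \<zero>\<^bsub>R\<^esub>}. (c x \<odot>\<^bsub>free_module R Y\<^esub> free_gen R (h x)) y)"
      proof (rule finsum_free_module_apply[OF assms(1) D(2)])
        show "(\<lambda>x. c x \<odot>\<^bsub>free_module R Y\<^esub> free_gen R (h x)) \<in>
          {x. c x \<noteq> \<zero>\<^bsub>R\<^esub>} \<rightarrow> carrier (free_module R Y)"
          using D(1) in_X h by (auto intro!: F.smult_closed free_gen_in assms(1))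
      qed
      also have "\<dots> = (\<Oplus>\<^bsub>R\<^esub>x \<in> {x. c x \<noteq> \<zero>\<^bsub>R\<^esub> \<and> h x = y}. c x)"
        by (rule R.add.finprod_mono_neutral_cong_right)
           (use D in \<open>auto simp: free_module_simps free_gen_def\<close>)
      finally show "free_map R X h c y =
        free_lift R X (free_module R Y) (\<lambda>x. free_gen R (h x)) c y"
        using True by (simp add: free_map_def free_lift_def)
    qed
  qed
qed

lemma free_map:
  assumes "cring R" and h: "h \<in> X \<rightarrow> Y"
  shows "free_map R X h \<in> mod_hom R (free_module R X) (free_module R Y)"
    and "\<And>x. x \<in> X \<Longrightarrow> free_map R X h (free_gen R x) = free_gen R (h x)"
proof -
  have "(\<lambda>x. free_gen R (h x)) \<in> X \<rightarrow> carrier (free_module R Y)"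
    using h by (auto intro: free_gen_in assms(1))
  note * = free_lift[OF module_free_module[OF assms(1)] this]
  show "free_map R X h \<in> mod_hom R (free_module R X) (free_module R Y)"
    and "\<And>x. x \<in> X \<Longrightarrow> free_map R X h (free_gen R x) = free_gen R (h x)"
    using * by (simp_all add: free_map_eq_free_lift[OF assms])
qed

subsection \<open>The size of a free module\<close>

lemma lepoll_iff_card_of: "A \<lesssim> B \<longleftrightarrow> (card_of A, card_of B) \<in> ordLeq"
  unfolding lepoll_def card_of_ordLeq ..

lemma times_lepoll_infinite:
  assumes "infinite Z" and "A \<lesssim> Z" and "B \<lesssim> Z"
  shows "A \<times> B \<lesssim> Z"
  using assms card_of_Sigma_ordLeq_infinite[of Z A "\<lambda>_. B"] by (simp add: lepoll_iff_card_of)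

text \<open>
  By induction the lists of a fixed length inject into \<open>Z\<close>, because \<open>Z \<times> Z\<close> does; the union over the
  countably many lengths is then no larger than \<open>Z\<close>.
\<close>

lemma lists_lepoll_infinite:
  assumes Z: "infinite Z" and A: "A \<lesssim> Z"
  shows "lists A \<lesssim> Z"
proof -
  have len: "{xs \<in> lists A. length xs = n} \<lesssim> Z" for n
  proof (induction n)
    case 0
    have "{xs \<in> lists A. length xs = 0} = {[]}" by auto
    then show ?case
      using Z finite_lepoll_infinite[of Z "{[]}"] by simp
  next
    case (Suc n)
    have "{xs \<in> lists A. length xs = Suc n} \<subseteq>
      (\<lambda>(x, xs). x # xs) ` (A \<times> {xs \<in> lists A. length xs = n})"
      by (auto simp: length_Suc_conv)
    then have "{xs \<in> lists A. length xs = Suc n} \<lesssim> A \<times> {xs \<in> lists A. length xs = n}"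
      by (rule subset_image_lepoll)
    then show ?case
      using times_lepoll_infinite[OF Z A Suc] lepoll_trans by blast
  qed
  have "(card_of (\<Union>n. {xs \<in> lists A. length xs = n}), card_of Z) \<in> ordLeq"
    using Z len by (intro card_of_UNION_ordLeq_infinite)
      (auto simp: lepoll_iff_card_of simp flip: infinite_iff_card_of_nat)
  moreover have "(\<Union>n. {xs \<in> lists A. length xs = n}) = lists A"
    by auto
  ultimately show ?thesis
    by (simp add: lepoll_iff_card_of)
qed

text \<open>
  Families in a universe are indexed by its members, so a binary union is taken over an infinite member
  with one index singled out.
\<close>

lemma universe_Un:
  assumes "universe \<U>" and "X \<in> \<U>" and "Y \<in> \<U>"
  shows "X \<union> Y \<in> \<U>"
proof -
  from assms(1) obtain I where I: "I \<in> \<U>" "infinite I"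
    unfolding universe_def by blast
  then obtain i where "i \<in> I"
    by (metis finite.emptyI equals0I)
  moreover obtain j where "j \<in> I" "j \<noteq> i"
    using I(2) by (metis finite.emptyI finite.insertI finite_subset insertI1 subsetI)
  ultimately have eq: "X \<union> Y = (\<Union>k \<in> I. if k = i then X else Y)"
    by auto
  have "\<forall>F. (\<forall>k \<in> I. F k \<in> \<U>) \<longrightarrow> (\<Union>k \<in> I. F k) \<in> \<U>"
    using assms(1) I(1) by (simp add: universe_def)
  from this[rule_format, of "\<lambda>k. if k = i then X else Y"] show ?thesis
    unfolding eq using assms(2,3) by metis
qed

text \<open>
  A finitely supported function is recovered from a list of its nonzero values.
\<close>

lemma small_free_module:
  fixes R :: "'r ring"
  assumes U: "universe \<U>" and R: "small \<U> (carrier R)" and X: "small \<U> X"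
  shows "small \<U> (carrier (free_module R X))"
proof -
  obtain Y1 Y2 Y3 where Y: "Y1 \<in> \<U>" "infinite Y1" "Y2 \<in> \<U>" "carrier R \<lesssim> Y2" "Y3 \<in> \<U>" "X \<lesssim> Y3"
    using assms unfolding small_def universe_def by blast
  define Z where "Z = Y1 \<union> Y2 \<union> Y3"
  have Z: "Z \<in> \<U>" "infinite Z"
    using Y by (auto simp: Z_def intro: universe_Un[OF U])
  have "carrier R \<lesssim> Z" "X \<lesssim> Z"
    using Y by (auto simp: Z_def intro: lepoll_trans subset_imp_lepoll)
  then have "lists (X \<times> carrier R) \<lesssim> Z"
    using Z(2) by (intro lists_lepoll_infinite times_lepoll_infinite)
  moreover have "carrier (free_module R X) \<lesssim> lists (X \<times> carrier R)"
  proof (rule subset_image_lepoll, rule subsetI)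
    fix c assume c: "c \<in> carrier (free_module R X)"
    note D = carrier_free_moduleD[OF c]
    obtain xs where xs: "set xs = {x. c x \<noteq> \<zero>\<^bsub>R\<^esub>}"
      using finite_list[OF D(2)] by blast
    show "c \<in> (\<lambda>ps x. case map_of ps x of None \<Rightarrow> \<zero>\<^bsub>R\<^esub> | Some r \<Rightarrow> r) ` lists (X \<times> carrier R)"
    proof (rule image_eqI)
      show "map (\<lambda>x. (x, c x)) xs \<in> lists (X \<times> carrier R)"
        using xs D by auto
      show "c = (\<lambda>x. case map_of (map (\<lambda>x. (x, c x)) xs) x of None \<Rightarrow> \<zero>\<^bsub>R\<^esub> | Some r \<Rightarrow> r)"
        using xs by (auto simp: map_of_map_restrict restrict_map_def)
    qed
  qed
  ultimately show ?thesis
    using Z(1) lepoll_trans unfolding small_def by blast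
qed

section \<open>Reflections and coreflections as universal arrows\<close>

lemma full_subcategory_simps:
  "Obj (full_subcategory B A) = A" "Hom (full_subcategory B A) = Hom B"
  "idt (full_subcategory B A) = idt B" "cmp (full_subcategory B A) = cmp B"
  by (simp_all add: full_subcategory_def)

lemma is_epiD:
  assumes "is_epi B x y e" and "z \<in> Obj B" and "g \<in> Hom B y z" and "h \<in> Hom B y z"
    and "cmp B x y z g e = cmp B x y z h e"
  shows "g = h"
  using assms unfolding is_epi_def by blast

text \<open>
  The unit is a universal arrow into the subcategory: an arrow \<open>f\<close> from \<open>x\<close> to \<open>y\<close> extends by the counit at
  \<open>y\<close> composed with \<open>L f\<close>, and the triangle identity at \<open>x\<close> recovers any extension from \<open>f\<close>.
\<close>

lemma adjunction_full_subcategory_universal: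
  assumes "category C" and A: "A \<subseteq> Obj C"
    and adj: "adjunction C (full_subcategory C A) L id_functor \<eta> \<epsilon>" and x: "x \<in> Obj C"
  shows "obj_map L x \<in> A" and "\<eta> x \<in> Hom C x (obj_map L x)"
    and "\<And>y f. y \<in> A \<Longrightarrow> f \<in> Hom C x y \<Longrightarrow>
      \<exists>!g. g \<in> Hom C (obj_map L x) y \<and> cmp C x (obj_map L x) y g (\<eta> x) = f"
proof -
  interpret category C by fact
  have L: "is_functor C (full_subcategory C A) L"
    and \<eta>: "\<eta> \<in> nat_trans C C id_functor (comp_functor id_functor L)"
    and \<epsilon>: "\<epsilon> \<in> nat_trans (full_subcategory C A) (full_subcategory C A)
      (comp_functor L id_functor) id_functor"
    and tri: "\<And>y. y \<in> A \<Longrightarrow> cmp C y (obj_map L y) y (\<epsilon> y) (\<eta> y) = idt C y"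
    and tri': "\<And>x. x \<in> Obj C \<Longrightarrow> cmp C (obj_map L x) (obj_map L (obj_map L x)) (obj_map L x)
      (\<epsilon> (obj_map L x)) (arr_map L x (obj_map L x) (\<eta> x)) = idt C (obj_map L x)"
    using adj unfolding adjunction_def full_subcategory_simps
    by (auto simp: id_functor_def comp_functor_def)
  have L_obj: "obj_map L x \<in> A" if "x \<in> Obj C" for x
    using L that unfolding is_functor_def full_subcategory_simps by blast
  have L_arr: "arr_map L x y f \<in> Hom C (obj_map L x) (obj_map L y)"
    if "x \<in> Obj C" "y \<in> Obj C" "f \<in> Hom C x y" for x y f
    using L that unfolding is_functor_def full_subcategory_simps by blast
  have L_cmp: "arr_map L x z (cmp C x y z g f) =
      cmp C (obj_map L x) (obj_map L y) (obj_map L z) (arr_map L y z g) (arr_map L x y f)"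
    if "x \<in> Obj C" "y \<in> Obj C" "z \<in> Obj C" "f \<in> Hom C x y" "g \<in> Hom C y z" for x y z f g
    using L that unfolding is_functor_def full_subcategory_simps by blast
  have \<eta>_nat: "cmp C x y (obj_map L y) (\<eta> y) f =
      cmp C x (obj_map L x) (obj_map L y) (arr_map L x y f) (\<eta> x)"
    if "x \<in> Obj C" "y \<in> Obj C" "f \<in> Hom C x y" for x y f
    using \<eta> that by (auto simp: nat_trans_def id_functor_def comp_functor_def)
  have \<eta>_in: "\<eta> x \<in> Hom C x (obj_map L x)" if "x \<in> Obj C" for x
    using \<eta> that by (auto simp: nat_trans_def id_functor_def comp_functor_def)
  have \<epsilon>_in: "\<epsilon> y \<in> Hom C (obj_map L y) y" if "y \<in> A" for y
    using \<epsilon> that by (auto simp: nat_trans_def id_functor_def comp_functor_def full_subcategory_simps)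
  have \<epsilon>_nat: "cmp C (obj_map L x) (obj_map L y) y (\<epsilon> y) (arr_map L x y f) =
      cmp C (obj_map L x) x y f (\<epsilon> x)"
    if "x \<in> A" "y \<in> A" "f \<in> Hom C x y" for x y f
    using \<epsilon> that by (auto simp: nat_trans_def id_functor_def comp_functor_def full_subcategory_simps)
  show LxA: "obj_map L x \<in> A" using L_obj x .
  show "\<eta> x \<in> Hom C x (obj_map L x)" using \<eta>_in x .
  fix y f assume y: "y \<in> A" and f: "f \<in> Hom C x y"
  have y': "y \<in> Obj C" using y A by blast
  have Lx: "obj_map L x \<in> Obj C" and Ly: "obj_map L y \<in> Obj C"
    using L_obj x y' A by auto
  have LLx: "obj_map L (obj_map L x) \<in> Obj C"
    using L_obj[OF Lx] A by auto
  note Lf = L_arr[OF x y' f] and \<eta>x = \<eta>_in[OF x] and \<epsilon>y = \<epsilon>_in[OF y]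
  define g where "g = cmp C (obj_map L x) (obj_map L y) y (\<epsilon> y) (arr_map L x y f)"
  have g: "g \<in> Hom C (obj_map L x) y"
    unfolding g_def by (rule cmp_in[OF Lx Ly y' Lf \<epsilon>y])
  have "cmp C x (obj_map L x) y g (\<eta> x) =
    cmp C x (obj_map L y) y (\<epsilon> y) (cmp C x y (obj_map L y) (\<eta> y) f)"
    unfolding \<eta>_nat[OF x y' f] g_def by (rule cmp_assoc[OF x Lx Ly y' \<eta>x Lf \<epsilon>y, symmetric])
  also have "\<dots> = cmp C x y y (cmp C y (obj_map L y) y (\<epsilon> y) (\<eta> y)) f"
    by (rule cmp_assoc[OF x y' Ly y' f \<eta>_in[OF y'] \<epsilon>y])
  also have "\<dots> = f"
    unfolding tri[OF y] by (rule cmp_idt_left[OF x y' f])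
  finally have gf: "cmp C x (obj_map L x) y g (\<eta> x) = f" .
  show "\<exists>!g. g \<in> Hom C (obj_map L x) y \<and> cmp C x (obj_map L x) y g (\<eta> x) = f"
  proof (rule ex1I[of _ g])
    show "g \<in> Hom C (obj_map L x) y \<and> cmp C x (obj_map L x) y g (\<eta> x) = f"
      using g gf by simp
  next
    fix h assume "h \<in> Hom C (obj_map L x) y \<and> cmp C x (obj_map L x) y h (\<eta> x) = f"
    then have h: "h \<in> Hom C (obj_map L x) y" and hf: "cmp C x (obj_map L x) y h (\<eta> x) = f"
      by auto
    note Lh = L_arr[OF Lx y' h] and L\<eta> = L_arr[OF x Lx \<eta>x] and \<epsilon>Lx = \<epsilon>_in[OF LxA]
    have "h = cmp C (obj_map L x) (obj_map L x) y h (cmp C (obj_map L x) (obj_map L (obj_map L x))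
        (obj_map L x) (\<epsilon> (obj_map L x)) (arr_map L x (obj_map L x) (\<eta> x)))"
      unfolding tri'[OF x] by (rule cmp_idt_right[OF Lx y' h, symmetric])
    also have "\<dots> = cmp C (obj_map L x) (obj_map L (obj_map L x)) y
        (cmp C (obj_map L (obj_map L x)) (obj_map L y) y (\<epsilon> y) (arr_map L (obj_map L x) y h))
        (arr_map L x (obj_map L x) (\<eta> x))"
      using cmp_assoc[OF Lx LLx Lx y' L\<eta> \<epsilon>Lx h] \<epsilon>_nat[OF LxA y h] by simp
    also have "\<dots> = g"
      using cmp_assoc[OF Lx LLx Ly y' L\<eta> Lh \<epsilon>y] L_cmp[OF x Lx y' \<eta>x h] hf by (simp add: g_def)
    finally show "h = g" .
  qed
qed

text \<open>
  The action of \<open>L\<close> on arrows and the counit are the extensions that universality provides, and every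
  equation that makes them an adjunction holds because both sides agree after composition with the
  universal arrow.
\<close>

lemma universal_adjunction_full_subcategory:
  assumes "category C" and A: "A \<subseteq> Obj C"
    and re: "\<And>x. x \<in> Obj C \<Longrightarrow> r x \<in> A \<and> e x \<in> Hom C x (r x) \<and>
      (\<forall>y \<in> A. \<forall>f \<in> Hom C x y. \<exists>!g. g \<in> Hom C (r x) y \<and> cmp C x (r x) y g (e x) = f)"
  obtains L \<epsilon> where "adjunction C (full_subcategory C A) L id_functor (restrict e (Obj C)) \<epsilon>"
    and "obj_map L = r"
proof -
  interpret category C by fact
  have r: "r x \<in> A" "r x \<in> Obj C" and e: "e x \<in> Hom C x (r x)" if "x \<in> Obj C" for x
    using that A re by auto
  have eq: "g = h"
    if "x \<in> Obj C" "y \<in> A" "g \<in> Hom C (r x) y" "h \<in> Hom C (r x) y"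
      "cmp C x (r x) y g (e x) = cmp C x (r x) y h (e x)" for x y g h
  proof -
    have "cmp C x (r x) y g (e x) \<in> Hom C x y"
      using that A r e by (intro cmp_in) auto
    then show ?thesis using re that by metis
  qed
  define lift where "lift x y f = (SOME g. g \<in> Hom C (r x) y \<and> cmp C x (r x) y g (e x) = f)"
    for x y f
  have lift_spec: "lift x y f \<in> Hom C (r x) y \<and> cmp C x (r x) y (lift x y f) (e x) = f"
    if "x \<in> Obj C" "y \<in> A" "f \<in> Hom C x y" for x y f
  proof -
    have "\<exists>g. g \<in> Hom C (r x) y \<and> cmp C x (r x) y g (e x) = f"
      using re that by blast
    then show ?thesis
      unfolding lift_def by (rule someI_ex)
  qed
  have lift: "lift x y f \<in> Hom C (r x) y" "cmp C x (r x) y (lift x y f) (e x) = f"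
    if "x \<in> Obj C" "y \<in> A" "f \<in> Hom C x y" for x y f
    using lift_spec that by auto
  define L where
    "L = \<lparr>obj_map = r, arr_map = (\<lambda>x y f. lift x (r y) (cmp C x y (r y) (e y) f))\<rparr>"
  have ef: "cmp C x y (r y) (e y) f \<in> Hom C x (r y)"
    if "x \<in> Obj C" "y \<in> Obj C" "f \<in> Hom C x y" for x y f
    using that r e by (intro cmp_in) auto
  have L_in: "arr_map L x y f \<in> Hom C (r x) (r y)"
    and L_e: "cmp C x (r x) (r y) (arr_map L x y f) (e x) = cmp C x y (r y) (e y) f"
    if "x \<in> Obj C" "y \<in> Obj C" "f \<in> Hom C x y" for x y f
    using lift[OF that(1) r(1)[OF that(2)] ef[OF that]] by (simp_all add: L_def)
  define \<epsilon> where "\<epsilon> = (\<lambda>y \<in> A. lift y y (idt C y))"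
  have \<epsilon>: "\<epsilon> y \<in> Hom C (r y) y" "cmp C y (r y) y (\<epsilon> y) (e y) = idt C y" if "y \<in> A" for y
    using lift[of y y "idt C y"] that A idt_in by (auto simp: \<epsilon>_def)
  have "adjunction C (full_subcategory C A) L id_functor (restrict e (Obj C)) \<epsilon>"
    unfolding adjunction_def full_subcategory_simps
  proof (intro conjI ballI)
    show "is_functor C (full_subcategory C A) L"
      unfolding is_functor_def full_subcategory_simps
    proof (intro conjI ballI)
      fix x assume x: "x \<in> Obj C"
      show "obj_map L x \<in> A"
        using r x by (simp add: L_def)
      have "arr_map L x x (idt C x) = idt C (r x)"
      proof (rule eq[OF x r(1)[OF x]])
        show "cmp C x (r x) (r x) (arr_map L x x (idt C x)) (e x) =
          cmp C x (r x) (r x) (idt C (r x)) (e x)"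
          using x r[OF x] e[OF x] L_e[OF x x idt_in[OF x]]
          by (simp add: cmp_idt_left cmp_idt_right)
      qed (use x r L_in idt_in in auto)
      then show "arr_map L x x (idt C x) = idt C (obj_map L x)"
        by (simp add: L_def)
    next
      fix x y f assume xyf: "x \<in> Obj C" "y \<in> Obj C" "f \<in> Hom C x y"
      then show "arr_map L x y f \<in> Hom C (obj_map L x) (obj_map L y)"
        using L_in by (simp add: L_def)
      fix z g assume z: "z \<in> Obj C" and g: "g \<in> Hom C y z"
      note xzgf = xyf(1) z cmp_in[OF xyf(1,2) z xyf(3) g]
      note yzg = xyf(2) z g
      note rx = r(2)[OF xyf(1)] and ry = r(2)[OF xyf(2)] and rz = r(2)[OF z]
      have "arr_map L x z (cmp C x y z g f) =
        cmp C (r x) (r y) (r z) (arr_map L y z g) (arr_map L x y f)"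
      proof (rule eq[OF xyf(1) r(1)[OF z] L_in[OF xzgf] cmp_in[OF rx ry rz L_in[OF xyf] L_in[OF yzg]]])
        have "cmp C x (r x) (r z) (cmp C (r x) (r y) (r z) (arr_map L y z g) (arr_map L x y f)) (e x)
          = cmp C x (r y) (r z) (arr_map L y z g) (cmp C x y (r y) (e y) f)"
          using cmp_assoc[OF xyf(1) rx ry rz e[OF xyf(1)] L_in[OF xyf] L_in[OF yzg]] L_e[OF xyf]
          by simp
        also have "\<dots> = cmp C x y (r z) (cmp C y z (r z) (e z) g) f"
          using cmp_assoc[OF xyf(1,2) ry rz xyf(3) e[OF xyf(2)] L_in[OF yzg]] L_e[OF yzg] by simp
        also have "\<dots> = cmp C x z (r z) (e z) (cmp C x y z g f)"
          using cmp_assoc[OF xyf(1,2) z rz xyf(3) g e[OF z]] by simp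
        also have "\<dots> = cmp C x (r x) (r z) (arr_map L x z (cmp C x y z g f)) (e x)"
          using L_e[OF xzgf] by simp
        finally show "cmp C x (r x) (r z) (arr_map L x z (cmp C x y z g f)) (e x) =
          cmp C x (r x) (r z) (cmp C (r x) (r y) (r z) (arr_map L y z g) (arr_map L x y f)) (e x)"
          by simp
      qed
      then show "arr_map L x z (cmp C x y z g f) =
        cmp C (obj_map L x) (obj_map L y) (obj_map L z) (arr_map L y z g) (arr_map L x y f)"
        by (simp add: L_def)
    qed
    show "is_functor (full_subcategory C A) C id_functor"
      using A by (auto simp: is_functor_def full_subcategory_simps id_functor_def)
    show "restrict e (Obj C) \<in> nat_trans C C id_functor (comp_functor id_functor L)"
      using e L_e by (auto simp: nat_trans_def id_functor_def comp_functor_def) (auto simp: L_def)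
    show "\<epsilon> \<in> nat_trans (full_subcategory C A) (full_subcategory C A)
      (comp_functor L id_functor) id_functor"
    proof -
      have "cmp C (r x) (r y) y (\<epsilon> y) (arr_map L x y f) = cmp C (r x) x y f (\<epsilon> x)"
        if x: "x \<in> A" and y: "y \<in> A" and f: "f \<in> Hom C x y" for x y f
      proof -
        have x': "x \<in> Obj C" and y': "y \<in> Obj C" using x y A by auto
        note rx = r(2)[OF x'] and ry = r(2)[OF y'] and xyf = x' y' f
        show ?thesis
        proof (rule eq[OF x' y cmp_in[OF rx ry y' L_in[OF xyf] \<epsilon>(1)[OF y]]
              cmp_in[OF rx x' y' \<epsilon>(1)[OF x] f]])
          have "cmp C x (r x) y (cmp C (r x) (r y) y (\<epsilon> y) (arr_map L x y f)) (e x)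
            = cmp C x (r y) y (\<epsilon> y) (cmp C x y (r y) (e y) f)"
            using cmp_assoc[OF x' rx ry y' e[OF x'] L_in[OF xyf] \<epsilon>(1)[OF y]] L_e[OF xyf] by simp
          also have "\<dots> = f"
            using cmp_assoc[OF x' y' ry y' f e[OF y'] \<epsilon>(1)[OF y]] \<epsilon>(2)[OF y] cmp_idt_left[OF xyf]
            by simp
          also have "\<dots> = cmp C x (r x) y (cmp C (r x) x y f (\<epsilon> x)) (e x)"
            using cmp_assoc[OF x' rx x' y' e[OF x'] \<epsilon>(1)[OF x] f] \<epsilon>(2)[OF x] cmp_idt_right[OF xyf]
            by simp
          finally show "cmp C x (r x) y (cmp C (r x) (r y) y (\<epsilon> y) (arr_map L x y f)) (e x) =
            cmp C x (r x) y (cmp C (r x) x y f (\<epsilon> x)) (e x)" .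
        qed
      qed
      then show ?thesis
        using \<epsilon> by (auto simp: nat_trans_def id_functor_def comp_functor_def full_subcategory_simps
            L_def \<epsilon>_def)
    qed
  next
    fix x assume x: "x \<in> Obj C"
    note rx = r[OF x] and ex = e[OF x]
    note rrx = r[OF rx(2)]
    have xf: "x \<in> Obj C" "r x \<in> Obj C" "e x \<in> Hom C x (r x)"
      using x rx ex by auto
    have "cmp C (r x) (r (r x)) (r x) (\<epsilon> (r x)) (arr_map L x (r x) (e x)) = idt C (r x)"
    proof (rule eq[OF x rx(1) cmp_in[OF rx(2) rrx(2) rx(2) L_in[OF xf] \<epsilon>(1)[OF rx(1)]]
          idt_in[OF rx(2)]])
      have "cmp C x (r x) (r x)
          (cmp C (r x) (r (r x)) (r x) (\<epsilon> (r x)) (arr_map L x (r x) (e x))) (e x)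
        = cmp C x (r (r x)) (r x) (\<epsilon> (r x)) (cmp C x (r x) (r (r x)) (e (r x)) (e x))"
        using cmp_assoc[OF x rx(2) rrx(2) rx(2) ex L_in[OF xf] \<epsilon>(1)[OF rx(1)]] L_e[OF xf] by simp
      also have "\<dots> = cmp C x (r x) (r x) (idt C (r x)) (e x)"
        using cmp_assoc[OF x rx(2) rrx(2) rx(2) ex e[OF rx(2)] \<epsilon>(1)[OF rx(1)]] \<epsilon>(2)[OF rx(1)]
        by simp
      finally show "cmp C x (r x) (r x)
          (cmp C (r x) (r (r x)) (r x) (\<epsilon> (r x)) (arr_map L x (r x) (e x))) (e x)
        = cmp C x (r x) (r x) (idt C (r x)) (e x)" .
    qed
    then show "cmp C (obj_map L x) (obj_map L (obj_map id_functor (obj_map L x))) (obj_map L x)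
        (\<epsilon> (obj_map L x))
        (arr_map L x (obj_map id_functor (obj_map L x)) (restrict e (Obj C) x)) =
      idt C (obj_map L x)"
      using x by (simp add: L_def id_functor_def)
  next
    fix y assume y: "y \<in> A"
    then show "cmp C (obj_map id_functor y) (obj_map id_functor (obj_map L (obj_map id_functor y)))
        (obj_map id_functor y)
        (arr_map id_functor (obj_map L (obj_map id_functor y)) y (\<epsilon> y))
        (restrict e (Obj C) (obj_map id_functor y)) =
      idt C (obj_map id_functor y)"
      using \<epsilon>(2)[OF y] A by (auto simp: L_def id_functor_def)
  qed
  then show thesis
    by (rule that) (simp add: L_def)
qed

text \<open>
  When the universal arrows are epimorphisms, uniqueness of extensions is automatic.
\<close>

lemma epireflective_iff_universal:
  assumes "category C"
  shows "epireflective C A \<longleftrightarrow> A \<subseteq> Obj C \<and>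
     (\<forall>x \<in> Obj C. \<exists>r \<in> A. \<exists>e. is_epi C x r e \<and>
        (\<forall>y \<in> A. \<forall>f \<in> Hom C x y. \<exists>g \<in> Hom C r y. cmp C x r y g e = f))"
  (is "_ \<longleftrightarrow> _ \<and> ?univ")
proof (intro iffI conjI)
  assume "epireflective C A"
  then obtain L \<eta> \<epsilon> where A: "A \<subseteq> Obj C"
    and adj: "adjunction C (full_subcategory C A) L id_functor \<eta> \<epsilon>"
    and epi: "\<And>x. x \<in> Obj C \<Longrightarrow> is_epi C x (obj_map L x) (\<eta> x)"
    unfolding epireflective_def by blast
  show "A \<subseteq> Obj C" by (fact A)
  note univ = adjunction_full_subcategory_universal[OF assms A adj]
  show ?univ
    using univ(1) epi ex1_implies_ex[OF univ(3)] by (metis (lifting))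
next
  assume "A \<subseteq> Obj C \<and> ?univ"
  then have A: "A \<subseteq> Obj C" and univ: ?univ by auto
  from univ obtain r e where re: "\<forall>x \<in> Obj C. r x \<in> A \<and> is_epi C x (r x) (e x) \<and>
    (\<forall>y \<in> A. \<forall>f \<in> Hom C x y. \<exists>g \<in> Hom C (r x) y. cmp C x (r x) y g (e x) = f)"
    by metis
  have "r x \<in> A \<and> e x \<in> Hom C x (r x) \<and>
      (\<forall>y \<in> A. \<forall>f \<in> Hom C x y. \<exists>!g. g \<in> Hom C (r x) y \<and> cmp C x (r x) y g (e x) = f)"
    if x: "x \<in> Obj C" for x
  proof (intro conjI ballI)
    fix y f assume y: "y \<in> A" and "f \<in> Hom C x y"
    then obtain g where g: "g \<in> Hom C (r x) y" "cmp C x (r x) y g (e x) = f"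
      using re x by blast
    have epi: "is_epi C x (r x) (e x)" and y': "y \<in> Obj C"
      using re x y A by auto
    show "\<exists>!g. g \<in> Hom C (r x) y \<and> cmp C x (r x) y g (e x) = f"
      by (rule ex1I[of _ g]) (use g is_epiD[OF epi y'] in auto)
  qed (use re x in \<open>auto simp: is_epi_def\<close>)
  then obtain L \<epsilon> where "adjunction C (full_subcategory C A) L id_functor (restrict e (Obj C)) \<epsilon>"
    and "obj_map L = r"
    by (rule universal_adjunction_full_subcategory[OF assms A])
  then show "epireflective C A"
    using A re unfolding epireflective_def by (metis restrict_apply')
qed

lemma opposite_simps:
  "Obj (opposite C) = Obj C" "Hom (opposite C) x y = Hom C y x" "idt (opposite C) = idt C"
  "cmp (opposite C) x y z g f = cmp C z y x f g"
  by (simp_all add: opposite_def)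

lemma category_opposite:
  assumes "category C"
  shows "category (opposite C)"
proof -
  interpret category C by fact
  show ?thesis
    by standard (auto simp: opposite_simps idt_in cmp_in cmp_idt_left cmp_idt_right cmp_assoc)
qed

definition opposite_functor ::
  "('o, 'a, 'p, 'b) cat_functor \<Rightarrow> ('o, 'a, 'p, 'b) cat_functor" where
  "opposite_functor F = \<lparr>obj_map = obj_map F, arr_map = (\<lambda>x y. arr_map F y x)\<rparr>"

lemma is_functor_opposite:
  "is_functor (opposite C) (opposite D) (opposite_functor F) \<longleftrightarrow> is_functor C D F"
  unfolding is_functor_def opposite_simps opposite_functor_def cat_functor.simps by blast

lemma nat_trans_opposite:
  "nat_trans (opposite C) (opposite D) (opposite_functor F) (opposite_functor G) = nat_trans C D G F"
  unfolding nat_trans_def opposite_simps opposite_functor_def cat_functor.simps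
  by (rule Collect_cong, rule conj_cong[OF refl], intro iffI ballI; rule sym; blast)

lemma opposite_functor_simps:
  "opposite_functor id_functor = id_functor"
  "opposite_functor (comp_functor G F) = comp_functor (opposite_functor G) (opposite_functor F)"
  "opposite_functor (opposite_functor F) = F"
  by (simp_all add: opposite_functor_def id_functor_def comp_functor_def)

lemma adjunction_opposite:
  "adjunction (opposite C) (opposite D) (opposite_functor G) (opposite_functor F) \<epsilon> \<eta> \<longleftrightarrow>
   adjunction D C F G \<eta> \<epsilon>"
proof -
  note n = nat_trans_opposite[of C C id_functor "comp_functor F G", unfolded opposite_functor_simps]
    nat_trans_opposite[of D D "comp_functor G F" id_functor, unfolded opposite_functor_simps]
  show ?thesis
    unfolding adjunction_def is_functor_opposite n
    unfolding opposite_simps opposite_functor_def cat_functor.simps by blast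
qed

text \<open>
  A coreflection is a reflection in the opposite category.
\<close>

lemma coreflective_iff_universal:
  assumes "category C"
  shows "coreflective C A \<longleftrightarrow> A \<subseteq> Obj C \<and>
     (\<forall>y \<in> Obj C. \<exists>r \<in> A. \<exists>e \<in> Hom C r y.
        \<forall>x \<in> A. \<forall>f \<in> Hom C x y. \<exists>!g. g \<in> Hom C x r \<and> cmp C x r y e g = f)"
  (is "_ \<longleftrightarrow> _ \<and> ?univ")
proof (intro iffI conjI)
  note op = category_opposite[OF assms]
  have full: "full_subcategory (opposite C) A = opposite (full_subcategory C A)"
    by (simp add: full_subcategory_def opposite_def)
  {
    assume "coreflective C A"
    then obtain G \<eta> \<epsilon> where A: "A \<subseteq> Obj C"
      and adj: "adjunction (full_subcategory C A) C id_functor G \<eta> \<epsilon>"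
      unfolding coreflective_def by blast
    show "A \<subseteq> Obj C" by (fact A)
    have "adjunction (opposite C) (full_subcategory (opposite C) A) (opposite_functor G) id_functor \<epsilon> \<eta>"
      using adj adjunction_opposite[of C "full_subcategory C A" G id_functor \<epsilon> \<eta>]
      by (simp add: full opposite_functor_simps)
    note univ = adjunction_full_subcategory_universal[OF op _ this, unfolded opposite_simps, OF A]
    show ?univ
      using univ by blast
  }
  assume "A \<subseteq> Obj C \<and> ?univ"
  then have A: "A \<subseteq> Obj C" and univ: ?univ by auto
  from univ obtain r e where "\<forall>y \<in> Obj C. r y \<in> A \<and> e y \<in> Hom C (r y) y \<and>
    (\<forall>x \<in> A. \<forall>f \<in> Hom C x y. \<exists>!g. g \<in> Hom C x (r y) \<and> cmp C x (r y) y (e y) g = f)"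
    by metis
  then have re: "r y \<in> A \<and> e y \<in> Hom C (r y) y \<and>
    (\<forall>x \<in> A. \<forall>f \<in> Hom C x y. \<exists>!g. g \<in> Hom C x (r y) \<and> cmp C x (r y) y (e y) g = f)"
    if "y \<in> Obj C" for y
    using that by simp
  obtain G \<eta> where
    "adjunction (opposite C) (full_subcategory (opposite C) A) G id_functor (restrict e (Obj C)) \<eta>"
    by (rule universal_adjunction_full_subcategory[OF op, unfolded opposite_simps, OF A re])
  then have "adjunction (full_subcategory C A) C id_functor (opposite_functor G) \<eta> (restrict e (Obj C))"
    using adjunction_opposite[of C "full_subcategory C A" "opposite_functor G" id_functor]
    by (simp add: full opposite_functor_simps)
  then show "coreflective C A"
    using A unfolding coreflective_def by blast
qed

section \<open>Functors to modules\<close>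

abbreviation (input) elems :: "('o, 'a, 'r, 'u) mod_functor \<Rightarrow> 'o \<Rightarrow> 'u set" where
  "elems F x \<equiv> carrier (obj_map F x)"

text \<open>
  Natural families of linear maps between functors whose values may have elements of different types.
  When the types agree these are the arrows of \<open>functor_mod\<close>, up to extensionality.
\<close>

definition linear_natural ::
  "'r ring \<Rightarrow> ('o, 'a) category \<Rightarrow> ('o, 'a, 'r, 'm) mod_functor \<Rightarrow> ('o, 'a, 'r, 'n) mod_functor
   \<Rightarrow> ('o \<Rightarrow> 'm \<Rightarrow> 'n) \<Rightarrow> bool" where
  "linear_natural R D F G h \<longleftrightarrow>
     (\<forall>x \<in> Obj D. h x \<in> mod_hom R (obj_map F x) (obj_map G x)) \<and>
     (\<forall>x \<in> Obj D. \<forall>y \<in> Obj D. \<forall>f \<in> Hom D x y. \<forall>u \<in> elems F x.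
        h y (arr_map F x y f u) = arr_map G x y f (h x u))"

lemma nat_surjection_iff:
  "nat_surjection R D F G q \<longleftrightarrow> linear_natural R D F G q \<and>
     (\<forall>x \<in> Obj D. q x ` elems F x = elems G x)"
  unfolding nat_surjection_def linear_natural_def by blast

lemma Funs_Obj_iff:
  assumes "category D"
  shows "F \<in> Obj (functor_mod R \<U> D) \<longleftrightarrow>
    (\<forall>x \<in> Obj D. module R (obj_map F x) \<and> elems F x \<in> \<U>) \<and>
    (\<forall>x \<in> Obj D. \<forall>y \<in> Obj D. \<forall>f \<in> Hom D x y.
       arr_map F x y f \<in> mod_hom R (obj_map F x) (obj_map F y)) \<and>
    (\<forall>x \<in> Obj D. \<forall>u \<in> elems F x. arr_map F x x (idt D x) u = u) \<and>
    (\<forall>x \<in> Obj D. \<forall>y \<in> Obj D. \<forall>z \<in> Obj D. \<forall>f \<in> Hom D x y. \<forall>g \<in> Hom D y z.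
       \<forall>u \<in> elems F x.
         arr_map F x z (cmp D x y z g f) u = arr_map F y z g (arr_map F x y f u))"
    (is "_ \<longleftrightarrow> ?mod \<and> ?hom \<and> ?idt \<and> ?cmp")
proof -
  interpret category D by fact
  have *: "F \<in> Obj (functor_mod R \<U> D) \<longleftrightarrow> ?mod \<and> ?hom \<and>
    (\<forall>x \<in> Obj D. arr_map F x x (idt D x) = (\<lambda>u \<in> elems F x. u)) \<and>
    (\<forall>x \<in> Obj D. \<forall>y \<in> Obj D. \<forall>z \<in> Obj D. \<forall>f \<in> Hom D x y. \<forall>g \<in> Hom D y z.
       arr_map F x z (cmp D x y z g f) =
         compose (elems F x) (arr_map F y z g) (arr_map F x y f))"
    by (simp add: functor_mod_def functor_category_def is_functor_def module_category_def)
  have ext: "arr_map F x y f \<in> extensional (elems F x)"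
    if ?hom "x \<in> Obj D" "y \<in> Obj D" "f \<in> Hom D x y" for x y f
    using that by (auto simp: mod_hom_def PiE_def)
  have idt_iff: "(arr_map F x x (idt D x) = (\<lambda>u \<in> elems F x. u)) \<longleftrightarrow>
      (\<forall>u \<in> elems F x. arr_map F x x (idt D x) u = u)"
    if ?hom "x \<in> Obj D" for x
    using ext[OF that that(2) idt_in[OF that(2)]]
    by (auto intro: extensionalityI[of _ "elems F x"])
  have cmp_iff: "(arr_map F x z (cmp D x y z g f) =
         compose (elems F x) (arr_map F y z g) (arr_map F x y f)) \<longleftrightarrow>
      (\<forall>u \<in> elems F x.
         arr_map F x z (cmp D x y z g f) u = arr_map F y z g (arr_map F x y f u))"
    if ?hom "x \<in> Obj D" "y \<in> Obj D" "z \<in> Obj D" "f \<in> Hom D x y" "g \<in> Hom D y z" for x y z f g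
    using ext[OF that(1,2,4) cmp_in[OF that(2-6)]]
    by (auto simp: compose_eq intro: extensionalityI[of _ "elems F x"])
  show ?thesis
    unfolding *
  proof (rule conj_cong[OF refl], rule conj_cong[OF refl])
    assume ?hom
    then show "((\<forall>x \<in> Obj D. arr_map F x x (idt D x) = (\<lambda>u \<in> elems F x. u)) \<and>
      (\<forall>x \<in> Obj D. \<forall>y \<in> Obj D. \<forall>z \<in> Obj D. \<forall>f \<in> Hom D x y. \<forall>g \<in> Hom D y z.
         arr_map F x z (cmp D x y z g f) =
           compose (elems F x) (arr_map F y z g) (arr_map F x y f))) \<longleftrightarrow>
      ?idt \<and> ?cmp"
      by (intro arg_cong2[where f = "(\<and>)"] ball_cong refl idt_iff cmp_iff)
  qed
qed

text \<open>
  The functor laws of a module-valued functor, evaluated at elements.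
\<close>

locale module_functor =
  fixes R :: "'r ring" and \<U> :: "'u set set" and D :: "('o, 'a) category"
    and F :: "('o, 'a, 'r, 'u) mod_functor"
  assumes base: "category D" and obj: "F \<in> Obj (functor_mod R \<U> D)"
begin

lemma module: "x \<in> Obj D \<Longrightarrow> module R (obj_map F x)"
  and carrier_in: "x \<in> Obj D \<Longrightarrow> elems F x \<in> \<U>"
  and arr: "x \<in> Obj D \<Longrightarrow> y \<in> Obj D \<Longrightarrow> f \<in> Hom D x y \<Longrightarrow>
    arr_map F x y f \<in> mod_hom R (obj_map F x) (obj_map F y)"
  and arr_idt: "x \<in> Obj D \<Longrightarrow> u \<in> elems F x \<Longrightarrow> arr_map F x x (idt D x) u = u"
  and arr_cmp: "x \<in> Obj D \<Longrightarrow> y \<in> Obj D \<Longrightarrow> z \<in> Obj D \<Longrightarrow> f \<in> Hom D x y \<Longrightarrow> g \<in> Hom D y z \<Longrightarrow>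
    u \<in> elems F x \<Longrightarrow>
    arr_map F x z (cmp D x y z g f) u = arr_map F y z g (arr_map F x y f u)"
  using obj unfolding Funs_Obj_iff[OF base] by blast+

lemma arr_in: "x \<in> Obj D \<Longrightarrow> y \<in> Obj D \<Longrightarrow> f \<in> Hom D x y \<Longrightarrow> u \<in> elems F x \<Longrightarrow>
    arr_map F x y f u \<in> elems F y"
  using mod_hom_closed[OF arr] .

end

context
  fixes R :: "'r ring" and \<U> :: "'u set set" and D :: "('o, 'a) category"
begin

abbreviation (input) Funs :: "(('o, 'a, 'r, 'u) mod_functor, 'o \<Rightarrow> 'u \<Rightarrow> 'u) category" where
  "Funs \<equiv> functor_mod R \<U> D"

lemma Funs_Hom_iff:
  "\<alpha> \<in> Hom Funs F G \<longleftrightarrow> \<alpha> \<in> extensional (Obj D) \<and> linear_natural R D F G \<alpha>"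
proof -
  have *: "compose A f g = compose A h k \<longleftrightarrow> (\<forall>u \<in> A. f (g u) = h (k u))"
    for A :: "'u set" and f h :: "'u \<Rightarrow> 'u" and g k
    by (auto simp: compose_def restrict_def fun_eq_iff)
  show ?thesis
    unfolding functor_mod_def functor_category_def nat_trans_def module_category_def
      linear_natural_def category.simps
    by (auto simp: * PiE_def)
qed

lemma Funs_cmp:
  "x \<in> Obj D \<Longrightarrow> u \<in> elems F x \<Longrightarrow>
    cmp Funs F G H \<beta> \<alpha> x u = \<beta> x (\<alpha> x u)"
  by (simp add: functor_mod_def functor_category_def module_category_def compose_eq)

lemma Funs_idt:
  "x \<in> Obj D \<Longrightarrow> u \<in> elems F x \<Longrightarrow> idt Funs F x u = u"
  by (simp add: functor_mod_def functor_category_def module_category_def)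

lemma linear_naturalD:
  assumes "linear_natural R D F G h"
  shows "x \<in> Obj D \<Longrightarrow> h x \<in> mod_hom R (obj_map F x) (obj_map G x)"
    and "x \<in> Obj D \<Longrightarrow> u \<in> elems F x \<Longrightarrow> h x u \<in> elems G x"
    and "x \<in> Obj D \<Longrightarrow> y \<in> Obj D \<Longrightarrow> f \<in> Hom D x y \<Longrightarrow> u \<in> elems F x \<Longrightarrow>
      h y (arr_map F x y f u) = arr_map G x y f (h x u)"
  using assms unfolding linear_natural_def by (blast intro: mod_hom_closed)+

lemma Funs_HomD:
  assumes "\<alpha> \<in> Hom Funs F G"
  shows "x \<in> Obj D \<Longrightarrow> \<alpha> x \<in> mod_hom R (obj_map F x) (obj_map G x)"
    and "x \<in> Obj D \<Longrightarrow> u \<in> elems F x \<Longrightarrow> \<alpha> x u \<in> elems G x"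
    and "x \<in> Obj D \<Longrightarrow> y \<in> Obj D \<Longrightarrow> f \<in> Hom D x y \<Longrightarrow> u \<in> elems F x \<Longrightarrow>
      \<alpha> y (arr_map F x y f u) = arr_map G x y f (\<alpha> x u)"
  using assms linear_naturalD[of F G \<alpha>] unfolding Funs_Hom_iff by auto

lemma Funs_Hom_ext:
  assumes "\<alpha> \<in> Hom Funs F G" and "\<beta> \<in> Hom Funs F G"
    and "\<And>x u. x \<in> Obj D \<Longrightarrow> u \<in> elems F x \<Longrightarrow> \<alpha> x u = \<beta> x u"
  shows "\<alpha> = \<beta>"
proof (rule extensionalityI[of _ "Obj D"])
  fix x assume x: "x \<in> Obj D"
  show "\<alpha> x = \<beta> x"
    by (rule mod_hom_ext[OF Funs_HomD(1)[OF assms(1) x] Funs_HomD(1)[OF assms(2) x]])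
       (use assms(3) x in auto)
qed (use assms in \<open>auto simp: Funs_Hom_iff\<close>)

lemma restrict_Funs_Hom:
  assumes "linear_natural R D F G h"
  shows "restrict h (Obj D) \<in> Hom Funs F G"
  using assms unfolding Funs_Hom_iff linear_natural_def by simp

lemma Funs_cmp_in:
  assumes "category D" and "F \<in> Obj Funs"
    and \<alpha>: "\<alpha> \<in> Hom Funs F G" and \<beta>: "\<beta> \<in> Hom Funs G H"
  shows "cmp Funs F G H \<beta> \<alpha> \<in> Hom Funs F H"
proof -
  interpret F: module_functor R \<U> D F by (rule module_functor.intro) fact+
  show ?thesis
    unfolding Funs_Hom_iff
  proof
    show "cmp Funs F G H \<beta> \<alpha> \<in> extensional (Obj D)"
      by (simp add: functor_mod_def functor_category_def)
    have "cmp Funs F G H \<beta> \<alpha> x \<in> mod_hom R (obj_map F x) (obj_map H x)"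
      if x: "x \<in> Obj D" for x
      using compose_mod_hom[OF F.module Funs_HomD(1)[OF \<alpha>] Funs_HomD(1)[OF \<beta>]] x
      by (simp add: functor_mod_def functor_category_def module_category_def)
    then show "linear_natural R D F H (cmp Funs F G H \<beta> \<alpha>)"
      unfolding linear_natural_def
      by (auto simp: Funs_cmp F.arr_in Funs_HomD(2,3)[OF \<alpha>] Funs_HomD(3)[OF \<beta>])
  qed
qed

lemma Funs_idt_in:
  assumes "category D" and "F \<in> Obj Funs"
  shows "idt Funs F \<in> Hom Funs F F"
proof -
  interpret F: module_functor R \<U> D F by (rule module_functor.intro) fact+
  show ?thesis
    unfolding Funs_Hom_iff
  proof
    show "idt Funs F \<in> extensional (Obj D)"
      by (simp add: functor_mod_def functor_category_def)
    have "idt Funs F x \<in> mod_hom R (obj_map F x) (obj_map F x)"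
      if x: "x \<in> Obj D" for x
      using restrict_mod_hom[OF F.module[OF x], of "\<lambda>u. u" "obj_map F x"] x
      by (simp add: functor_mod_def functor_category_def module_category_def)
    then show "linear_natural R D F F (idt Funs F)"
      unfolding linear_natural_def by (auto simp: Funs_idt F.arr_in)
  qed
qed

lemma category_Funs:
  assumes "category D"
  shows "category Funs"
proof
  fix F assume F: "F \<in> Obj Funs"
  show "idt Funs F \<in> Hom Funs F F"
    by (rule Funs_idt_in[OF assms F])
next
  fix F G H \<alpha> \<beta>
  assume "F \<in> Obj Funs" "\<alpha> \<in> Hom Funs F G"
    "\<beta> \<in> Hom Funs G H"
  then show "cmp Funs F G H \<beta> \<alpha> \<in> Hom Funs F H"
    by (intro Funs_cmp_in[OF assms])
next
  fix F G \<alpha>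
  assume F: "F \<in> Obj Funs" and G: "G \<in> Obj Funs"
    and \<alpha>: "\<alpha> \<in> Hom Funs F G"
  show "cmp Funs F G G (idt Funs G) \<alpha> = \<alpha>"
    by (rule Funs_Hom_ext[OF Funs_cmp_in[OF assms F \<alpha> Funs_idt_in[OF assms G]] \<alpha>])
       (simp add: Funs_cmp Funs_idt Funs_HomD(2)[OF \<alpha>])
  show "cmp Funs F F G \<alpha> (idt Funs F) = \<alpha>"
    by (rule Funs_Hom_ext[OF Funs_cmp_in[OF assms F Funs_idt_in[OF assms F] \<alpha>] \<alpha>])
       (simp add: Funs_cmp Funs_idt)
next
  fix F G H K \<alpha> \<beta> \<gamma>
  assume obj: "F \<in> Obj Funs" "G \<in> Obj Funs"
    "H \<in> Obj Funs" "K \<in> Obj Funs"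
    and \<alpha>: "\<alpha> \<in> Hom Funs F G" and \<beta>: "\<beta> \<in> Hom Funs G H"
    and \<gamma>: "\<gamma> \<in> Hom Funs H K"
  note in1 = Funs_cmp_in[OF assms obj(1) Funs_cmp_in[OF assms obj(1) \<alpha> \<beta>] \<gamma>]
    and in2 = Funs_cmp_in[OF assms obj(1) \<alpha> Funs_cmp_in[OF assms obj(2) \<beta> \<gamma>]]
  show "cmp Funs F H K \<gamma> (cmp Funs F G H \<beta> \<alpha>) =
    cmp Funs F G K (cmp Funs G H K \<gamma> \<beta>) \<alpha>"
    by (rule Funs_Hom_ext[OF in1 in2]) (simp add: Funs_cmp Funs_HomD(2)[OF \<alpha>])
qed

lemma Funs_isomorphicE:
  assumes "category D" and "isomorphic Funs F G"
  obtains \<alpha> \<beta> where "\<alpha> \<in> Hom Funs F G" and "\<beta> \<in> Hom Funs G F"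
    and "\<And>x u. x \<in> Obj D \<Longrightarrow> u \<in> elems F x \<Longrightarrow> \<beta> x (\<alpha> x u) = u"
proof -
  obtain \<alpha> \<beta> where \<alpha>: "\<alpha> \<in> Hom Funs F G" and \<beta>: "\<beta> \<in> Hom Funs G F"
    and id: "cmp Funs F G F \<beta> \<alpha> = idt Funs F"
    using assms(2) unfolding isomorphic_def is_iso_def by blast
  have "\<beta> x (\<alpha> x u) = u" if "x \<in> Obj D" "u \<in> elems F x" for x u
    using Funs_cmp[OF that, of G F \<beta> \<alpha>] Funs_idt[OF that] id by simp
  then show thesis
    using that \<alpha> \<beta> by blast
qed

subsection \<open>Quotients and subfunctors\<close>

text \<open>
  Quotients of functors are formed objectwise, and so are factorisations through them.
\<close>

lemma factor_through:
  assumes "category D" and F: "F \<in> Obj (functor_mod R \<V> D)" and Q: "Q \<in> Obj Funs"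
    and G: "G \<in> Obj Funs"
    and q: "nat_surjection R D F Q q" and h: "linear_natural R D F G h"
    and ker: "\<And>x m. x \<in> Obj D \<Longrightarrow> m \<in> elems F x \<Longrightarrow> q x m = \<zero>\<^bsub>obj_map Q x\<^esub> \<Longrightarrow>
      h x m = \<zero>\<^bsub>obj_map G x\<^esub>"
  obtains \<alpha> where "\<alpha> \<in> Hom Funs Q G"
    and "\<And>x m. x \<in> Obj D \<Longrightarrow> m \<in> elems F x \<Longrightarrow> \<alpha> x (q x m) = h x m"
proof -
  interpret F: module_functor R \<V> D F by (rule module_functor.intro) fact+
  interpret Q: module_functor R \<U> D Q by (rule module_functor.intro) fact+
  interpret G: module_functor R \<U> D G by (rule module_functor.intro) fact+
  have qn: "linear_natural R D F Q q"
    and surj: "\<And>x. x \<in> Obj D \<Longrightarrow> q x ` elems F x = elems Q x"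
    using q by (auto simp: nat_surjection_iff)
  define \<alpha> where "\<alpha> x = lift_along (q x) (obj_map F x) (obj_map Q x) (h x)" for x
  have \<alpha>_hom: "\<alpha> x \<in> mod_hom R (obj_map Q x) (obj_map G x)"
    and \<alpha>_eq: "\<And>m. m \<in> elems F x \<Longrightarrow> \<alpha> x (q x m) = h x m"
    if x: "x \<in> Obj D" for x
    using lift_along[OF F.module[OF x] Q.module[OF x] G.module[OF x] linear_naturalD(1)[OF qn x]
        surj[OF x] linear_naturalD(1)[OF h x] ker[OF x]]
    unfolding \<alpha>_def by auto
  have "linear_natural R D Q G \<alpha>"
    unfolding linear_natural_def
  proof (intro conjI ballI)
    fix x y f v assume x: "x \<in> Obj D" and y: "y \<in> Obj D" and f: "f \<in> Hom D x y"
      and "v \<in> elems Q x"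
    then obtain m where m: "m \<in> elems F x" and v: "v = q x m"
      using surj by blast
    have "\<alpha> y (arr_map Q x y f v) = \<alpha> y (q y (arr_map F x y f m))"
      unfolding v using linear_naturalD(3)[OF qn x y f m] by simp
    also have "\<dots> = arr_map G x y f (\<alpha> x v)"
      unfolding v using linear_naturalD(3)[OF h x y f m] by (simp add: \<alpha>_eq x y m F.arr_in[OF x y f m])
    finally show "\<alpha> y (arr_map Q x y f v) = arr_map G x y f (\<alpha> x v)" .
  qed (rule \<alpha>_hom)
  then have "restrict \<alpha> (Obj D) \<in> Hom Funs Q G"
    by (rule restrict_Funs_Hom)
  then show thesis
    using \<alpha>_eq by (intro that[of "restrict \<alpha> (Obj D)"]) auto
qed

text \<open>
  The source \<open>F\<close> takes values in modules of an arbitrary type, only their sizes being bounded. The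
  lemma thus covers both quotients of objects of \<open>functor_mod\<close> and quotients of \<open>free_hom\<close>.
\<close>

lemma quotient_functor_exists:
  fixes F :: "('o, 'a, 'r, 'm) mod_functor"
  assumes "universe \<U>" and "category D" and F: "F \<in> Obj (functor_mod R \<V> D)"
    and small: "\<And>x. x \<in> Obj D \<Longrightarrow> small \<U> (elems F x)"
    and K: "\<And>x. x \<in> Obj D \<Longrightarrow> submodule (K x) R (obj_map F x)"
    and stable: "\<And>x y f u. x \<in> Obj D \<Longrightarrow> y \<in> Obj D \<Longrightarrow> f \<in> Hom D x y \<Longrightarrow> u \<in> K x \<Longrightarrow>
      arr_map F x y f u \<in> K y"
  obtains Q :: "('o, 'a, 'r, 'u) mod_functor" and q
  where "Q \<in> Obj Funs" and "nat_surjection R D F Q q"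
    and "\<And>x m. x \<in> Obj D \<Longrightarrow> m \<in> elems F x \<Longrightarrow>
      q x m = \<zero>\<^bsub>obj_map Q x\<^esub> \<longleftrightarrow> m \<in> K x"
proof -
  interpret category D by fact
  interpret F: module_functor R \<V> D F by (rule module_functor.intro) fact+
  have "\<forall>x \<in> Obj D. \<exists>(N :: ('r, 'u) module) q. module R N \<and> carrier N \<in> \<U> \<and>
      q \<in> mod_hom R (obj_map F x) N \<and> q ` elems F x = carrier N \<and>
      (\<forall>m \<in> elems F x. q m = \<zero>\<^bsub>N\<^esub> \<longleftrightarrow> m \<in> K x)"
    using quotient_module_exists[OF assms(1) F.module K small] by blast
  then obtain N :: "'o \<Rightarrow> ('r, 'u) module" and q where Nq: "\<forall>x \<in> Obj D. module R (N x) \<and>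
      carrier (N x) \<in> \<U> \<and>
      q x \<in> mod_hom R (obj_map F x) (N x) \<and> q x ` elems F x = carrier (N x) \<and>
      (\<forall>m \<in> elems F x. q x m = \<zero>\<^bsub>N x\<^esub> \<longleftrightarrow> m \<in> K x)"
    by metis
  then have N: "module R (N x)" "carrier (N x) \<in> \<U>" and q: "q x \<in> mod_hom R (obj_map F x) (N x)"
    and surj: "q x ` elems F x = carrier (N x)"
    and ker: "\<And>m. m \<in> elems F x \<Longrightarrow> q x m = \<zero>\<^bsub>N x\<^esub> \<longleftrightarrow> m \<in> K x"
    if "x \<in> Obj D" for x
    using that by auto
  define qf where "qf x y f = compose (elems F x) (q y) (arr_map F x y f)" for x y f
  define Q :: "('o, 'a, 'r, 'u) mod_functor" where
    "Q = \<lparr>obj_map = N, arr_map = (\<lambda>x y f. lift_along (q x) (obj_map F x) (N x) (qf x y f))\<rparr>"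
  have Q_hom: "arr_map Q x y f \<in> mod_hom R (N x) (N y)"
    and Q_eq: "\<And>m. m \<in> elems F x \<Longrightarrow> arr_map Q x y f (q x m) = q y (arr_map F x y f m)"
    if x: "x \<in> Obj D" and y: "y \<in> Obj D" and f: "f \<in> Hom D x y" for x y f
  proof -
    have h: "qf x y f \<in> mod_hom R (obj_map F x) (N y)"
      unfolding qf_def by (rule compose_mod_hom[OF F.module[OF x] F.arr[OF x y f] q[OF y]])
    have "qf x y f m = \<zero>\<^bsub>N y\<^esub>" if "m \<in> elems F x" "q x m = \<zero>\<^bsub>N x\<^esub>" for m
      using that ker[OF x] ker[OF y F.arr_in[OF x y f]] stable[OF x y f]
      by (simp add: qf_def compose_eq)
    note * = lift_along[OF F.module[OF x] N(1)[OF x] N(1)[OF y] q[OF x] surj[OF x] h this]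
    show "arr_map Q x y f \<in> mod_hom R (N x) (N y)"
      using *(1) by (simp add: Q_def)
    show "arr_map Q x y f (q x m) = q y (arr_map F x y f m)" if "m \<in> elems F x" for m
      using *(2) that by (simp add: Q_def qf_def compose_eq)
  qed
  have objQ [simp]: "obj_map Q = N"
    by (simp add: Q_def)
  show thesis
  proof (rule that)
    show "Q \<in> Obj Funs"
      unfolding Funs_Obj_iff[OF assms(2)] objQ
    proof (intro conjI ballI)
      fix x v assume x: "x \<in> Obj D" and "v \<in> carrier (N x)"
      then obtain m where m: "m \<in> elems F x" "v = q x m"
        using surj by blast
      then show "arr_map Q x x (idt D x) v = v"
        using Q_eq[OF x x idt_in[OF x]] F.arr_idt[OF x] by simp
    next
      fix x y z f g v assume x: "x \<in> Obj D" and y: "y \<in> Obj D" and z: "z \<in> Obj D"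
        and f: "f \<in> Hom D x y" and g: "g \<in> Hom D y z" and "v \<in> carrier (N x)"
      then obtain m where m: "m \<in> elems F x" and v: "v = q x m"
        using surj by blast
      show "arr_map Q x z (cmp D x y z g f) v = arr_map Q y z g (arr_map Q x y f v)"
        unfolding v Q_eq[OF x z cmp_in[OF x y z f g] m] F.arr_cmp[OF x y z f g m]
          Q_eq[OF x y f m] Q_eq[OF y z g F.arr_in[OF x y f m]] ..
    qed (use N Q_hom in auto)
    show "nat_surjection R D F Q q"
      unfolding nat_surjection_def using q surj Q_eq by simp
  next
    fix x m assume "x \<in> Obj D" "m \<in> elems F x"
    then show "q x m = \<zero>\<^bsub>obj_map Q x\<^esub> \<longleftrightarrow> m \<in> K x"
      using ker by simp
  qed
qed

lemma subfunctor_exists: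
  fixes F :: "('o, 'a, 'r, 'u) mod_functor"
  assumes "universe \<U>" and "category D" and F: "F \<in> Obj Funs"
    and K: "\<And>x. x \<in> Obj D \<Longrightarrow> submodule (K x) R (obj_map F x)"
    and stable: "\<And>x y f u. x \<in> Obj D \<Longrightarrow> y \<in> Obj D \<Longrightarrow> f \<in> Hom D x y \<Longrightarrow> u \<in> K x \<Longrightarrow>
      arr_map F x y f u \<in> K y"
  obtains S j where "S \<in> Obj Funs" and "j \<in> Hom Funs S F"
    and "\<And>x. x \<in> Obj D \<Longrightarrow> obj_map S x = (obj_map F x)\<lparr>carrier := K x\<rparr>"
    and "\<And>x y f u. u \<in> K x \<Longrightarrow> arr_map S x y f u = arr_map F x y f u"
    and "\<And>x u. x \<in> Obj D \<Longrightarrow> u \<in> K x \<Longrightarrow> j x u = u"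
proof -
  interpret category D by fact
  interpret F: module_functor R \<U> D F by (rule module_functor.intro) fact+
  have sub: "K x \<subseteq> elems F x" if "x \<in> Obj D" for x
    using module.submoduleE(1)[OF F.module[OF that] K[OF that]] .
  define S where "S = F\<lparr>obj_map := (\<lambda>x. (obj_map F x)\<lparr>carrier := K x\<rparr>),
    arr_map := (\<lambda>x y f. restrict (arr_map F x y f) (K x))\<rparr>"
  have S_obj: "obj_map S x = (obj_map F x)\<lparr>carrier := K x\<rparr>" for x
    by (simp add: S_def)
  have S_arr: "arr_map S x y f = restrict (arr_map F x y f) (K x)" for x y f
    by (simp add: S_def)
  have mod: "module R (obj_map S x)" if "x \<in> Obj D" for x
    unfolding S_obj by (rule submodule.submodule_is_module[OF K[OF that] F.module[OF that]])
  show thesis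
  proof (rule that[of S "\<lambda>x \<in> Obj D. \<lambda>u \<in> K x. u"])
    show "S \<in> Obj Funs"
      unfolding Funs_Obj_iff[OF assms(2)]
    proof (intro conjI ballI)
      fix x assume x: "x \<in> Obj D"
      show "module R (obj_map S x)" by (rule mod[OF x])
      show "elems S x \<in> \<U>"
        using assms(1) sub[OF x] F.carrier_in[OF x] unfolding universe_def S_obj by simp
      show "arr_map S x x (idt D x) u = u" if "u \<in> elems S x" for u
        using that F.arr_idt[OF x] sub[OF x] by (auto simp: S_obj S_arr)
    next
      fix x y f assume x: "x \<in> Obj D" and y: "y \<in> Obj D" and f: "f \<in> Hom D x y"
      show "arr_map S x y f \<in> mod_hom R (obj_map S x) (obj_map S y)"
        using restrict_mod_hom[OF mod[OF x], of "arr_map F x y f" "obj_map S y"]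
          stable[OF x y f] sub[OF x] mod_hom_add[OF F.arr[OF x y f]] mod_hom_smult[OF F.arr[OF x y f]]
        by (simp add: S_obj S_arr subset_iff)
      fix z g u assume z: "z \<in> Obj D" and g: "g \<in> Hom D y z" and u: "u \<in> elems S x"
      show "arr_map S x z (cmp D x y z g f) u = arr_map S y z g (arr_map S x y f u)"
        using u sub[OF x] F.arr_cmp[OF x y z f g] stable[OF x y f] by (auto simp: S_obj S_arr)
    qed
    have "restrict (\<lambda>u. u) (K x) \<in> mod_hom R (obj_map S x) (obj_map F x)" if x: "x \<in> Obj D" for x
      using restrict_mod_hom[OF mod[OF x], of "\<lambda>u. u" "obj_map F x"] sub[OF x]
      by (auto simp: S_obj)
    then show "(\<lambda>x \<in> Obj D. \<lambda>u \<in> K x. u) \<in> Hom Funs S F"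
      by (intro restrict_Funs_Hom) (auto simp: linear_natural_def S_obj S_arr stable)
  qed (simp_all add: S_obj S_arr)
qed

lemma surjective_imp_epi:
  assumes "category D" and F: "F \<in> Obj Funs"
    and \<alpha>: "\<alpha> \<in> Hom Funs F G"
    and surj: "\<And>x. x \<in> Obj D \<Longrightarrow> \<alpha> x ` elems F x = elems G x"
  shows "is_epi Funs F G \<alpha>"
  unfolding is_epi_def
proof (intro conjI ballI impI)
  fix H g h assume g: "g \<in> Hom Funs G H" and h: "h \<in> Hom Funs G H"
    and eq: "cmp Funs F G H g \<alpha> = cmp Funs F G H h \<alpha>"
  show "g = h"
  proof (rule Funs_Hom_ext[OF g h])
    fix x v assume x: "x \<in> Obj D" and "v \<in> elems G x"
    then obtain u where u: "u \<in> elems F x" "v = \<alpha> x u"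
      using surj by blast
    then show "g x v = h x v"
      using Funs_cmp[OF x u(1), of G H g \<alpha>] Funs_cmp[OF x u(1), of G H h \<alpha>] eq
      by simp
  qed
qed (rule \<alpha>)

lemma small_in_universe: "X \<in> \<U> \<Longrightarrow> small \<U> X"
  unfolding small_def by blast

lemma zero_Funs_Hom:
  assumes "category D" and "F \<in> Obj Funs" and "G \<in> Obj Funs"
  shows "(\<lambda>x \<in> Obj D. \<lambda>u \<in> elems F x. \<zero>\<^bsub>obj_map G x\<^esub>) \<in> Hom Funs F G"
proof -
  interpret F: module_functor R \<U> D F by (rule module_functor.intro) fact+
  interpret G: module_functor R \<U> D G by (rule module_functor.intro) fact+
  have "(\<lambda>u \<in> elems F x. \<zero>\<^bsub>obj_map G x\<^esub>) \<in> mod_hom R (obj_map F x) (obj_map G x)"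
    if x: "x \<in> Obj D" for x
  proof -
    interpret M: module R "obj_map G x" by (rule G.module[OF x])
    show ?thesis
      by (rule restrict_mod_hom[OF F.module[OF x]]) auto
  qed
  then show ?thesis
    by (intro restrict_Funs_Hom)
       (auto simp: linear_natural_def F.arr_in mod_hom_zero[OF G.module G.module G.arr])
qed

text \<open>
  The projection onto the cokernel and the zero map agree after composition with the epimorphism, hence
  are equal, so the cokernel vanishes.
\<close>

lemma epi_imp_surjective:
  assumes U: "universe \<U>" and D: "category D" and F: "F \<in> Obj Funs"
    and G: "G \<in> Obj Funs"
    and epi: "is_epi Funs F G \<alpha>" and x: "x \<in> Obj D"
  shows "\<alpha> x ` elems F x = elems G x"
proof -
  interpret F: module_functor R \<U> D F by (rule module_functor.intro) fact+
  interpret G: module_functor R \<U> D G by (rule module_functor.intro) fact+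
  have \<alpha>: "\<alpha> \<in> Hom Funs F G"
    using epi by (simp add: is_epi_def)
  obtain Q q where Q: "Q \<in> Obj Funs" and q: "nat_surjection R D G Q q"
    and ker: "\<And>x m. x \<in> Obj D \<Longrightarrow> m \<in> elems G x \<Longrightarrow>
      q x m = \<zero>\<^bsub>obj_map Q x\<^esub> \<longleftrightarrow> m \<in> \<alpha> x ` elems F x"
  proof (rule quotient_functor_exists[OF U D G, of "\<lambda>x. \<alpha> x ` elems F x"])
    fix x assume x: "x \<in> Obj D"
    show "small \<U> (elems G x)"
      by (rule small_in_universe[OF G.carrier_in[OF x]])
    show "submodule (\<alpha> x ` elems F x) R (obj_map G x)"
      by (rule image_submodule[OF F.module[OF x] G.module[OF x] Funs_HomD(1)[OF \<alpha> x]])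
  next
    fix x y f u assume x: "x \<in> Obj D" and y: "y \<in> Obj D" and f: "f \<in> Hom D x y"
      and "u \<in> \<alpha> x ` elems F x"
    then obtain v where v: "v \<in> elems F x" and u: "u = \<alpha> x v" by blast
    show "arr_map G x y f u \<in> \<alpha> y ` elems F y"
      unfolding u Funs_HomD(3)[OF \<alpha> x y f v, symmetric] using F.arr_in[OF x y f v] by blast
  qed blast
  let ?zero = "\<lambda>x \<in> Obj D. \<lambda>u \<in> elems G x. \<zero>\<^bsub>obj_map Q x\<^esub>"
  have qn: "linear_natural R D G Q q"
    using q by (simp add: nat_surjection_iff)
  have q': "restrict q (Obj D) \<in> Hom Funs G Q"
    by (rule restrict_Funs_Hom[OF qn])
  have zero: "?zero \<in> Hom Funs G Q"
    by (rule zero_Funs_Hom[OF D G Q])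
  have "restrict q (Obj D) = ?zero"
  proof (rule is_epiD[OF epi Q q' zero])
    show "cmp Funs F G Q (restrict q (Obj D)) \<alpha> =
      cmp Funs F G Q ?zero \<alpha>"
      by (rule Funs_Hom_ext[OF Funs_cmp_in[OF D F \<alpha> q'] Funs_cmp_in[OF D F \<alpha> zero]])
         (use ker Funs_HomD(2)[OF \<alpha>] in \<open>simp add: Funs_cmp\<close>)
  qed
  then have "q x = (\<lambda>u \<in> elems G x. \<zero>\<^bsub>obj_map Q x\<^esub>)"
    using x by (metis (lifting) restrict_apply')
  then have "m \<in> \<alpha> x ` elems F x" if "m \<in> elems G x" for m
    using ker[OF x that] that by simp
  then show ?thesis
    using Funs_HomD(2)[OF \<alpha> x] by auto
qed

text \<open>
  A surjection with zero kernel is a quotient map, and the identity of \<open>F\<close> factors through it.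
\<close>

lemma bijective_imp_iso:
  assumes D: "category D" and F: "F \<in> Obj Funs"
    and G: "G \<in> Obj Funs" and \<alpha>: "\<alpha> \<in> Hom Funs F G"
    and inj: "\<And>x u. x \<in> Obj D \<Longrightarrow> u \<in> elems F x \<Longrightarrow> \<alpha> x u = \<zero>\<^bsub>obj_map G x\<^esub> \<Longrightarrow>
      u = \<zero>\<^bsub>obj_map F x\<^esub>"
    and surj: "\<And>x. x \<in> Obj D \<Longrightarrow> \<alpha> x ` elems F x = elems G x"
  shows "is_iso Funs F G \<alpha>"
proof -
  interpret F: module_functor R \<U> D F by (rule module_functor.intro) fact+
  have surj': "nat_surjection R D F G \<alpha>"
    using \<alpha> surj by (simp add: nat_surjection_iff Funs_Hom_iff)
  note idF = Funs_idt_in[OF D F] and idG = Funs_idt_in[OF D G]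
  have "linear_natural R D F F (idt Funs F)"
    using idF by (simp add: Funs_Hom_iff)
  from factor_through[OF D F G F surj' this] inj
  obtain \<beta> where \<beta>: "\<beta> \<in> Hom Funs G F"
    and \<beta>\<alpha>: "\<And>x m. x \<in> Obj D \<Longrightarrow> m \<in> elems F x \<Longrightarrow> \<beta> x (\<alpha> x m) = m"
    by (metis Funs_idt)
  have "cmp Funs F G F \<beta> \<alpha> = idt Funs F"
    by (rule Funs_Hom_ext[OF Funs_cmp_in[OF D F \<alpha> \<beta>] idF])
       (simp add: Funs_cmp Funs_idt \<beta>\<alpha>)
  moreover have "cmp Funs G F G \<alpha> \<beta> = idt Funs G"
  proof (rule Funs_Hom_ext[OF Funs_cmp_in[OF D G \<beta> \<alpha>] idG])
    fix x v assume x: "x \<in> Obj D" and v: "v \<in> elems G x"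
    then obtain u where "u \<in> elems F x" "v = \<alpha> x u"
      using surj by blast
    then show "cmp Funs G F G \<alpha> \<beta> x v = idt Funs G x v"
      using x v by (simp add: Funs_cmp Funs_idt \<beta>\<alpha>)
  qed
  ultimately show ?thesis
    using \<alpha> \<beta> unfolding is_iso_def by blast
qed

end

section \<open>Bifunctors\<close>

abbreviation bicategory :: "('o, 'a) category \<Rightarrow> ('o \<times> 'o, 'a \<times> 'a) category" where
  "bicategory C \<equiv> product_category (opposite C) C"

lemma bicategory_simps:
  "Obj (bicategory C) = Obj C \<times> Obj C"
  "Hom (bicategory C) p q = Hom C (fst q) (fst p) \<times> Hom C (snd p) (snd q)"
  "idt (bicategory C) p = (idt C (fst p), idt C (snd p))"
  "cmp (bicategory C) p q r h k =
    (cmp C (fst r) (fst q) (fst p) (fst k) (fst h), cmp C (snd p) (snd q) (snd r) (snd h) (snd k))"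
  by (simp_all add: product_category_def opposite_def)

lemma category_bicategory:
  assumes "category C"
  shows "category (bicategory C)"
proof -
  interpret category C by fact
  show ?thesis
    by standard
      (auto simp: bicategory_simps idt_in cmp_in cmp_idt_left cmp_idt_right cmp_assoc)
qed

lemma free_hom_simps:
  "obj_map (free_hom R C) (x, y) = free_module R (Hom C x y)"
  "arr_map (free_hom R C) (x, y) (x', y') (f, g) =
    free_map R (Hom C x y) (\<lambda>h. cmp C x' y y' g (cmp C x' x y h f))"
  by (simp_all add: free_hom_def)

lemma free_hom_arr:
  assumes "category C" and "cring R"
    and x: "x \<in> Obj C" "x' \<in> Obj C" and y: "y \<in> Obj C" "y' \<in> Obj C"
    and f: "f \<in> Hom C x' x" and g: "g \<in> Hom C y y'"
  shows "arr_map (free_hom R C) (x, y) (x', y') (f, g) \<in>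
      mod_hom R (free_module R (Hom C x y)) (free_module R (Hom C x' y'))"
    and "\<And>h. h \<in> Hom C x y \<Longrightarrow> arr_map (free_hom R C) (x, y) (x', y') (f, g) (free_gen R h) =
      free_gen R (cmp C x' y y' g (cmp C x' x y h f))"
proof -
  interpret category C by fact
  have "(\<lambda>h. cmp C x' y y' g (cmp C x' x y h f)) \<in> Hom C x y \<rightarrow> Hom C x' y'"
    using cmp_in[OF x(2) y _ g] cmp_in[OF x(2,1) y(1) f] by blast
  note * = free_map[OF assms(2) this]
  show "arr_map (free_hom R C) (x, y) (x', y') (f, g) \<in>
      mod_hom R (free_module R (Hom C x y)) (free_module R (Hom C x' y'))"
    and "\<And>h. h \<in> Hom C x y \<Longrightarrow> arr_map (free_hom R C) (x, y) (x', y') (f, g) (free_gen R h) =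
      free_gen R (cmp C x' y y' g (cmp C x' x y h f))"
    using * by (simp_all add: free_hom_simps)
qed

lemma free_hom_functor:
  assumes C: "category C" and R: "cring R"
  shows "free_hom R C \<in> Obj (functor_mod R UNIV (bicategory C))"
proof -
  interpret category C by fact
  note mod = module_free_module[OF R]
  note arr = free_hom_arr[OF C R]
  show ?thesis
    unfolding Funs_Obj_iff[OF category_bicategory[OF C]]
  proof (intro conjI ballI)
    fix p assume "p \<in> Obj (bicategory C)"
    then obtain x y where p: "p = (x, y)" and x: "x \<in> Obj C" and y: "y \<in> Obj C"
      by (auto simp: bicategory_simps)
    show "module R (obj_map (free_hom R C) p)"
      by (simp add: p free_hom_simps mod)
    show "elems (free_hom R C) p \<in> UNIV" by simp
    fix c assume c: "c \<in> elems (free_hom R C) p"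
    have "arr_map (free_hom R C) (x, y) (x, y) (idt C x, idt C y) =
      restrict (\<lambda>c. c) (carrier (free_module R (Hom C x y)))"
    proof (rule mod_hom_free_ext[OF R mod arr(1)])
      show "restrict (\<lambda>c. c) (carrier (free_module R (Hom C x y))) \<in>
        mod_hom R (free_module R (Hom C x y)) (free_module R (Hom C x y))"
        by (rule restrict_mod_hom[OF mod]) auto
    next
      fix h assume h: "h \<in> Hom C x y"
      then show "arr_map (free_hom R C) (x, y) (x, y) (idt C x, idt C y) (free_gen R h) =
        restrict (\<lambda>c. c) (carrier (free_module R (Hom C x y))) (free_gen R h)"
        using arr(2)[OF x x y y idt_in[OF x] idt_in[OF y] h] x y
        by (simp add: cmp_idt_left cmp_idt_right free_gen_in[OF R])
    qed (use x y idt_in in auto)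
    then show "arr_map (free_hom R C) p p (idt (bicategory C) p) c = c"
      using c by (simp add: p bicategory_simps free_hom_simps)
  next
    fix p q k assume "p \<in> Obj (bicategory C)" and "q \<in> Obj (bicategory C)"
      and "k \<in> Hom (bicategory C) p q"
    then obtain x y x' y' f g where p: "p = (x, y)" and q: "q = (x', y')" and k: "k = (f, g)"
      and x: "x \<in> Obj C" and y: "y \<in> Obj C" and x': "x' \<in> Obj C" and y': "y' \<in> Obj C"
      and f: "f \<in> Hom C x' x" and g: "g \<in> Hom C y y'"
      by (auto simp: bicategory_simps)
    note arr1 = arr[OF x x' y y' f g]
    show "arr_map (free_hom R C) p q k \<in>
      mod_hom R (obj_map (free_hom R C) p) (obj_map (free_hom R C) q)"
      using arr1(1) by (simp add: p q k free_hom_simps)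
    fix r l c assume "r \<in> Obj (bicategory C)" and "l \<in> Hom (bicategory C) q r"
      and c: "c \<in> elems (free_hom R C) p"
    then obtain x'' y'' f' g' where r: "r = (x'', y'')" and l: "l = (f', g')"
      and x'': "x'' \<in> Obj C" and y'': "y'' \<in> Obj C"
      and f': "f' \<in> Hom C x'' x'" and g': "g' \<in> Hom C y' y''"
      by (auto simp: bicategory_simps q)
    note ff = cmp_in[OF x'' x' x f' f] and gg = cmp_in[OF y y' y'' g g']
    note arr2 = arr[OF x' x'' y' y'' f' g'] and arr3 = arr[OF x x'' y y'' ff gg]
    have "arr_map (free_hom R C) (x, y) (x'', y'') (cmp C x'' x' x f f', cmp C y y' y'' g' g) =
      compose (carrier (free_module R (Hom C x y)))
        (arr_map (free_hom R C) (x', y') (x'', y'') (f', g'))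
        (arr_map (free_hom R C) (x, y) (x', y') (f, g))"
    proof (rule mod_hom_free_ext[OF R mod arr3(1) compose_mod_hom[OF mod arr1(1) arr2(1)]])
      fix h assume h: "h \<in> Hom C x y"
      note hf = cmp_in[OF x' x y f h]
      note hff = cmp_in[OF x'' x' y f' hf]
      have "cmp C x'' y y'' (cmp C y y' y'' g' g) (cmp C x'' x y h (cmp C x'' x' x f f')) =
        cmp C x'' y' y'' g' (cmp C x'' x' y' (cmp C x' y y' g (cmp C x' x y h f)) f')"
        using cmp_assoc[OF x'' x' x y f' f h] cmp_assoc[OF x'' x' y y' f' hf g]
          cmp_assoc[OF x'' y y' y'' hff g g'] by simp
      then show "arr_map (free_hom R C) (x, y) (x'', y'') (cmp C x'' x' x f f', cmp C y y' y'' g' g)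
          (free_gen R h) =
        compose (carrier (free_module R (Hom C x y)))
          (arr_map (free_hom R C) (x', y') (x'', y'') (f', g'))
          (arr_map (free_hom R C) (x, y) (x', y') (f, g)) (free_gen R h)"
        using arr1(2)[OF h] arr2(2)[OF cmp_in[OF x' y y' hf g]] arr3(2)[OF h] h
        by (simp add: compose_eq free_gen_in[OF R])
    qed
    then show "arr_map (free_hom R C) p r (cmp (bicategory C) p q r l k) c =
      arr_map (free_hom R C) q r l (arr_map (free_hom R C) p q k c)"
      using c by (simp add: p q r k l bicategory_simps free_hom_simps compose_eq)
  qed
qed

lemma fix_left_simps:
  "obj_map (fix_left C T a) y = obj_map T (a, y)"
  "arr_map (fix_left C T a) y y' g = arr_map T (a, y) (a, y') (idt C a, g)"
  by (simp_all add: fix_left_def)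

lemma fix_left_functor:
  assumes C: "category C" and T: "T \<in> Obj (functor_mod R \<U> (bicategory C))" and a: "a \<in> Obj C"
  shows "fix_left C T a \<in> Obj (functor_mod R \<U> C)"
proof -
  interpret category C by fact
  interpret T: module_functor R \<U> "bicategory C" T
    by (rule module_functor.intro[OF category_bicategory[OF C] T])
  note ida = idt_in[OF a]
  show ?thesis
    unfolding Funs_Obj_iff[OF C] fix_left_simps
  proof (intro conjI ballI)
    fix x y z f g u assume "x \<in> Obj C" "y \<in> Obj C" "z \<in> Obj C" "f \<in> Hom C x y" "g \<in> Hom C y z"
      "u \<in> elems T (a, x)"
    then show "arr_map T (a, x) (a, z) (idt C a, cmp C x y z g f) u =
      arr_map T (a, y) (a, z) (idt C a, g) (arr_map T (a, x) (a, y) (idt C a, f) u)"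
      using T.arr_cmp[of "(a, x)" "(a, y)" "(a, z)" "(idt C a, f)" "(idt C a, g)" u] a ida
      by (simp add: bicategory_simps cmp_idt_left)
  next
    fix x u assume "x \<in> Obj C" "u \<in> elems T (a, x)"
    then show "arr_map T (a, x) (a, x) (idt C a, idt C x) u = u"
      using T.arr_idt[of "(a, x)" u] a by (simp add: bicategory_simps)
  qed (use T.module T.carrier_in T.arr a ida in \<open>auto simp: bicategory_simps\<close>)
qed

lemma fix_left_surjection:
  assumes "category C" and \<mu>: "nat_surjection R (bicategory C) F T \<mu>" and a: "a \<in> Obj C"
  shows "nat_surjection R C (fix_left C F a) (fix_left C T a) (\<lambda>y. \<mu> (a, y))"
proof -
  interpret category C by fact
  show ?thesis
    using \<mu> a idt_in[OF a] unfolding nat_surjection_def fix_left_simps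
    by (simp add: bicategory_simps)
qed

section \<open>The action of formal sums of arrows\<close>

text \<open>
  A functor to modules is a left module over the linearised category: the formal sum of the arrows \<open>f\<close>
  with coefficients \<open>c f\<close> sends \<open>u\<close> to the sum of \<open>c f\<close> times the image of \<open>u\<close> under \<open>f\<close>. For fixed \<open>u\<close>
  this is the Yoneda map from the linearised representable functor to \<open>F\<close> that sends the identity to
  \<open>u\<close>.
\<close>

definition act ::
  "'r ring \<Rightarrow> ('o, 'a) category \<Rightarrow> ('o, 'a, 'r, 'u) mod_functor \<Rightarrow> 'o \<Rightarrow> 'o \<Rightarrow> 'u
   \<Rightarrow> ('a \<Rightarrow> 'r) \<Rightarrow> 'u" where
  "act R C F x y u = free_lift R (Hom C x y) (obj_map F y) (\<lambda>f. arr_map F x y f u)"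

locale cring_functor = module_functor R \<U> C F + cring R
  for R :: "'r ring" and \<U> :: "'u set set" and C :: "('o, 'a) category"
    and F :: "('o, 'a, 'r, 'u) mod_functor"
begin

lemma act_hom:
  assumes "x \<in> Obj C" and "y \<in> Obj C" and "u \<in> elems F x"
  shows "act R C F x y u \<in> mod_hom R (free_module R (Hom C x y)) (obj_map F y)"
  unfolding act_def by (rule free_lift(1)[OF module]) (use assms arr_in in auto)

lemma act_gen:
  assumes "x \<in> Obj C" and "y \<in> Obj C" and "u \<in> elems F x" and "f \<in> Hom C x y"
  shows "act R C F x y u (free_gen R f) = arr_map F x y f u"
  unfolding act_def by (rule free_lift(2)[OF module]) (use assms arr_in in auto)

lemma act_in:
  assumes "x \<in> Obj C" and "y \<in> Obj C" and "u \<in> elems F x"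
    and "c \<in> carrier (free_module R (Hom C x y))"
  shows "act R C F x y u c \<in> elems F y"
  by (rule mod_hom_closed[OF act_hom]) fact+

lemma act_hom_left:
  assumes x: "x \<in> Obj C" and y: "y \<in> Obj C" and c: "c \<in> carrier (free_module R (Hom C x y))"
  shows "(\<lambda>u \<in> elems F x. act R C F x y u c) \<in> mod_hom R (obj_map F x) (obj_map F y)"
proof (rule restrict_mod_hom[OF module[OF x]])
  interpret Mx: module R "obj_map F x" by (rule module[OF x])
  interpret My: module R "obj_map F y" by (rule module[OF y])
  have R: "cring R" by (rule is_cring)
  note free = module_free_module[OF R]
  note hom = act_hom[OF x y]
  fix u assume u: "u \<in> elems F x"
  show "act R C F x y u c \<in> elems F y"
    by (rule act_in[OF x y u c])
  show "act R C F x y (r \<odot>\<^bsub>obj_map F x\<^esub> u) c = r \<odot>\<^bsub>obj_map F y\<^esub> act R C F x y u c"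
    if r: "r \<in> carrier R" for r
    using R c
  proof (induction rule: free_module_induct)
    case (add c d)
    then show ?case
      using r u act_in[OF x y u]
      by (simp add: mod_hom_add[OF hom] My.smult_r_distr)
  next
    case (smult s c)
    then show ?case
      using r u act_in[OF x y u]
      by (simp add: mod_hom_smult[OF hom] m_comm flip: My.smult_assoc1)
  next
    case (gen f)
    then show ?case
      using r u by (simp add: act_gen[OF x y] mod_hom_smult[OF arr[OF x y]])
  qed (use r u in \<open>simp add: mod_hom_zero[OF free module[OF y] hom]\<close>)
  fix v assume v: "v \<in> elems F x"
  show "act R C F x y (u \<oplus>\<^bsub>obj_map F x\<^esub> v) c =
    act R C F x y u c \<oplus>\<^bsub>obj_map F y\<^esub> act R C F x y v c"
    using R c
  proof (induction rule: free_module_induct)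
    case (add c d)
    then show ?case
      using u v act_in[OF x y u] act_in[OF x y v]
      by (simp add: mod_hom_add[OF hom] My.M.a_ac)
  next
    case (smult s c)
    then show ?case
      using u v act_in[OF x y u] act_in[OF x y v]
      by (simp add: mod_hom_smult[OF hom] My.smult_r_distr)
  next
    case (gen f)
    then show ?case
      using u v by (simp add: act_gen[OF x y] mod_hom_add[OF arr[OF x y]])
  qed (use u v in \<open>simp add: mod_hom_zero[OF free module[OF y] hom]\<close>)
qed

text \<open>
  Acting by \<open>g c f\<close> is the same as acting by \<open>f\<close>, then by \<open>c\<close>, then by \<open>g\<close>. This is what makes the
  annihilator of a family of functors a two-sided ideal.
\<close>

lemma act_free_hom:
  assumes x: "x \<in> Obj C" and x': "x' \<in> Obj C" and y: "y \<in> Obj C" and y': "y' \<in> Obj C"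
    and f: "f \<in> Hom C x' x" and g: "g \<in> Hom C y y'"
    and u: "u \<in> elems F x'" and c: "c \<in> carrier (free_module R (Hom C x y))"
  shows "act R C F x' y' u (arr_map (free_hom R C) (x, y) (x', y') (f, g) c) =
    arr_map F y y' g (act R C F x y (arr_map F x' x f u) c)"
proof -
  have R: "cring R" by (rule is_cring)
  interpret category C by (rule base)
  note free = module_free_module[OF R]
  note fh = free_hom_arr[OF base R x x' y y' f g]
  note fu = arr_in[OF x' x f u]
  let ?M = "free_module R (Hom C x y)"
  have "compose (carrier ?M) (act R C F x' y' u) (arr_map (free_hom R C) (x, y) (x', y') (f, g)) =
    compose (carrier ?M) (arr_map F y y' g) (act R C F x y (arr_map F x' x f u))"
  proof (rule mod_hom_free_ext[OF R module[OF y']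
        compose_mod_hom[OF free fh(1) act_hom[OF x' y' u]]
        compose_mod_hom[OF free act_hom[OF x y fu] arr[OF y y' g]]])
    fix h assume h: "h \<in> Hom C x y"
    note hf = cmp_in[OF x' x y f h]
    show "compose (carrier ?M) (act R C F x' y' u)
        (arr_map (free_hom R C) (x, y) (x', y') (f, g)) (free_gen R h) =
      compose (carrier ?M) (arr_map F y y' g) (act R C F x y (arr_map F x' x f u)) (free_gen R h)"
      using free_gen_in[OF R h] fh(2)[OF h] act_gen[OF x' y' u cmp_in[OF x' y y' hf g]]
        act_gen[OF x y fu h] arr_cmp[OF x' y y' hf g u] arr_cmp[OF x' x y f h u]
      by (simp add: compose_eq)
  qed
  from fun_cong[OF this, of c] show ?thesis
    using c by (simp add: compose_eq)
qed

end

lemma act_natural: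
  assumes F: "cring_functor R \<U> C F" and G: "cring_functor R \<V> C G"
    and \<alpha>: "linear_natural R C F G \<alpha>"
    and x: "x \<in> Obj C" and y: "y \<in> Obj C" and u: "u \<in> elems F x"
    and c: "c \<in> carrier (free_module R (Hom C x y))"
  shows "\<alpha> y (act R C F x y u c) = act R C G x y (\<alpha> x u) c"
proof -
  interpret F: cring_functor R \<U> C F by fact
  interpret G: cring_functor R \<V> C G by fact
  have R: "cring R" by (rule F.is_cring)
  note free = module_free_module[OF R] and n = linear_naturalD[OF \<alpha>]
  note \<alpha>u = n(2)[OF x u]
  let ?M = "free_module R (Hom C x y)"
  have "compose (carrier ?M) (\<alpha> y) (act R C F x y u) = act R C G x y (\<alpha> x u)"
  proof (rule mod_hom_free_ext[OF R G.module[OF y] compose_mod_hom[OF free F.act_hom[OF x y u] n(1)[OF y]]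
        G.act_hom[OF x y \<alpha>u]])
    fix h assume h: "h \<in> Hom C x y"
    then show "compose (carrier ?M) (\<alpha> y) (act R C F x y u) (free_gen R h) =
      act R C G x y (\<alpha> x u) (free_gen R h)"
      using free_gen_in[OF R h] F.act_gen[OF x y u h] G.act_gen[OF x y \<alpha>u h] n(3)[OF x y h u]
      by (simp add: compose_eq)
  qed
  from fun_cong[OF this, of c] show ?thesis
    using c by (simp add: compose_eq)
qed

section \<open>Quotients of the free bifunctor are Yoneda bifunctors\<close>

locale linear_setting =
  fixes R :: "'r ring" and \<U> :: "'u set set" and C :: "('o, 'a) category"
  assumes universe: "universe \<U>" and cring: "cring R" and base: "category C"
    and small_scalars: "small \<U> (carrier R)"
    and small_Hom: "\<And>x y. x \<in> Obj C \<Longrightarrow> y \<in> Obj C \<Longrightarrow> small \<U> (Hom C x y)"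
begin

abbreviation Mod :: "(('o, 'a, 'r, 'u) mod_functor, 'o \<Rightarrow> 'u \<Rightarrow> 'u) category" where
  "Mod \<equiv> functor_mod R \<U> C"

abbreviation Bimod :: "(('o, 'a, 'r, 'u) mod_bifunctor, 'o \<times> 'o \<Rightarrow> 'u \<Rightarrow> 'u) category" where
  "Bimod \<equiv> functor_mod R \<U> (bicategory C)"

abbreviation Sums :: "'o \<Rightarrow> 'o \<Rightarrow> ('a \<Rightarrow> 'r) set" where
  "Sums x y \<equiv> carrier (free_module R (Hom C x y))"

lemma cring_functor: "F \<in> Obj Mod \<Longrightarrow> cring_functor R \<U> C F"
  by (intro cring_functor.intro module_functor.intro base cring)

lemma act_natural_Mod:
  assumes "F \<in> Obj Mod" and "G \<in> Obj Mod" and "\<alpha> \<in> Hom Mod F G"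
    and "x \<in> Obj C" and "y \<in> Obj C" and "u \<in> elems F x" and "c \<in> Sums x y"
  shows "\<alpha> y (act R C F x y u c) = act R C G x y (\<alpha> x u) c"
  using assms by (intro act_natural[of R \<U> C F \<U> G] cring_functor) (auto simp: Funs_Hom_iff)

lemma act_linear_natural:
  assumes G: "G \<in> Obj Mod" and a: "a \<in> Obj C" and u: "u \<in> elems G a"
  shows "linear_natural R C (fix_left C (free_hom R C) a) G (\<lambda>y. act R C G a y u)"
proof -
  interpret category C by (rule base)
  interpret G: cring_functor R \<U> C G by (rule cring_functor[OF G])
  show ?thesis
    unfolding linear_natural_def fix_left_simps
  proof (intro conjI ballI)
    fix y assume y: "y \<in> Obj C"
    show "act R C G a y u \<in> mod_hom R (obj_map (free_hom R C) (a, y)) (obj_map G y)"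
      using G.act_hom[OF a y u] by (simp add: free_hom_simps)
    fix y' g c assume y': "y' \<in> Obj C" and g: "g \<in> Hom C y y'"
      and "c \<in> elems (free_hom R C) (a, y)"
    then show "act R C G a y' u (arr_map (free_hom R C) (a, y) (a, y') (idt C a, g) c) =
      arr_map G y y' g (act R C G a y u c)"
      using G.act_free_hom[OF a a y y' idt_in[OF a] g u, of c] G.arr_idt[OF a u]
      by (simp add: free_hom_simps)
  qed
qed

text \<open>
  The Yoneda lemma for quotients: if \<open>T\<close> is \<open>free_hom\<close> modulo \<open>I\<close>, then an element \<open>u\<close> of \<open>G a\<close> defines a
  map from \<open>T(a, -)\<close> to \<open>G\<close> as soon as \<open>I\<close> acts on it by zero.
\<close>

lemma yoneda_extend:
  assumes T: "T \<in> Obj Bimod"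
    and \<mu>: "nat_surjection R (bicategory C) (free_hom R C) T \<mu>"
    and G: "G \<in> Obj Mod" and a: "a \<in> Obj C" and u: "u \<in> elems G a"
    and ker: "\<And>y c. y \<in> Obj C \<Longrightarrow> c \<in> Sums a y \<Longrightarrow> \<mu> (a, y) c = \<zero>\<^bsub>obj_map T (a, y)\<^esub> \<Longrightarrow>
      act R C G a y u c = \<zero>\<^bsub>obj_map G y\<^esub>"
  obtains \<alpha> where "\<alpha> \<in> Hom Mod (fix_left C T a) G"
    and "\<And>y c. y \<in> Obj C \<Longrightarrow> c \<in> Sums a y \<Longrightarrow> \<alpha> y (\<mu> (a, y) c) = act R C G a y u c"
proof (rule factor_through[OF base fix_left_functor[OF base free_hom_functor[OF base cring] a]
      fix_left_functor[OF base T a] G fix_left_surjection[OF base \<mu> a]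
      act_linear_natural[OF G a u]])
  fix y c assume "y \<in> Obj C" "c \<in> elems (fix_left C (free_hom R C) a) y"
    "\<mu> (a, y) c = \<zero>\<^bsub>obj_map (fix_left C T a) y\<^esub>"
  then show "act R C G a y u c = \<zero>\<^bsub>obj_map G y\<^esub>"
    using ker by (simp add: fix_left_simps free_hom_simps)
qed (use that in \<open>simp add: fix_left_simps free_hom_simps\<close>)

lemma bifunctor_surjectionD:
  assumes \<mu>: "nat_surjection R (bicategory C) (free_hom R C) T \<mu>"
    and x: "x \<in> Obj C" and y: "y \<in> Obj C"
  shows "\<mu> (x, y) \<in> mod_hom R (free_module R (Hom C x y)) (obj_map T (x, y))"
    and "\<mu> (x, y) ` Sums x y = elems T (x, y)"
    and "\<And>x' y' f g c. x' \<in> Obj C \<Longrightarrow> y' \<in> Obj C \<Longrightarrow> f \<in> Hom C x' x \<Longrightarrow> g \<in> Hom C y y' \<Longrightarrow>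
      c \<in> Sums x y \<Longrightarrow> \<mu> (x', y') (arr_map (free_hom R C) (x, y) (x', y') (f, g) c) =
        arr_map T (x, y) (x', y') (f, g) (\<mu> (x, y) c)"
proof -
  have "(x, y) \<in> Obj (bicategory C)"
    using x y by (simp add: bicategory_simps)
  then show "\<mu> (x, y) \<in> mod_hom R (free_module R (Hom C x y)) (obj_map T (x, y))"
    and "\<mu> (x, y) ` Sums x y = elems T (x, y)"
    using \<mu> unfolding nat_surjection_def free_hom_simps(1)[of R C x y, symmetric] by blast+
  fix x' y' f g c assume "x' \<in> Obj C" "y' \<in> Obj C" "f \<in> Hom C x' x" "g \<in> Hom C y y'" "c \<in> Sums x y"
  then have "(x', y') \<in> Obj (bicategory C)" "(f, g) \<in> Hom (bicategory C) (x, y) (x', y')"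
    "c \<in> elems (free_hom R C) (x, y)"
    by (simp_all add: bicategory_simps free_hom_simps)
  then show "\<mu> (x', y') (arr_map (free_hom R C) (x, y) (x', y') (f, g) c) =
        arr_map T (x, y) (x', y') (f, g) (\<mu> (x, y) c)"
    using \<mu> \<open>(x, y) \<in> Obj (bicategory C)\<close> unfolding nat_surjection_def by blast
qed

text \<open>
  The kernel \<open>I\<close> of \<open>\<mu>\<close> annihilates \<open>T(a, -)\<close>: an element of \<open>T(a, x)\<close> is the class of some \<open>d\<close>, and \<open>c\<close>
  in \<open>I(x, y)\<close> sends it to the class of \<open>c d\<close>, which is again in \<open>I\<close>. That \<open>I\<close> is a right ideal is used
  in the form of the functoriality of \<open>T\<close> in its first variable.
\<close>

lemma fix_left_annihilated:
  assumes T: "T \<in> Obj Bimod"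
    and \<mu>: "nat_surjection R (bicategory C) (free_hom R C) T \<mu>"
    and a: "a \<in> Obj C" and x: "x \<in> Obj C" and y: "y \<in> Obj C"
    and t: "t \<in> elems T (a, x)" and c: "c \<in> Sums x y"
    and zero: "\<mu> (x, y) c = \<zero>\<^bsub>obj_map T (x, y)\<^esub>"
  shows "act R C (fix_left C T a) x y t c = \<zero>\<^bsub>obj_map T (a, y)\<^esub>"
proof -
  interpret category C by (rule base)
  interpret T: module_functor R \<U> "bicategory C" T
    by (rule module_functor.intro[OF category_bicategory[OF base] T])
  interpret Ta: cring_functor R \<U> C "fix_left C T a"
    by (rule cring_functor[OF fix_left_functor[OF base T a]])
  note free = module_free_module[OF cring]
  note \<mu>ax = bifunctor_surjectionD[OF \<mu> a x] and \<mu>ay = bifunctor_surjectionD[OF \<mu> a y]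
    and \<mu>xy = bifunctor_surjectionD[OF \<mu> x y]
  have mod: "module R (obj_map T (p, q))" if "p \<in> Obj C" "q \<in> Obj C" for p q
    using T.module that by (simp add: bicategory_simps)
  interpret Tay: module R "obj_map T (a, y)" by (rule mod[OF a y])
  \<comment> \<open>both sides of the claim are linear in \<open>t\<close>, so the class of a single arrow \<open>f\<close> suffices\<close>
  have gen: "act R C (fix_left C T a) x y (\<mu> (a, x) (free_gen R f)) c = \<zero>\<^bsub>obj_map T (a, y)\<^esub>"
    if f: "f \<in> Hom C a x" for f
  proof -
    note gf = free_gen_in[OF cring f]
    have tf: "\<mu> (a, x) (free_gen R f) \<in> elems (fix_left C T a) x"
      using mod_hom_closed[OF \<mu>ax(1) gf] by (simp add: fix_left_simps)
    note fid = free_hom_arr[OF base cring x a y y f idt_in[OF y]]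
    have "act R C (fix_left C T a) x y (\<mu> (a, x) (free_gen R f)) =
      compose (Sums x y) (\<mu> (a, y)) (arr_map (free_hom R C) (x, y) (a, y) (f, idt C y))"
    proof (rule mod_hom_free_ext[OF cring mod[OF a y] _ compose_mod_hom[OF free fid(1) \<mu>ay(1)]])
      show "act R C (fix_left C T a) x y (\<mu> (a, x) (free_gen R f)) \<in>
        mod_hom R (free_module R (Hom C x y)) (obj_map T (a, y))"
        using Ta.act_hom[OF x y tf] by (simp add: fix_left_simps)
      fix g assume g: "g \<in> Hom C x y"
      note gf' = cmp_in[OF a x y f g]
      have "act R C (fix_left C T a) x y (\<mu> (a, x) (free_gen R f)) (free_gen R g) =
        \<mu> (a, y) (arr_map (free_hom R C) (a, x) (a, y) (idt C a, g) (free_gen R f))"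
        using Ta.act_gen[OF x y tf g] \<mu>ax(3)[OF a y idt_in[OF a] g gf] by (simp add: fix_left_simps)
      also have "\<dots> = \<mu> (a, y) (free_gen R (cmp C a x y g f))"
        using free_hom_arr(2)[OF base cring a a x y idt_in[OF a] g f] cmp_idt_right[OF a x f] by simp
      also have "\<dots> = \<mu> (a, y) (arr_map (free_hom R C) (x, y) (a, y) (f, idt C y) (free_gen R g))"
        using fid(2)[OF g] cmp_idt_left[OF a y gf'] by simp
      finally show "act R C (fix_left C T a) x y (\<mu> (a, x) (free_gen R f)) (free_gen R g) =
        compose (Sums x y) (\<mu> (a, y)) (arr_map (free_hom R C) (x, y) (a, y) (f, idt C y))
          (free_gen R g)"
        using free_gen_in[OF cring g] by (simp add: compose_eq)
    qed
    from fun_cong[OF this, of c]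
    have "act R C (fix_left C T a) x y (\<mu> (a, x) (free_gen R f)) c =
      \<mu> (a, y) (arr_map (free_hom R C) (x, y) (a, y) (f, idt C y) c)"
      using c by (simp add: compose_eq)
    also have "\<dots> = arr_map T (x, y) (a, y) (f, idt C y) \<zero>\<^bsub>obj_map T (x, y)\<^esub>"
      using \<mu>xy(3)[OF a y f idt_in[OF y] c] zero by simp
    also have "\<dots> = \<zero>\<^bsub>obj_map T (a, y)\<^esub>"
      by (rule mod_hom_zero[OF mod[OF x y] mod[OF a y] T.arr])
         (use x y a f idt_in in \<open>auto simp: bicategory_simps\<close>)
    finally show ?thesis .
  qed
  let ?L = "\<lambda>t \<in> elems T (a, x). act R C (fix_left C T a) x y t c"
  have L: "?L \<in> mod_hom R (obj_map T (a, x)) (obj_map T (a, y))"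
    using Ta.act_hom_left[OF x y c] by (simp add: fix_left_simps)
  have eq: "compose (Sums a x) ?L (\<mu> (a, x)) = (\<lambda>d \<in> Sums a x. \<zero>\<^bsub>obj_map T (a, y)\<^esub>)"
  proof (rule mod_hom_free_ext[OF cring mod[OF a y] compose_mod_hom[OF free \<mu>ax(1) L]])
    show "(\<lambda>d \<in> Sums a x. \<zero>\<^bsub>obj_map T (a, y)\<^esub>) \<in>
      mod_hom R (free_module R (Hom C a x)) (obj_map T (a, y))"
      by (rule restrict_mod_hom[OF free]) auto
  next
    fix f assume f: "f \<in> Hom C a x"
    then show "compose (Sums a x) ?L (\<mu> (a, x)) (free_gen R f) =
      (\<lambda>d \<in> Sums a x. \<zero>\<^bsub>obj_map T (a, y)\<^esub>) (free_gen R f)"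
      using gen free_gen_in[OF cring f] mod_hom_closed[OF \<mu>ax(1)] by (simp add: compose_eq)
  qed
  obtain d where d: "d \<in> Sums a x" "t = \<mu> (a, x) d"
    using t \<mu>ax(2) by blast
  show ?thesis
    using fun_cong[OF eq, of d] d t by (simp add: compose_eq)
qed

text \<open>
  The class of the identity generates \<open>T(b, -)\<close>.
\<close>

lemma bifunctor_action_unit:
  assumes T: "T \<in> Obj Bimod"
    and \<mu>: "nat_surjection R (bicategory C) (free_hom R C) T \<mu>"
    and b: "b \<in> Obj C" and y: "y \<in> Obj C" and c: "c \<in> Sums b y"
  shows "act R C (fix_left C T b) b y (\<mu> (b, b) (free_gen R (idt C b))) c = \<mu> (b, y) c"
proof -
  interpret category C by (rule base)
  interpret Tb: cring_functor R \<U> C "fix_left C T b"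
    by (rule cring_functor[OF fix_left_functor[OF base T b]])
  note \<mu>b = bifunctor_surjectionD[OF \<mu> b]
  let ?e = "\<mu> (b, b) (free_gen R (idt C b))"
  have e: "?e \<in> elems (fix_left C T b) b"
    using mod_hom_closed[OF \<mu>b(1)[OF b] free_gen_in[OF cring idt_in[OF b]]]
    by (simp add: fix_left_simps)
  have "\<mu> (b, y) = act R C (fix_left C T b) b y ?e"
  proof (rule mod_hom_free_ext[OF cring Tb.module[OF y] _ Tb.act_hom[OF b y e]])
    show "\<mu> (b, y) \<in> mod_hom R (free_module R (Hom C b y)) (obj_map (fix_left C T b) y)"
      using \<mu>b(1)[OF y] by (simp add: fix_left_simps)
    fix f assume f: "f \<in> Hom C b y"
    have "act R C (fix_left C T b) b y ?e (free_gen R f) =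
      \<mu> (b, y) (arr_map (free_hom R C) (b, b) (b, y) (idt C b, f) (free_gen R (idt C b)))"
      using Tb.act_gen[OF b y e f]
        \<mu>b(3)[OF b b y idt_in[OF b] f free_gen_in[OF cring idt_in[OF b]]]
      by (simp add: fix_left_simps)
    also have "\<dots> = \<mu> (b, y) (free_gen R f)"
      using free_hom_arr(2)[OF base cring b b b y idt_in[OF b] f idt_in[OF b]]
        cmp_idt_right[OF b b idt_in[OF b]] cmp_idt_right[OF b y f] by simp
    finally show "\<mu> (b, y) (free_gen R f) = act R C (fix_left C T b) b y ?e (free_gen R f)" ..
  qed
  then show ?thesis by simp
qed

text \<open>
  The operations of \<open>functor_mod_hom\<close> stay within its carrier, so that \<open>yoneda_map\<close>, being undefined
  outside, can be evaluated at sums and multiples.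
\<close>

lemma functor_mod_hom_closed:
  assumes F: "F \<in> Obj Mod" and G: "G \<in> Obj Mod" and \<alpha>: "\<alpha> \<in> Hom Mod F G"
  shows "\<And>\<beta>. \<beta> \<in> Hom Mod F G \<Longrightarrow> \<alpha> \<oplus>\<^bsub>functor_mod_hom R \<U> C F G\<^esub> \<beta> \<in> Hom Mod F G"
    and "\<And>r. r \<in> carrier R \<Longrightarrow> r \<odot>\<^bsub>functor_mod_hom R \<U> C F G\<^esub> \<alpha> \<in> Hom Mod F G"
proof -
  interpret F: cring_functor R \<U> C F by (rule cring_functor[OF F])
  interpret G: cring_functor R \<U> C G by (rule cring_functor[OF G])
  note \<alpha>D = Funs_HomD[OF \<alpha>]
  fix \<beta> assume \<beta>: "\<beta> \<in> Hom Mod F G"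
  note \<beta>D = Funs_HomD[OF \<beta>]
  have "(\<lambda>u \<in> elems F x. \<alpha> x u \<oplus>\<^bsub>obj_map G x\<^esub> \<beta> x u) \<in>
    mod_hom R (obj_map F x) (obj_map G x)" if x: "x \<in> Obj C" for x
  proof -
    interpret N: module R "obj_map G x" by (rule G.module[OF x])
    show ?thesis
      by (rule restrict_mod_hom[OF F.module[OF x]])
         (simp_all add: \<alpha>D(2)[OF x] \<beta>D(2)[OF x] mod_hom_add[OF \<alpha>D(1)[OF x]]
           mod_hom_add[OF \<beta>D(1)[OF x]] mod_hom_smult[OF \<alpha>D(1)[OF x]]
           mod_hom_smult[OF \<beta>D(1)[OF x]] N.smult_r_distr N.M.a_ac)
  qed
  then show "\<alpha> \<oplus>\<^bsub>functor_mod_hom R \<U> C F G\<^esub> \<beta> \<in> Hom Mod F G"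
    unfolding functor_mod_hom_def
    by (simp, intro restrict_Funs_Hom)
       (auto simp: linear_natural_def F.arr_in \<alpha>D(2,3) \<beta>D(2,3) mod_hom_add[OF G.arr])
next
  interpret F: cring_functor R \<U> C F by (rule cring_functor[OF F])
  interpret G: cring_functor R \<U> C G by (rule cring_functor[OF G])
  note \<alpha>D = Funs_HomD[OF \<alpha>]
  fix r assume r: "r \<in> carrier R"
  have "(\<lambda>u \<in> elems F x. r \<odot>\<^bsub>obj_map G x\<^esub> \<alpha> x u) \<in>
    mod_hom R (obj_map F x) (obj_map G x)" if x: "x \<in> Obj C" for x
  proof -
    interpret N: module R "obj_map G x" by (rule G.module[OF x])
    show ?thesis
      using r
      by (intro restrict_mod_hom[OF F.module[OF x]])
         (simp_all add: \<alpha>D(2)[OF x] mod_hom_add[OF \<alpha>D(1)[OF x]] mod_hom_smult[OF \<alpha>D(1)[OF x]]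
           N.smult_r_distr F.m_comm flip: N.smult_assoc1)
  qed
  then show "r \<odot>\<^bsub>functor_mod_hom R \<U> C F G\<^esub> \<alpha> \<in> Hom Mod F G"
    using r unfolding functor_mod_hom_def
    by (simp, intro restrict_Funs_Hom)
       (auto simp: linear_natural_def F.arr_in \<alpha>D(2,3) mod_hom_smult[OF G.arr])
qed

text \<open>
  The Yoneda condition holds for every quotient of \<open>free_hom\<close>. A map out of \<open>T(b, -)\<close> is determined by
  the image of the class of the identity of \<open>b\<close>. This image can be any element of \<open>T(a, b)\<close>, because
  the kernel of \<open>\<mu>\<close> acts on \<open>T(a, -)\<close> by zero.
\<close>

lemma yoneda_bifunctors_iff:
  "(T, \<mu>) \<in> yoneda_bifunctors R \<U> C \<longleftrightarrow> T \<in> Obj Bimod \<and>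
     nat_surjection R (bicategory C) (free_hom R C) T \<mu>"
proof (intro iffI conjI)
  assume "T \<in> Obj Bimod \<and>
     nat_surjection R (bicategory C) (free_hom R C) T \<mu>"
  then have T: "T \<in> Obj Bimod"
    and \<mu>: "nat_surjection R (bicategory C) (free_hom R C) T \<mu>"
    by auto
  interpret category C by (rule base)
  have "yoneda_map R \<U> C T \<mu> a b
      \<in> mod_iso R (functor_mod_hom R \<U> C (fix_left C T b) (fix_left C T a)) (obj_map T (a, b))"
    if a: "a \<in> Obj C" and b: "b \<in> Obj C" for a b
  proof -
    let ?H = "Hom Mod (fix_left C T b) (fix_left C T a)"
    interpret Ta: cring_functor R \<U> C "fix_left C T a"
      by (rule cring_functor[OF fix_left_functor[OF base T a]])
    interpret Tb: cring_functor R \<U> C "fix_left C T b"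
      by (rule cring_functor[OF fix_left_functor[OF base T b]])
    note \<mu>b = bifunctor_surjectionD[OF \<mu> b]
    let ?e = "\<mu> (b, b) (free_gen R (idt C b))"
    have e: "?e \<in> elems (fix_left C T b) b"
      using mod_hom_closed[OF \<mu>b(1)[OF b] free_gen_in[OF cring idt_in[OF b]]]
      by (simp add: fix_left_simps)
    note \<mu>_eq = bifunctor_action_unit[OF T \<mu> b, symmetric]
    have "inj_on (\<lambda>\<alpha>. \<alpha> b ?e) ?H"
    proof (rule inj_onI)
      fix \<alpha> \<beta> assume \<alpha>: "\<alpha> \<in> ?H" and \<beta>: "\<beta> \<in> ?H" and eq: "\<alpha> b ?e = \<beta> b ?e"
      show "\<alpha> = \<beta>"
      proof (rule Funs_Hom_ext[OF \<alpha> \<beta>])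
        fix y u assume y: "y \<in> Obj C" and "u \<in> elems (fix_left C T b) y"
        then obtain c where c: "c \<in> Sums b y" and "u = \<mu> (b, y) c"
          using \<mu>b(2)[OF y] by (auto simp: fix_left_simps)
        then have u: "u = act R C (fix_left C T b) b y ?e c"
          using \<mu>_eq[OF y c] by simp
        show "\<alpha> y u = \<beta> y u"
          unfolding u using eq
          by (simp add: act_natural_Mod[OF Tb.obj Ta.obj \<alpha> b y e c]
              act_natural_Mod[OF Tb.obj Ta.obj \<beta> b y e c])
      qed
    qed
    moreover have "(\<lambda>\<alpha>. \<alpha> b ?e) ` ?H = elems T (a, b)"
    proof (intro subset_antisym subsetI)
      fix v assume "v \<in> (\<lambda>\<alpha>. \<alpha> b ?e) ` ?H"
      then obtain \<alpha> where "\<alpha> \<in> ?H" "v = \<alpha> b ?e" by blast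
      then show "v \<in> elems T (a, b)"
        using Funs_HomD(2)[of \<alpha> R \<U> C _ "fix_left C T a", OF _ b e]
        by (simp add: fix_left_simps(1))
    next
      fix t assume "t \<in> elems T (a, b)"
      then have t: "t \<in> elems (fix_left C T a) b"
        by (simp add: fix_left_simps)
      obtain \<alpha> where \<alpha>: "\<alpha> \<in> ?H"
        and \<alpha>\<mu>: "\<And>y c. y \<in> Obj C \<Longrightarrow> c \<in> Sums b y \<Longrightarrow>
          \<alpha> y (\<mu> (b, y) c) = act R C (fix_left C T a) b y t c"
      proof (rule yoneda_extend[OF T \<mu> Ta.obj b t])
        fix y c assume "y \<in> Obj C" "c \<in> Sums b y" "\<mu> (b, y) c = \<zero>\<^bsub>obj_map T (b, y)\<^esub>"
        then show "act R C (fix_left C T a) b y t c = \<zero>\<^bsub>obj_map (fix_left C T a) y\<^esub>"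
          using fix_left_annihilated[OF T \<mu> a b _ _ _ , of y t c] t by (simp add: fix_left_simps)
      qed blast
      have "\<alpha> b ?e = t"
        using \<alpha>\<mu>[OF b free_gen_in[OF cring idt_in[OF b]]] Ta.act_gen[OF b b t idt_in[OF b]]
          Ta.arr_idt[OF b t] by simp
      then show "t \<in> (\<lambda>\<alpha>. \<alpha> b ?e) ` ?H"
        using \<alpha> by blast
    qed
    ultimately have "bij_betw (\<lambda>\<alpha> \<in> ?H. \<alpha> b ?e) ?H (elems T (a, b))"
      by (simp add: bij_betw_def)
    moreover have "(\<lambda>\<alpha> \<in> ?H. \<alpha> b ?e) \<in>
      mod_hom R (functor_mod_hom R \<U> C (fix_left C T b) (fix_left C T a)) (obj_map T (a, b))"
    proof (rule mod_homI)
      note closed = functor_mod_hom_closed[OF Tb.obj Ta.obj]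
      show "(\<lambda>\<alpha> \<in> ?H. \<alpha> b ?e) \<in>
        extensional (carrier (functor_mod_hom R \<U> C (fix_left C T b) (fix_left C T a)))"
        by (simp add: functor_mod_hom_def)
      fix \<alpha> assume "\<alpha> \<in> carrier (functor_mod_hom R \<U> C (fix_left C T b) (fix_left C T a))"
      then have \<alpha>: "\<alpha> \<in> ?H"
        by (simp add: functor_mod_hom_def)
      show "(\<lambda>\<alpha> \<in> ?H. \<alpha> b ?e) \<alpha> \<in> elems T (a, b)"
        using Funs_HomD(2)[OF \<alpha> b e] \<alpha> by (simp add: fix_left_simps)
      show "(\<lambda>\<alpha> \<in> ?H. \<alpha> b ?e) (r \<odot>\<^bsub>functor_mod_hom R \<U> C (fix_left C T b) (fix_left C T a)\<^esub> \<alpha>) =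
        r \<odot>\<^bsub>obj_map T (a, b)\<^esub> (\<lambda>\<alpha> \<in> ?H. \<alpha> b ?e) \<alpha>" if "r \<in> carrier R" for r
        using closed(2)[OF \<alpha> that] \<alpha> b e by (simp add: functor_mod_hom_def fix_left_simps)
      fix \<beta> assume "\<beta> \<in> carrier (functor_mod_hom R \<U> C (fix_left C T b) (fix_left C T a))"
      then have \<beta>: "\<beta> \<in> ?H"
        by (simp add: functor_mod_hom_def)
      show "(\<lambda>\<alpha> \<in> ?H. \<alpha> b ?e) (\<alpha> \<oplus>\<^bsub>functor_mod_hom R \<U> C (fix_left C T b) (fix_left C T a)\<^esub> \<beta>) =
        (\<lambda>\<alpha> \<in> ?H. \<alpha> b ?e) \<alpha> \<oplus>\<^bsub>obj_map T (a, b)\<^esub> (\<lambda>\<alpha> \<in> ?H. \<alpha> b ?e) \<beta>"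
        using closed(1)[OF \<alpha> \<beta>] \<alpha> \<beta> b e by (simp add: functor_mod_hom_def fix_left_simps)
    qed
    ultimately show ?thesis
      by (simp add: mod_iso_def yoneda_map_def functor_mod_hom_def)
  qed
  then show "(T, \<mu>) \<in> yoneda_bifunctors R \<U> C"
    using T \<mu> by (simp add: yoneda_bifunctors_def)
qed (simp_all add: yoneda_bifunctors_def)

end

section \<open>Annihilators and annihilated functors\<close>

text \<open>
  Ideals of the linearised category are families of sets of formal sums indexed by pairs of objects.
  They are made extensional, since equality of such families serves as the invariant that classifies
  both subcategories and Yoneda bifunctors.
\<close>

definition annihilator ::
  "'r ring \<Rightarrow> ('o, 'a) category \<Rightarrow> ('o, 'a, 'r, 'u) mod_functor set
   \<Rightarrow> 'o \<times> 'o \<Rightarrow> ('a \<Rightarrow> 'r) set" where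
  "annihilator R C A = (\<lambda>(x, y) \<in> Obj C \<times> Obj C.
     {c \<in> carrier (free_module R (Hom C x y)).
        \<forall>F \<in> A. \<forall>u \<in> elems F x. act R C F x y u c = \<zero>\<^bsub>obj_map F y\<^esub>})"

definition annihilated_by ::
  "'r ring \<Rightarrow> ('o, 'a) category \<Rightarrow> ('o \<times> 'o \<Rightarrow> ('a \<Rightarrow> 'r) set)
   \<Rightarrow> ('o, 'a, 'r, 'u) mod_functor \<Rightarrow> bool" where
  "annihilated_by R C K F \<longleftrightarrow> (\<forall>x \<in> Obj C. \<forall>y \<in> Obj C. \<forall>c \<in> K (x, y).
     \<forall>u \<in> elems F x. act R C F x y u c = \<zero>\<^bsub>obj_map F y\<^esub>)"

definition bifunctor_kernel ::
  "'r ring \<Rightarrow> ('o, 'a) category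
   \<Rightarrow> ('o, 'a, 'r, 'u) mod_bifunctor \<times> ('o \<times> 'o \<Rightarrow> ('a \<Rightarrow> 'r) \<Rightarrow> 'u)
   \<Rightarrow> 'o \<times> 'o \<Rightarrow> ('a \<Rightarrow> 'r) set" where
  "bifunctor_kernel R C = (\<lambda>(T, \<mu>). \<lambda>(x, y) \<in> Obj C \<times> Obj C.
     {c \<in> carrier (free_module R (Hom C x y)). \<mu> (x, y) c = \<zero>\<^bsub>obj_map T (x, y)\<^esub>})"

lemma annihilator_iff:
  "x \<in> Obj C \<Longrightarrow> y \<in> Obj C \<Longrightarrow> c \<in> annihilator R C A (x, y) \<longleftrightarrow>
    c \<in> carrier (free_module R (Hom C x y)) \<and>
    (\<forall>F \<in> A. \<forall>u \<in> elems F x. act R C F x y u c = \<zero>\<^bsub>obj_map F y\<^esub>)"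
  by (simp add: annihilator_def)

lemma bifunctor_kernel_iff:
  "x \<in> Obj C \<Longrightarrow> y \<in> Obj C \<Longrightarrow> c \<in> bifunctor_kernel R C (T, \<mu>) (x, y) \<longleftrightarrow>
    c \<in> carrier (free_module R (Hom C x y)) \<and> \<mu> (x, y) c = \<zero>\<^bsub>obj_map T (x, y)\<^esub>"
  by (simp add: bifunctor_kernel_def)

lemma annihilator_extensional: "annihilator R C A \<in> extensional (Obj C \<times> Obj C)"
  by (simp add: annihilator_def)

lemma bifunctor_kernel_extensional: "bifunctor_kernel R C T\<mu> \<in> extensional (Obj C \<times> Obj C)"
  by (simp add: bifunctor_kernel_def split: prod.split)

lemma arrow_family_eqI:
  assumes "K \<in> extensional (Obj C \<times> Obj C)" and "L \<in> extensional (Obj C \<times> Obj C)"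
    and "\<And>x y c. x \<in> Obj C \<Longrightarrow> y \<in> Obj C \<Longrightarrow> c \<in> K (x, y) \<longleftrightarrow> c \<in> L (x, y)"
  shows "K = L"
  by (rule extensionalityI[OF assms(1,2)]) (use assms(3) in auto)

lemma annihilated_byD:
  "annihilated_by R C K F \<Longrightarrow> x \<in> Obj C \<Longrightarrow> y \<in> Obj C \<Longrightarrow> c \<in> K (x, y) \<Longrightarrow>
    u \<in> elems F x \<Longrightarrow> act R C F x y u c = \<zero>\<^bsub>obj_map F y\<^esub>"
  unfolding annihilated_by_def by blast

context linear_setting
begin

lemmas epireflective_Mod_iff = epireflective_iff_universal[OF category_Funs[OF base], of R \<U>]
lemmas coreflective_Mod_iff = coreflective_iff_universal[OF category_Funs[OF base], of R \<U>]

lemma annihilated_by_annihilator: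
  "F \<in> A \<Longrightarrow> annihilated_by R C (annihilator R C A) F"
  unfolding annihilated_by_def by (simp add: annihilator_iff)

lemma small_free_hom:
  assumes "p \<in> Obj (bicategory C)"
  shows "small \<U> (elems (free_hom R C) p)"
  using assms by (auto simp: bicategory_simps free_hom_simps
      intro!: small_free_module universe small_scalars small_Hom)

text \<open>
  The annihilator of \<open>A\<close> is an intersection of kernels of linear maps and is closed under composition
  with arrows on both sides. So \<open>free_hom\<close> has a quotient by it, and this is a Yoneda bifunctor.
\<close>

lemma annihilator_kernel_of_yoneda:
  assumes A: "A \<subseteq> Obj Mod"
  obtains T \<mu> where "(T, \<mu>) \<in> yoneda_bifunctors R \<U> C"
    and "bifunctor_kernel R C (T, \<mu>) = annihilator R C A"
proof -
  note free = module_free_module[OF cring]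
  obtain T :: "('o, 'a, 'r, 'u) mod_bifunctor" and \<mu>
    where T: "T \<in> Obj Bimod"
    and \<mu>: "nat_surjection R (bicategory C) (free_hom R C) T \<mu>"
    and ker: "\<And>p c. p \<in> Obj (bicategory C) \<Longrightarrow> c \<in> elems (free_hom R C) p \<Longrightarrow>
      \<mu> p c = \<zero>\<^bsub>obj_map T p\<^esub> \<longleftrightarrow> c \<in> annihilator R C A p"
  proof (rule quotient_functor_exists[OF universe category_bicategory[OF base]
        free_hom_functor[OF base cring] small_free_hom, of "annihilator R C A"])
    fix p assume "p \<in> Obj (bicategory C)"
    then obtain x y where p: "p = (x, y)" and x: "x \<in> Obj C" and y: "y \<in> Obj C"
      by (auto simp: bicategory_simps)
    let ?I = "{(F, u). F \<in> A \<and> u \<in> elems F x}"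
    have F: "module R (obj_map F y) \<and> act R C F x y u \<in> mod_hom R (free_module R (Hom C x y)) (obj_map F y)"
      if "(F, u) \<in> ?I" for F u
    proof -
      interpret F: cring_functor R \<U> C F using A that cring_functor by blast
      show ?thesis using F.module[OF y] F.act_hom[OF x y] that by simp
    qed
    have eq: "annihilator R C A (x, y) =
      {c \<in> Sums x y. \<forall>i \<in> ?I. act R C (fst i) x y (snd i) c = \<zero>\<^bsub>obj_map (fst i) y\<^esub>}"
      using annihilator_iff[OF x y] by auto
    show "submodule (annihilator R C A p) R (obj_map (free_hom R C) p)"
      unfolding p free_hom_simps eq by (rule common_kernel_submodule[OF free]) (use F in auto)
  next
    fix p q k c assume "p \<in> Obj (bicategory C)" "q \<in> Obj (bicategory C)" "k \<in> Hom (bicategory C) p q"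
      and c: "c \<in> annihilator R C A p"
    then obtain x y x' y' f g where p: "p = (x, y)" and q: "q = (x', y')" and k: "k = (f, g)"
      and x: "x \<in> Obj C" and y: "y \<in> Obj C" and x': "x' \<in> Obj C" and y': "y' \<in> Obj C"
      and f: "f \<in> Hom C x' x" and g: "g \<in> Hom C y y'"
      by (auto simp: bicategory_simps)
    have cS: "c \<in> Sums x y"
      using c annihilator_iff[OF x y] unfolding p by blast
    show "arr_map (free_hom R C) p q k c \<in> annihilator R C A q"
      unfolding p q k annihilator_iff[OF x' y']
    proof (intro conjI ballI)
      show "arr_map (free_hom R C) (x, y) (x', y') (f, g) c \<in> Sums x' y'"
        by (rule mod_hom_closed[OF free_hom_arr(1)[OF base cring x x' y y' f g] cS])
      fix F u assume F: "F \<in> A" and u: "u \<in> elems F x'"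
      then interpret F: cring_functor R \<U> C F using A cring_functor by blast
      have "act R C F x y (arr_map F x' x f u) c = \<zero>\<^bsub>obj_map F y\<^esub>"
        using c F F.arr_in[OF x' x f u] unfolding p by (simp add: annihilator_iff[OF x y])
      then show "act R C F x' y' u (arr_map (free_hom R C) (x, y) (x', y') (f, g) c) =
        \<zero>\<^bsub>obj_map F y'\<^esub>"
        using F.act_free_hom[OF x x' y y' f g u cS]
          mod_hom_zero[OF F.module[OF y] F.module[OF y'] F.arr[OF y y' g]] by simp
    qed
  next
    fix T :: "('o, 'a, 'r, 'u) mod_bifunctor" and \<mu>
    assume "T \<in> Obj Bimod"
      and "nat_surjection R (bicategory C) (free_hom R C) T \<mu>"
      and "\<And>p c. p \<in> Obj (bicategory C) \<Longrightarrow> c \<in> elems (free_hom R C) p \<Longrightarrow>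
        \<mu> p c = \<zero>\<^bsub>obj_map T p\<^esub> \<longleftrightarrow> c \<in> annihilator R C A p"
    then show thesis by (rule that)
  qed
  have "c \<in> bifunctor_kernel R C (T, \<mu>) (x, y) \<longleftrightarrow> c \<in> annihilator R C A (x, y)"
    if "x \<in> Obj C" "y \<in> Obj C" for x y c
    using ker[of "(x, y)" c] that
    by (auto simp: bifunctor_kernel_iff annihilator_iff bicategory_simps free_hom_simps)
  then have "bifunctor_kernel R C (T, \<mu>) = annihilator R C A"
    by (rule arrow_family_eqI[OF bifunctor_kernel_extensional annihilator_extensional])
  then show thesis
    using T \<mu> by (intro that[of T \<mu>]) (auto simp: yoneda_bifunctors_iff)
qed

lemma fix_left_annihilated_by_kernel:
  assumes T: "(T, \<mu>) \<in> yoneda_bifunctors R \<U> C" and a: "a \<in> Obj C"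
  shows "annihilated_by R C (bifunctor_kernel R C (T, \<mu>)) (fix_left C T a)"
  unfolding annihilated_by_def fix_left_simps
  using fix_left_annihilated[OF _ _ a] T
  by (auto simp: bifunctor_kernel_iff yoneda_bifunctors_iff)

subsection \<open>The functors annihilated by an ideal\<close>

text \<open>
  The reflection of \<open>F\<close> is its quotient by the elements that every map to an annihilated functor kills.
  The quotient is annihilated because naturality puts the action of \<open>K\<close> on \<open>F\<close> among these elements.
\<close>

lemma epireflective_annihilated_by:
  assumes K: "\<And>x y. x \<in> Obj C \<Longrightarrow> y \<in> Obj C \<Longrightarrow> K (x, y) \<subseteq> Sums x y"
  shows "epireflective Mod {F \<in> Obj Mod. annihilated_by R C K F}" (is "epireflective Mod ?A")
  unfolding epireflective_Mod_iff
proof (intro conjI ballI)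
  fix F assume F: "F \<in> Obj Mod"
  interpret F: cring_functor R \<U> C F by (rule cring_functor[OF F])
  define N where "N x = {u \<in> elems F x. \<forall>G \<in> ?A. \<forall>\<alpha> \<in> Hom Mod F G.
    \<alpha> x u = \<zero>\<^bsub>obj_map G x\<^esub>}" for x
  have NI: "u \<in> N x" if "u \<in> elems F x"
    and "\<And>G \<alpha>. G \<in> ?A \<Longrightarrow> \<alpha> \<in> Hom Mod F G \<Longrightarrow> \<alpha> x u = \<zero>\<^bsub>obj_map G x\<^esub>" for x u
    using that unfolding N_def by blast
  have ND: "u \<in> elems F x"
    "\<And>G \<alpha>. G \<in> ?A \<Longrightarrow> \<alpha> \<in> Hom Mod F G \<Longrightarrow> \<alpha> x u = \<zero>\<^bsub>obj_map G x\<^esub>" if "u \<in> N x" for x u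
    using that unfolding N_def by blast+
  have mod: "module R (obj_map G x)" if "G \<in> ?A" "x \<in> Obj C" for G x
    using module_functor.module[of R \<U> C G x] that base by (auto intro: module_functor.intro)
  obtain Q q where Q: "Q \<in> Obj Mod" and q: "nat_surjection R C F Q q"
    and ker: "\<And>x m. x \<in> Obj C \<Longrightarrow> m \<in> elems F x \<Longrightarrow>
      q x m = \<zero>\<^bsub>obj_map Q x\<^esub> \<longleftrightarrow> m \<in> N x"
  proof (rule quotient_functor_exists[OF universe base F, of N])
    fix x assume x: "x \<in> Obj C"
    show "small \<U> (elems F x)"
      by (rule small_in_universe[OF F.carrier_in[OF x]])
    let ?I = "{(G, \<alpha>). G \<in> ?A \<and> \<alpha> \<in> Hom Mod F G}"
    have eq: "N x = {u \<in> elems F x. \<forall>i \<in> ?I. snd i x u = \<zero>\<^bsub>obj_map (fst i) x\<^esub>}"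
      unfolding N_def by auto
    show "submodule (N x) R (obj_map F x)"
      unfolding eq by (rule common_kernel_submodule[OF F.module[OF x]])
        (use mod[OF _ x] Funs_HomD(1)[OF _ x] in auto)
  next
    fix x y f u assume x: "x \<in> Obj C" and y: "y \<in> Obj C" and f: "f \<in> Hom C x y" and u: "u \<in> N x"
    show "arr_map F x y f u \<in> N y"
    proof (rule NI)
      fix G \<alpha> assume G: "G \<in> ?A" and \<alpha>: "\<alpha> \<in> Hom Mod F G"
      interpret G: cring_functor R \<U> C G using G cring_functor by blast
      show "\<alpha> y (arr_map F x y f u) = \<zero>\<^bsub>obj_map G y\<^esub>"
        using Funs_HomD(3)[OF \<alpha> x y f ND(1)[OF u]] ND(2)[OF u G \<alpha>]
          mod_hom_zero[OF G.module[OF x] G.module[OF y] G.arr[OF x y f]] by simp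
    qed (rule F.arr_in[OF x y f ND(1)[OF u]])
  next
    fix Q q assume "Q \<in> Obj Mod" and "nat_surjection R C F Q q"
      and "\<And>x m. x \<in> Obj C \<Longrightarrow> m \<in> elems F x \<Longrightarrow>
        q x m = \<zero>\<^bsub>obj_map Q x\<^esub> \<longleftrightarrow> m \<in> N x"
    then show thesis by (rule that)
  qed
  interpret Q: cring_functor R \<U> C Q by (rule cring_functor[OF Q])
  have qn: "linear_natural R C F Q q"
    and surj: "\<And>x. x \<in> Obj C \<Longrightarrow> q x ` elems F x = elems Q x"
    using q by (auto simp: nat_surjection_iff)
  have q': "restrict q (Obj C) \<in> Hom Mod F Q"
    by (rule restrict_Funs_Hom[OF qn])
  have "annihilated_by R C K Q"
    unfolding annihilated_by_def
  proof (intro ballI)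
    fix x y c v assume x: "x \<in> Obj C" and y: "y \<in> Obj C" and c: "c \<in> K (x, y)"
      and "v \<in> elems Q x"
    then obtain u where u: "u \<in> elems F x" and v: "v = q x u"
      using surj by blast
    have cS: "c \<in> Sums x y"
      using K x y c by blast
    have "\<alpha> y (act R C F x y u c) = \<zero>\<^bsub>obj_map G y\<^esub>" if G: "G \<in> ?A" and \<alpha>: "\<alpha> \<in> Hom Mod F G" for G \<alpha>
      using act_natural_Mod[OF F _ \<alpha> x y u cS] annihilated_byD[of R C K G, OF _ x y c]
        Funs_HomD(2)[OF \<alpha> x u] G by simp
    then have "act R C F x y u c \<in> N y"
      by (rule NI[OF F.act_in[OF x y u cS]])
    then have "q y (act R C F x y u c) = \<zero>\<^bsub>obj_map Q y\<^esub>"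
      using ker[OF y F.act_in[OF x y u cS]] by simp
    then show "act R C Q x y v c = \<zero>\<^bsub>obj_map Q y\<^esub>"
      using act_natural_Mod[OF F Q q' x y u cS] x y unfolding v by simp
  qed
  then have QA: "Q \<in> ?A"
    using Q by simp
  have "is_epi Mod F Q (restrict q (Obj C))"
    by (rule surjective_imp_epi[OF base F q']) (simp add: surj)
  moreover have "\<exists>\<beta> \<in> Hom Mod Q G. cmp Mod F Q G \<beta> (restrict q (Obj C)) = \<alpha>"
    if G: "G \<in> ?A" and \<alpha>: "\<alpha> \<in> Hom Mod F G" for G \<alpha>
  proof -
    have "linear_natural R C F G \<alpha>"
      using \<alpha> by (simp add: Funs_Hom_iff)
    from factor_through[OF base F Q _ q this]
    obtain \<beta> where \<beta>: "\<beta> \<in> Hom Mod Q G"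
      and eq: "\<And>x m. x \<in> Obj C \<Longrightarrow> m \<in> elems F x \<Longrightarrow> \<beta> x (q x m) = \<alpha> x m"
      using G \<alpha> ker by (auto simp: N_def)
    have "cmp Mod F Q G \<beta> (restrict q (Obj C)) = \<alpha>"
      by (rule Funs_Hom_ext[OF Funs_cmp_in[OF base F q' \<beta>] \<alpha>])
         (simp add: Funs_cmp eq)
    then show ?thesis using \<beta> by blast
  qed
  ultimately show "\<exists>r \<in> ?A. \<exists>e. is_epi Mod F r e \<and>
      (\<forall>y \<in> ?A. \<forall>f \<in> Hom Mod F y. \<exists>g \<in> Hom Mod r y. cmp Mod F r y g e = f)"
    using QA by blast
qed auto

text \<open>
  The coreflection of \<open>F\<close> consists of the elements on which \<open>K\<close> acts by zero. It is a subfunctor because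
  \<open>K\<close> is closed under precomposition with arrows.
\<close>

lemma coreflective_annihilated_by:
  assumes K: "\<And>x y. x \<in> Obj C \<Longrightarrow> y \<in> Obj C \<Longrightarrow> K (x, y) \<subseteq> Sums x y"
    and ideal: "\<And>x x' y f c. x \<in> Obj C \<Longrightarrow> x' \<in> Obj C \<Longrightarrow> y \<in> Obj C \<Longrightarrow> f \<in> Hom C x' x \<Longrightarrow>
      c \<in> K (x, y) \<Longrightarrow> arr_map (free_hom R C) (x, y) (x', y) (f, idt C y) c \<in> K (x', y)"
  shows "coreflective Mod {F \<in> Obj Mod. annihilated_by R C K F}" (is "coreflective Mod ?A")
  unfolding coreflective_Mod_iff
proof (intro conjI ballI)
  interpret category C by (rule base)
  fix F assume F: "F \<in> Obj Mod"
  interpret F: cring_functor R \<U> C F by (rule cring_functor[OF F])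
  define N where "N x = {u \<in> elems F x. \<forall>y \<in> Obj C. \<forall>c \<in> K (x, y).
    act R C F x y u c = \<zero>\<^bsub>obj_map F y\<^esub>}" for x
  have sub: "submodule (N x) R (obj_map F x)" if x: "x \<in> Obj C" for x
  proof -
    let ?I = "{(y, c). y \<in> Obj C \<and> c \<in> K (x, y)}"
    have hom: "(\<lambda>u \<in> elems F x. act R C F x y u c) \<in> mod_hom R (obj_map F x) (obj_map F y)"
      if "y \<in> Obj C" "c \<in> K (x, y)" for y c
      using that K x by (intro F.act_hom_left) auto
    have eq: "N x = {u \<in> elems F x. \<forall>i \<in> ?I.
        (\<lambda>u \<in> elems F x. act R C F x (fst i) u (snd i)) u = \<zero>\<^bsub>obj_map F (fst i)\<^esub>}"
      unfolding N_def by auto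
    show ?thesis
      unfolding eq
      by (rule common_kernel_submodule[OF F.module[OF x] F.module hom]) auto
  qed
  obtain S j where S: "S \<in> Obj Mod" and j: "j \<in> Hom Mod S F"
    and S_obj: "\<And>x. x \<in> Obj C \<Longrightarrow> obj_map S x = (obj_map F x)\<lparr>carrier := N x\<rparr>"
    and S_arr: "\<And>x y f u. u \<in> N x \<Longrightarrow> arr_map S x y f u = arr_map F x y f u"
    and j_eq: "\<And>x u. x \<in> Obj C \<Longrightarrow> u \<in> N x \<Longrightarrow> j x u = u"
  proof (rule subfunctor_exists[OF universe base F sub])
    fix x x' f u assume x: "x \<in> Obj C" and x': "x' \<in> Obj C" and f: "f \<in> Hom C x x'" and u: "u \<in> N x"
    have u': "u \<in> elems F x"
      using u by (simp add: N_def)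
    have "act R C F x' y (arr_map F x x' f u) c = \<zero>\<^bsub>obj_map F y\<^esub>"
      if y: "y \<in> Obj C" and c: "c \<in> K (x', y)" for y c
    proof -
      have cS: "c \<in> Sums x' y"
        using K x' y c by blast
      have "act R C F x' y (arr_map F x x' f u) c =
        act R C F x y u (arr_map (free_hom R C) (x', y) (x, y) (f, idt C y) c)"
        using F.act_free_hom[OF x' x y y f idt_in[OF y] u' cS]
          F.arr_idt[OF y F.act_in[OF x' y F.arr_in[OF x x' f u'] cS]] by simp
      also have "\<dots> = \<zero>\<^bsub>obj_map F y\<^esub>"
        using u ideal[OF x' x y f c] y by (simp add: N_def)
      finally show ?thesis .
    qed
    then show "arr_map F x x' f u \<in> N x'"
      using F.arr_in[OF x x' f u'] by (simp add: N_def)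
  qed blast+
  interpret S: cring_functor R \<U> C S by (rule cring_functor[OF S])
  have "annihilated_by R C K S"
    unfolding annihilated_by_def
  proof (intro ballI)
    fix x y c u assume x: "x \<in> Obj C" and y: "y \<in> Obj C" and c: "c \<in> K (x, y)"
      and u: "u \<in> elems S x"
    then have uN: "u \<in> N x"
      by (simp add: S_obj)
    have cS: "c \<in> Sums x y"
      using K x y c by blast
    have "act R C S x y u c \<in> N y"
      using S.act_in[OF x y u cS] y by (simp add: S_obj)
    then have "act R C S x y u c = act R C F x y u c"
      using act_natural_Mod[OF S F j x y u cS] j_eq[OF y] j_eq[OF x uN] by simp
    also have "\<dots> = \<zero>\<^bsub>obj_map F y\<^esub>"
      using uN y c by (simp add: N_def)
    finally show "act R C S x y u c = \<zero>\<^bsub>obj_map S y\<^esub>"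
      using y by (simp add: S_obj)
  qed
  then have SA: "S \<in> ?A"
    using S by simp
  have univ: "\<exists>!\<beta>. \<beta> \<in> Hom Mod G S \<and> cmp Mod G S F j \<beta> = \<alpha>"
    if "G \<in> ?A" and \<alpha>: "\<alpha> \<in> Hom Mod G F" for G \<alpha>
  proof -
    have G: "G \<in> Obj Mod" and annG: "annihilated_by R C K G"
      using that by auto
    note \<alpha>D = Funs_HomD[OF \<alpha>]
    have \<alpha>N: "\<alpha> x u \<in> N x" if x: "x \<in> Obj C" and u: "u \<in> elems G x" for x u
    proof -
      have "act R C F x y (\<alpha> x u) c = \<zero>\<^bsub>obj_map F y\<^esub>" if y: "y \<in> Obj C" and c: "c \<in> K (x, y)" for y c
      proof -
        have cS: "c \<in> Sums x y"
          using K x y c by blast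
        show ?thesis
          using act_natural_Mod[OF G F \<alpha> x y u cS] annihilated_byD[OF annG x y c u]
            mod_hom_zero[OF module_functor.module[OF module_functor.intro[OF base G] y] F.module[OF y]
              \<alpha>D(1)[OF y]] by simp
      qed
      then show ?thesis
        using \<alpha>D(2)[OF x u] by (simp add: N_def)
    qed
    have \<alpha>S: "\<alpha> \<in> Hom Mod G S"
      unfolding Funs_Hom_iff
    proof
      show "\<alpha> \<in> extensional (Obj C)"
        using \<alpha> by (simp add: Funs_Hom_iff)
      have "\<alpha> x \<in> mod_hom R (obj_map G x) (obj_map S x)" if x: "x \<in> Obj C" for x
        using \<alpha>D(1)[OF x] \<alpha>N[OF x] by (auto simp: mod_hom_def S_obj[OF x] PiE_iff)
      then show "linear_natural R C G S \<alpha>"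
        unfolding linear_natural_def by (simp add: \<alpha>D(3) \<alpha>N S_arr)
    qed
    show ?thesis
    proof (rule ex1I[of _ \<alpha>])
      show "\<alpha> \<in> Hom Mod G S \<and> cmp Mod G S F j \<alpha> = \<alpha>"
        using \<alpha>S Funs_Hom_ext[OF Funs_cmp_in[OF base G \<alpha>S j] \<alpha>]
        by (simp add: Funs_cmp j_eq \<alpha>N)
    next
      fix \<beta> assume \<beta>: "\<beta> \<in> Hom Mod G S \<and> cmp Mod G S F j \<beta> = \<alpha>"
      show "\<beta> = \<alpha>"
      proof (rule Funs_Hom_ext[OF conjunct1[OF \<beta>] \<alpha>S])
        fix x u assume x: "x \<in> Obj C" and u: "u \<in> elems G x"
        have "\<beta> x u \<in> N x"
          using Funs_HomD(2)[OF conjunct1[OF \<beta>] x u] x by (simp add: S_obj)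
        then have "\<beta> x u = cmp Mod G S F j \<beta> x u"
          using Funs_cmp[OF x u, of R \<U> S F j \<beta>] j_eq[OF x] by simp
        then show "\<beta> x u = \<alpha> x u"
          using \<beta> by simp
      qed
    qed
  qed
  show "\<exists>r \<in> ?A. \<exists>e \<in> Hom Mod r F. \<forall>x \<in> ?A. \<forall>f \<in> Hom Mod x F.
      \<exists>!g. g \<in> Hom Mod x r \<and> cmp Mod x r F e g = f"
    using SA j univ by blast
qed auto

text \<open>
  Nothing is added to the kernel \<open>K\<close> by passing to the functors that it annihilates and back, because
  these include \<open>T(x, -)\<close>, where \<open>c\<close> sends the class of the identity to the class of \<open>c\<close>.
\<close>

lemma kernel_is_annihilator:
  assumes TY: "(T, \<mu>) \<in> yoneda_bifunctors R \<U> C"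
  defines "K \<equiv> bifunctor_kernel R C (T, \<mu>)"
  shows "{F \<in> Obj Mod. annihilated_by R C K F} \<in> epi_coreflectives Mod"
    and "annihilator R C {F \<in> Obj Mod. annihilated_by R C K F} = K"
proof -
  interpret category C by (rule base)
  let ?A = "{F \<in> Obj Mod. annihilated_by R C K F}"
  have T: "T \<in> Obj Bimod"
    and \<mu>: "nat_surjection R (bicategory C) (free_hom R C) T \<mu>"
    using TY by (auto simp: yoneda_bifunctors_iff)
  interpret T: module_functor R \<U> "bicategory C" T
    by (rule module_functor.intro[OF category_bicategory[OF base] T])
  have K: "K (x, y) \<subseteq> Sums x y" if "x \<in> Obj C" "y \<in> Obj C" for x y
    using that by (auto simp: K_def bifunctor_kernel_iff)
  have "arr_map (free_hom R C) (x, y) (x', y) (f, idt C y) c \<in> K (x', y)"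
    if x: "x \<in> Obj C" and x': "x' \<in> Obj C" and y: "y \<in> Obj C" and f: "f \<in> Hom C x' x"
      and c: "c \<in> K (x, y)" for x x' y f c
  proof -
    have cS: "c \<in> Sums x y" and zero: "\<mu> (x, y) c = \<zero>\<^bsub>obj_map T (x, y)\<^esub>"
      using c x y by (auto simp: K_def bifunctor_kernel_iff)
    have "arr_map T (x, y) (x', y) (f, idt C y) \<zero>\<^bsub>obj_map T (x, y)\<^esub> = \<zero>\<^bsub>obj_map T (x', y)\<^esub>"
      by (rule mod_hom_zero[OF T.module T.module T.arr])
         (use x x' y f idt_in in \<open>auto simp: bicategory_simps\<close>)
    then show ?thesis
      using bifunctor_surjectionD(3)[OF \<mu> x y x' y f idt_in[OF y] cS] zero
        mod_hom_closed[OF free_hom_arr(1)[OF base cring x x' y y f idt_in[OF y]] cS] x' y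
      by (simp add: K_def bifunctor_kernel_iff)
  qed
  then show "?A \<in> epi_coreflectives Mod"
    unfolding epi_coreflectives_def
    using epireflective_annihilated_by[OF K] coreflective_annihilated_by[OF K] by simp
  have "c \<in> annihilator R C ?A (x, y) \<longleftrightarrow> c \<in> K (x, y)" if x: "x \<in> Obj C" and y: "y \<in> Obj C" for x y c
  proof
    assume "c \<in> K (x, y)"
    then show "c \<in> annihilator R C ?A (x, y)"
      using K[OF x y] annihilated_byD[of R C K _ x y c] x y by (auto simp: annihilator_iff)
  next
    assume c: "c \<in> annihilator R C ?A (x, y)"
    then have cS: "c \<in> Sums x y"
      by (simp add: annihilator_iff[OF x y])
    let ?e = "\<mu> (x, x) (free_gen R (idt C x))"
    note gen = free_gen_in[OF cring idt_in[OF x]]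
    interpret Tx: cring_functor R \<U> C "fix_left C T x"
      by (rule cring_functor[OF fix_left_functor[OF base T x]])
    have e: "?e \<in> elems (fix_left C T x) x"
      using mod_hom_closed[OF bifunctor_surjectionD(1)[OF \<mu> x x] gen] by (simp add: fix_left_simps)
    have "fix_left C T x \<in> ?A"
      using Tx.obj fix_left_annihilated_by_kernel[OF TY x] by (simp add: K_def)
    then have "act R C (fix_left C T x) x y ?e c = \<zero>\<^bsub>obj_map T (x, y)\<^esub>"
      using c e by (auto simp: annihilator_iff[OF x y] fix_left_simps(1))
    then show "c \<in> K (x, y)"
      using bifunctor_action_unit[OF T \<mu> x y cS] cS x y by (simp add: K_def bifunctor_kernel_iff)
  qed
  then show "annihilator R C ?A = K"
    unfolding K_def by (rule arrow_family_eqI[OF annihilator_extensional bifunctor_kernel_extensional])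
qed

subsection \<open>Epireflective and coreflective subcategories are determined by their annihilators\<close>

lemma isomorphic_annihilated:
  assumes F: "F \<in> Obj Mod" and G: "G \<in> Obj Mod" and iso: "isomorphic Mod F G"
    and K: "\<And>x y. x \<in> Obj C \<Longrightarrow> y \<in> Obj C \<Longrightarrow> K (x, y) \<subseteq> Sums x y"
    and ann: "annihilated_by R C K G"
  shows "annihilated_by R C K F"
  unfolding annihilated_by_def
proof (intro ballI)
  interpret F: cring_functor R \<U> C F by (rule cring_functor[OF F])
  interpret G: cring_functor R \<U> C G by (rule cring_functor[OF G])
  obtain \<alpha> \<beta> where \<alpha>: "\<alpha> \<in> Hom Mod F G" and \<beta>: "\<beta> \<in> Hom Mod G F"
    and \<beta>\<alpha>: "\<And>x u. x \<in> Obj C \<Longrightarrow> u \<in> elems F x \<Longrightarrow> \<beta> x (\<alpha> x u) = u"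
    using Funs_isomorphicE[OF base iso] by blast
  fix x y c u assume x: "x \<in> Obj C" and y: "y \<in> Obj C" and c: "c \<in> K (x, y)"
    and u: "u \<in> elems F x"
  have cS: "c \<in> Sums x y" using K x y c by blast
  note \<alpha>u = Funs_HomD(2)[OF \<alpha> x u]
  have "act R C F x y u c = \<beta> y (act R C G x y (\<alpha> x u) c)"
    using act_natural_Mod[OF G F \<beta> x y \<alpha>u cS] \<beta>\<alpha>[OF x u] by simp
  also have "\<dots> = \<beta> y \<zero>\<^bsub>obj_map G y\<^esub>"
    using annihilated_byD[OF ann x y c \<alpha>u] by simp
  also have "\<dots> = \<zero>\<^bsub>obj_map F y\<^esub>"
    by (rule mod_hom_zero[OF G.module[OF y] F.module[OF y] Funs_HomD(1)[OF \<beta> y]])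
  finally show "act R C F x y u c = \<zero>\<^bsub>obj_map F y\<^esub>" .
qed

lemma annihilator_subset: "x \<in> Obj C \<Longrightarrow> y \<in> Obj C \<Longrightarrow> annihilator R C A (x, y) \<subseteq> Sums x y"
  by (auto simp: annihilator_iff)

text \<open>
  With \<open>T\<close> the quotient of \<open>free_hom\<close> by the annihilator of \<open>A\<close>, the unit from \<open>T(a, -)\<close> to its
  reflection in \<open>A\<close> is surjective as an epimorphism. It is injective: if it kills the class of \<open>c\<close>, so
  does every map from \<open>T(a, -)\<close> to a member of \<open>A\<close>, which by the Yoneda lemma means that \<open>c\<close> acts by zero
  on all members of \<open>A\<close>.
\<close>

lemma fix_left_in_repletion:
  assumes A: "epireflective Mod A" and TY: "(T, \<mu>) \<in> yoneda_bifunctors R \<U> C"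
    and ker: "bifunctor_kernel R C (T, \<mu>) = annihilator R C A" and a: "a \<in> Obj C"
  shows "\<exists>G \<in> A. isomorphic Mod (fix_left C T a) G"
proof -
  have T: "T \<in> Obj Bimod"
    and \<mu>: "nat_surjection R (bicategory C) (free_hom R C) T \<mu>"
    using TY by (auto simp: yoneda_bifunctors_iff)
  let ?Ta = "fix_left C T a"
  have Ta: "?Ta \<in> Obj Mod" by (rule fix_left_functor[OF base T a])
  have sub: "A \<subseteq> Obj Mod"
    using A by (simp add: epireflective_def)
  obtain G e where G: "G \<in> A" and epi: "is_epi Mod ?Ta G e"
    and ext: "\<And>F f. F \<in> A \<Longrightarrow> f \<in> Hom Mod ?Ta F \<Longrightarrow> \<exists>g \<in> Hom Mod G F. cmp Mod ?Ta G F g e = f"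
    using A Ta unfolding epireflective_Mod_iff
    by blast
  have GM: "G \<in> Obj Mod" using G sub by blast
  interpret G: cring_functor R \<U> C G by (rule cring_functor[OF GM])
  have e: "e \<in> Hom Mod ?Ta G"
    using epi by (simp add: is_epi_def)
  have "is_iso Mod ?Ta G e"
  proof (rule bijective_imp_iso[OF base Ta GM e])
    fix y t assume y: "y \<in> Obj C" and t: "t \<in> elems ?Ta y"
      and zero: "e y t = \<zero>\<^bsub>obj_map G y\<^esub>"
    obtain c where c: "c \<in> Sums a y" and tc: "t = \<mu> (a, y) c"
      using t bifunctor_surjectionD(2)[OF \<mu> a y] by (auto simp: fix_left_simps)
    have "act R C F a y u c = \<zero>\<^bsub>obj_map F y\<^esub>" if F: "F \<in> A" and u: "u \<in> elems F a" for F u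
    proof -
      have FM: "F \<in> Obj Mod" using F sub by blast
      interpret F: cring_functor R \<U> C F by (rule cring_functor[OF FM])
      obtain \<alpha> where \<alpha>: "\<alpha> \<in> Hom Mod ?Ta F"
        and \<alpha>\<mu>: "\<And>y c. y \<in> Obj C \<Longrightarrow> c \<in> Sums a y \<Longrightarrow> \<alpha> y (\<mu> (a, y) c) = act R C F a y u c"
      proof (rule yoneda_extend[OF T \<mu> FM a u])
        fix y c assume "y \<in> Obj C" "c \<in> Sums a y" "\<mu> (a, y) c = \<zero>\<^bsub>obj_map T (a, y)\<^esub>"
        moreover from this have "c \<in> annihilator R C A (a, y)"
          unfolding ker[symmetric] by (simp add: bifunctor_kernel_iff[OF a])
        ultimately show "act R C F a y u c = \<zero>\<^bsub>obj_map F y\<^esub>"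
          using annihilated_byD[OF annihilated_by_annihilator[OF F] a _ _ u] by blast
      qed blast
      obtain g where g: "g \<in> Hom Mod G F" and ge: "cmp Mod ?Ta G F g e = \<alpha>"
        using ext[OF F \<alpha>] by blast
      have "act R C F a y u c = g y (e y t)"
        using \<alpha>\<mu>[OF y c] Funs_cmp[OF y t, of R \<U> G F g e] ge tc by simp
      also have "\<dots> = \<zero>\<^bsub>obj_map F y\<^esub>"
        unfolding zero by (rule mod_hom_zero[OF G.module[OF y] F.module[OF y] Funs_HomD(1)[OF g y]])
      finally show ?thesis .
    qed
    then have "c \<in> bifunctor_kernel R C (T, \<mu>) (a, y)"
      using c by (simp add: ker annihilator_iff[OF a y])
    then show "t = \<zero>\<^bsub>obj_map ?Ta y\<^esub>"
      by (simp add: tc bifunctor_kernel_iff[OF a y] fix_left_simps)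
  next
    fix y assume "y \<in> Obj C"
    then show "e y ` elems ?Ta y = elems G y"
      by (rule epi_imp_surjective[OF universe base Ta GM epi])
  qed
  then show ?thesis
    using G unfolding isomorphic_def by blast
qed

text \<open>
  The inclusion \<open>j\<close> of the kernel of \<open>e\<close> extends along the reflection \<open>\<rho>\<close> of that kernel to a map
  \<open>j'\<close> between members of \<open>A\<close>. Since \<open>\<rho>\<close> is an epimorphism and \<open>e j' \<rho> = e j = 0\<close>, also
  \<open>e j' = 0\<close>; then \<open>j' = 0\<close> by the uniqueness that coreflectivity grants, and so \<open>j = 0\<close>.
\<close>

lemma coreflection_injective:
  assumes A: "epireflective Mod A" and F: "F \<in> Obj Mod" and r: "r \<in> A"
    and e: "e \<in> Hom Mod r F"
    and uniq: "\<And>G g h. G \<in> A \<Longrightarrow> g \<in> Hom Mod G r \<Longrightarrow> h \<in> Hom Mod G r \<Longrightarrow>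
      cmp Mod G r F e g = cmp Mod G r F e h \<Longrightarrow> g = h"
    and x: "x \<in> Obj C" and u: "u \<in> elems r x" and zero: "e x u = \<zero>\<^bsub>obj_map F x\<^esub>"
  shows "u = \<zero>\<^bsub>obj_map r x\<^esub>"
proof -
  have sub: "A \<subseteq> Obj Mod"
    using A by (simp add: epireflective_def)
  have rM: "r \<in> Obj Mod" using r sub by blast
  interpret F: cring_functor R \<U> C F by (rule cring_functor[OF F])
  interpret r: cring_functor R \<U> C r by (rule cring_functor[OF rM])
  note eD = Funs_HomD[OF e]
  let ?N = "\<lambda>x. {u \<in> elems r x. e x u = \<zero>\<^bsub>obj_map F x\<^esub>}"
  obtain S j where S: "S \<in> Obj Mod" and j: "j \<in> Hom Mod S r"
    and S_obj: "\<And>x. x \<in> Obj C \<Longrightarrow> obj_map S x = (obj_map r x)\<lparr>carrier := ?N x\<rparr>"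
    and j_eq: "\<And>x u. x \<in> Obj C \<Longrightarrow> u \<in> ?N x \<Longrightarrow> j x u = u"
  proof (rule subfunctor_exists[OF universe base rM, of ?N])
    fix x assume x: "x \<in> Obj C"
    show "submodule (?N x) R (obj_map r x)"
      by (rule kernel_submodule[OF r.module[OF x] F.module[OF x] eD(1)[OF x]])
  next
    fix x y f u assume x: "x \<in> Obj C" and y: "y \<in> Obj C" and f: "f \<in> Hom C x y" and "u \<in> ?N x"
    then show "arr_map r x y f u \<in> ?N y"
      using r.arr_in[OF x y f] eD(3)[OF x y f]
        mod_hom_zero[OF F.module[OF x] F.module[OF y] F.arr[OF x y f]] by simp
  qed blast
  obtain G \<rho> where G: "G \<in> A" and epi: "is_epi Mod S G \<rho>"
    and ext: "\<And>H f. H \<in> A \<Longrightarrow> f \<in> Hom Mod S H \<Longrightarrow> \<exists>g \<in> Hom Mod G H. cmp Mod S G H g \<rho> = f"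
    using A S unfolding epireflective_Mod_iff
    by blast
  have GM: "G \<in> Obj Mod" using G sub by blast
  have \<rho>: "\<rho> \<in> Hom Mod S G"
    using epi by (simp add: is_epi_def)
  obtain j' where j': "j' \<in> Hom Mod G r" and j'\<rho>: "cmp Mod S G r j' \<rho> = j"
    using ext[OF r j] by blast
  let ?z = "\<lambda>x \<in> Obj C. \<lambda>u \<in> elems G x. \<zero>\<^bsub>obj_map r x\<^esub>"
  have z: "?z \<in> Hom Mod G r"
    by (rule zero_Funs_Hom[OF base GM rM])
  note ej' = Funs_cmp_in[OF base GM j' e] and ez = Funs_cmp_in[OF base GM z e]
  have "cmp Mod G r F e j' = cmp Mod G r F e ?z"
  proof (rule is_epiD[OF epi F ej' ez])
    show "cmp Mod S G F (cmp Mod G r F e j') \<rho> = cmp Mod S G F (cmp Mod G r F e ?z) \<rho>"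
    proof (rule Funs_Hom_ext[OF Funs_cmp_in[OF base S \<rho> ej']
          Funs_cmp_in[OF base S \<rho> ez]])
      fix x v assume x: "x \<in> Obj C" and v: "v \<in> elems S x"
      have vN: "v \<in> ?N x"
        using v x by (simp add: S_obj)
      note \<rho>v = Funs_HomD(2)[OF \<rho> x v]
      have "j' x (\<rho> x v) = v"
        using Funs_cmp[OF x v, of R \<U> G r j' \<rho>] j'\<rho> j_eq[OF x vN] by simp
      then show "cmp Mod S G F (cmp Mod G r F e j') \<rho> x v =
        cmp Mod S G F (cmp Mod G r F e ?z) \<rho> x v"
        using x v \<rho>v vN mod_hom_zero[OF r.module[OF x] F.module[OF x] eD(1)[OF x]]
        by (simp add: Funs_cmp)
    qed
  qed
  then have "j' = ?z"
    using uniq[OF G j' z] by simp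
  moreover have uS: "u \<in> elems S x"
    using x u zero by (simp add: S_obj)
  moreover have "j' x (\<rho> x u) = u"
    using Funs_cmp[OF x uS, of R \<U> G r j' \<rho>] j'\<rho> j_eq[OF x] u zero by simp
  ultimately show ?thesis
    using x Funs_HomD(2)[OF \<rho> x uS] by simp
qed

text \<open>
  Up to isomorphism \<open>A\<close> consists of all functors that its annihilator annihilates. For such a functor
  \<open>F\<close> the counit of the coreflection is injective, and it is surjective because every element of \<open>F a\<close>
  is the image of the class of the identity under a map from \<open>T(a, -)\<close>, which is isomorphic to a member
  of \<open>A\<close>.
\<close>

lemma repletion_iff_annihilated:
  assumes A: "A \<in> epi_coreflectives Mod" and F: "F \<in> Obj Mod"
  shows "(\<exists>G \<in> A. isomorphic Mod F G) \<longleftrightarrow> annihilated_by R C (annihilator R C A) F"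
proof
  have epi: "epireflective Mod A" and co: "coreflective Mod A"
    using A by (auto simp: epi_coreflectives_def)
  have sub: "A \<subseteq> Obj Mod"
    using epi by (simp add: epireflective_def)
  {
    assume "\<exists>G \<in> A. isomorphic Mod F G"
    then obtain G where G: "G \<in> A" and iso: "isomorphic Mod F G" by blast
    then show "annihilated_by R C (annihilator R C A) F"
      using sub
      by (intro isomorphic_annihilated[OF F _ iso annihilator_subset annihilated_by_annihilator]) auto
  }
  assume ann: "annihilated_by R C (annihilator R C A) F"
  interpret category C by (rule base)
  interpret F: cring_functor R \<U> C F by (rule cring_functor[OF F])
  obtain T \<mu> where TY: "(T, \<mu>) \<in> yoneda_bifunctors R \<U> C"
    and ker: "bifunctor_kernel R C (T, \<mu>) = annihilator R C A"
    by (rule annihilator_kernel_of_yoneda[OF sub])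
  have T: "T \<in> Obj Bimod"
    and \<mu>: "nat_surjection R (bicategory C) (free_hom R C) T \<mu>"
    using TY by (auto simp: yoneda_bifunctors_iff)
  have "\<forall>F \<in> Obj Mod. \<exists>r \<in> A. \<exists>e \<in> Hom Mod r F. \<forall>G \<in> A. \<forall>f \<in> Hom Mod G F.
      \<exists>!g. g \<in> Hom Mod G r \<and> cmp Mod G r F e g = f"
    by (rule conjunct2[OF iffD1[OF coreflective_Mod_iff co]])
  from bspec[OF this F] obtain r e where r: "r \<in> A" and e: "e \<in> Hom Mod r F"
    and all: "\<forall>G \<in> A. \<forall>f \<in> Hom Mod G F. \<exists>!g. g \<in> Hom Mod G r \<and> cmp Mod G r F e g = f"
    by (elim bexE)
  have univ: "\<exists>!g. g \<in> Hom Mod G r \<and> cmp Mod G r F e g = f"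
    if "G \<in> A" "f \<in> Hom Mod G F" for G f
    by (rule bspec[OF bspec[OF all that(1)] that(2)])
  have rM: "r \<in> Obj Mod" using r sub by blast
  have uniq: "g = h" if "G \<in> A" "g \<in> Hom Mod G r" "h \<in> Hom Mod G r"
    "cmp Mod G r F e g = cmp Mod G r F e h" for G g h
  proof -
    have "cmp Mod G r F e g \<in> Hom Mod G F"
      using that sub by (intro Funs_cmp_in[OF base _ _ e]) auto
    then show ?thesis
      using univ[OF that(1)] that by metis
  qed
  have "is_iso Mod r F e"
  proof (rule bijective_imp_iso[OF base rM F e])
    show "u = \<zero>\<^bsub>obj_map r x\<^esub>" if "x \<in> Obj C" "u \<in> elems r x"
      "e x u = \<zero>\<^bsub>obj_map F x\<^esub>" for x u
      using coreflection_injective[OF epi F r e uniq that] .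
  next
    fix a assume a: "a \<in> Obj C"
    show "e a ` elems r a = elems F a"
    proof (intro subset_antisym subsetI)
      fix v assume "v \<in> e a ` elems r a"
      then show "v \<in> elems F a"
        using Funs_HomD(2)[OF e a] by blast
    next
      fix u assume u: "u \<in> elems F a"
      let ?Ta = "fix_left C T a"
      have Ta: "?Ta \<in> Obj Mod" by (rule fix_left_functor[OF base T a])
      obtain \<alpha> where \<alpha>: "\<alpha> \<in> Hom Mod ?Ta F"
        and \<alpha>\<mu>: "\<And>y c. y \<in> Obj C \<Longrightarrow> c \<in> Sums a y \<Longrightarrow> \<alpha> y (\<mu> (a, y) c) = act R C F a y u c"
      proof (rule yoneda_extend[OF T \<mu> F a u])
        fix y c assume "y \<in> Obj C" "c \<in> Sums a y" "\<mu> (a, y) c = \<zero>\<^bsub>obj_map T (a, y)\<^esub>"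
        moreover from this have "c \<in> annihilator R C A (a, y)"
          unfolding ker[symmetric] by (simp add: bifunctor_kernel_iff[OF a])
        ultimately show "act R C F a y u c = \<zero>\<^bsub>obj_map F y\<^esub>"
          using annihilated_byD[OF ann a _ _ u] by blast
      qed blast
      obtain G where G: "G \<in> A" and iso: "isomorphic Mod ?Ta G"
        using fix_left_in_repletion[OF epi TY ker a] by blast
      obtain i k where i: "i \<in> Hom Mod ?Ta G" and k: "k \<in> Hom Mod G ?Ta"
        and ki: "\<And>x u. x \<in> Obj C \<Longrightarrow> u \<in> elems ?Ta x \<Longrightarrow> k x (i x u) = u"
        using Funs_isomorphicE[OF base iso] by blast
      have GM: "G \<in> Obj Mod" using G sub by blast
      obtain g where g: "g \<in> Hom Mod G r" and eg: "cmp Mod G r F e g = cmp Mod G ?Ta F \<alpha> k"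
        using univ[OF G Funs_cmp_in[OF base GM k \<alpha>]] by blast
      let ?t = "\<mu> (a, a) (free_gen R (idt C a))"
      note gen = free_gen_in[OF cring idt_in[OF a]]
      have t: "?t \<in> elems ?Ta a"
        using mod_hom_closed[OF bifunctor_surjectionD(1)[OF \<mu> a a] gen] by (simp add: fix_left_simps)
      note it = Funs_HomD(2)[OF i a t]
      have "u = \<alpha> a ?t"
        using \<alpha>\<mu>[OF a gen] F.act_gen[OF a a u idt_in[OF a]] F.arr_idt[OF a u] by simp
      also have "\<dots> = cmp Mod G ?Ta F \<alpha> k a (i a ?t)"
        using Funs_cmp[OF a it, of R \<U> ?Ta F \<alpha> k] ki[OF a t] by simp
      also have "\<dots> = e a (g a (i a ?t))"
        unfolding eg[symmetric] by (rule Funs_cmp[OF a it])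
      finally show "u \<in> e a ` elems r a"
        using Funs_HomD(2)[OF g a it] by blast
    qed
  qed
  then have "isomorphic Mod F r"
    unfolding isomorphic_def is_iso_def by blast
  then show "\<exists>G \<in> A. isomorphic Mod F G"
    using r by blast
qed

subsection \<open>The two equivalence relations\<close>

lemma subcategory_equiv_iff:
  assumes A: "A \<in> epi_coreflectives Mod" and B: "B \<in> epi_coreflectives Mod"
  shows "(A, B) \<in> subcategory_equiv Mod \<longleftrightarrow> annihilator R C A = annihilator R C B"
proof
  have sub: "X \<subseteq> Obj Mod" if "X \<in> epi_coreflectives Mod" for X
    using that by (simp add: epi_coreflectives_def epireflective_def)
  {
    assume eq: "annihilator R C A = annihilator R C B"
    have "\<exists>Y \<in> B. isomorphic Mod F Y" if "F \<in> A" for F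
      using repletion_iff_annihilated[OF B, of F] annihilated_by_annihilator[OF that] that sub[OF A]
      unfolding eq by blast
    moreover have "\<exists>Y \<in> A. isomorphic Mod F Y" if "F \<in> B" for F
      using repletion_iff_annihilated[OF A, of F] annihilated_by_annihilator[OF that] that sub[OF B]
      unfolding eq by blast
    ultimately show "(A, B) \<in> subcategory_equiv Mod"
      using A B by (simp add: subcategory_equiv_def)
  }
  have mono: "c \<in> annihilator R C Y (x, y)"
    if X: "X \<in> epi_coreflectives Mod" and Y: "Y \<in> epi_coreflectives Mod"
      and iso: "\<forall>G \<in> Y. \<exists>F \<in> X. isomorphic Mod G F"
      and x: "x \<in> Obj C" and y: "y \<in> Obj C" and c: "c \<in> annihilator R C X (x, y)" for X Y x y c
  proof -
    have "annihilated_by R C (annihilator R C X) G" if "G \<in> Y" for G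
      using repletion_iff_annihilated[OF X, of G] iso that sub[OF Y] by blast
    then have "act R C G x y u c = \<zero>\<^bsub>obj_map G y\<^esub>" if "G \<in> Y" "u \<in> elems G x" for G u
      using annihilated_byD[of R C "annihilator R C X" G x y c u] x y c that by blast
    then show ?thesis
      using c by (simp add: annihilator_iff[OF x y])
  qed
  assume "(A, B) \<in> subcategory_equiv Mod"
  then have "\<forall>F \<in> A. \<exists>G \<in> B. isomorphic Mod F G" "\<forall>G \<in> B. \<exists>F \<in> A. isomorphic Mod G F"
    by (auto simp: subcategory_equiv_def)
  then show "annihilator R C A = annihilator R C B"
    by (intro arrow_family_eqI[OF annihilator_extensional annihilator_extensional])
       (use mono[OF A B] mono[OF B A] in blast)
qed

lemma yoneda_isomorphism_iff:
  assumes S: "(S, \<nu>) \<in> yoneda_bifunctors R \<U> C" and T: "(T, \<mu>) \<in> yoneda_bifunctors R \<U> C"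
  shows "((S, \<nu>), (T, \<mu>)) \<in> yoneda_isomorphism R \<U> C \<longleftrightarrow>
    bifunctor_kernel R C (S, \<nu>) = bifunctor_kernel R C (T, \<mu>)"
proof
  note CC = category_bicategory[OF base]
  have SM: "S \<in> Obj Bimod"
    and \<nu>: "nat_surjection R (bicategory C) (free_hom R C) S \<nu>"
    and TM: "T \<in> Obj Bimod"
    and \<mu>: "nat_surjection R (bicategory C) (free_hom R C) T \<mu>"
    using S T by (auto simp: yoneda_bifunctors_iff)
  interpret S: module_functor R \<U> "bicategory C" S by (rule module_functor.intro[OF CC SM])
  interpret T: module_functor R \<U> "bicategory C" T by (rule module_functor.intro[OF CC TM])
  {
    assume "((S, \<nu>), (T, \<mu>)) \<in> yoneda_isomorphism R \<U> C"
    then obtain \<theta> where iso: "is_iso Bimod S T \<theta>"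
      and \<theta>\<nu>: "\<And>p c. p \<in> Obj (bicategory C) \<Longrightarrow> c \<in> elems (free_hom R C) p \<Longrightarrow>
        \<theta> p (\<nu> p c) = \<mu> p c"
      by (auto simp: yoneda_isomorphism_def)
    obtain \<theta>' where \<theta>: "\<theta> \<in> Hom Bimod S T"
      and \<theta>': "\<theta>' \<in> Hom Bimod T S"
      and id: "cmp Bimod S T S \<theta>' \<theta> = idt Bimod S"
      using iso unfolding is_iso_def by blast
    have \<theta>'\<theta>: "\<theta>' p (\<theta> p s) = s" if "p \<in> Obj (bicategory C)" "s \<in> elems S p" for p s
      using Funs_cmp[OF that, of R \<U> T S \<theta>' \<theta>] Funs_idt[OF that, of R \<U>] id by simp
    show "bifunctor_kernel R C (S, \<nu>) = bifunctor_kernel R C (T, \<mu>)"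
    proof (rule arrow_family_eqI[OF bifunctor_kernel_extensional bifunctor_kernel_extensional])
      fix x y c assume x: "x \<in> Obj C" and y: "y \<in> Obj C"
      have p: "(x, y) \<in> Obj (bicategory C)"
        using x y by (simp add: bicategory_simps)
      have "\<nu> (x, y) c = \<zero>\<^bsub>obj_map S (x, y)\<^esub> \<longleftrightarrow> \<mu> (x, y) c = \<zero>\<^bsub>obj_map T (x, y)\<^esub>" if c: "c \<in> Sums x y"
        using \<theta>\<nu>[OF p, of c] \<theta>'\<theta>[OF p mod_hom_closed[OF bifunctor_surjectionD(1)[OF \<nu> x y] c]] c
          mod_hom_zero[OF S.module[OF p] T.module[OF p] Funs_HomD(1)[OF \<theta> p]]
          mod_hom_zero[OF T.module[OF p] S.module[OF p] Funs_HomD(1)[OF \<theta>' p]]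
        by (auto simp: free_hom_simps)
      then show "c \<in> bifunctor_kernel R C (S, \<nu>) (x, y) \<longleftrightarrow> c \<in> bifunctor_kernel R C (T, \<mu>) (x, y)"
        by (auto simp: bifunctor_kernel_iff[OF x y])
    qed
  }
  assume eq: "bifunctor_kernel R C (S, \<nu>) = bifunctor_kernel R C (T, \<mu>)"
  have ker: "\<nu> p c = \<zero>\<^bsub>obj_map S p\<^esub> \<longleftrightarrow> \<mu> p c = \<zero>\<^bsub>obj_map T p\<^esub>"
    if p: "p \<in> Obj (bicategory C)" and c: "c \<in> elems (free_hom R C) p" for p c
  proof -
    obtain x y where xy: "p = (x, y)" "x \<in> Obj C" "y \<in> Obj C"
      using p by (auto simp: bicategory_simps)
    then have "c \<in> bifunctor_kernel R C (S, \<nu>) (x, y) \<longleftrightarrow> c \<in> bifunctor_kernel R C (T, \<mu>) (x, y)"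
      using eq by simp
    then show ?thesis
      using c xy by (simp add: bifunctor_kernel_iff free_hom_simps)
  qed
  have \<mu>n: "linear_natural R (bicategory C) (free_hom R C) T \<mu>"
    and \<mu>surj: "\<And>p. p \<in> Obj (bicategory C) \<Longrightarrow> \<mu> p ` elems (free_hom R C) p = elems T p"
    and \<nu>surj: "\<And>p. p \<in> Obj (bicategory C) \<Longrightarrow> \<nu> p ` elems (free_hom R C) p = elems S p"
    using \<mu> \<nu> by (auto simp: nat_surjection_iff)
  obtain \<theta> where \<theta>: "\<theta> \<in> Hom Bimod S T"
    and \<theta>\<nu>: "\<And>p c. p \<in> Obj (bicategory C) \<Longrightarrow> c \<in> elems (free_hom R C) p \<Longrightarrow>
      \<theta> p (\<nu> p c) = \<mu> p c"
    using factor_through[OF CC free_hom_functor[OF base cring] SM TM \<nu> \<mu>n] ker by blast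
  have "is_iso Bimod S T \<theta>"
  proof (rule bijective_imp_iso[OF CC SM TM \<theta>])
    fix p s assume p: "p \<in> Obj (bicategory C)" and "s \<in> elems S p"
      and zero: "\<theta> p s = \<zero>\<^bsub>obj_map T p\<^esub>"
    then obtain c where "c \<in> elems (free_hom R C) p" "s = \<nu> p c"
      using \<nu>surj by blast
    then show "s = \<zero>\<^bsub>obj_map S p\<^esub>"
      using zero \<theta>\<nu>[OF p] ker[OF p] by simp
  next
    fix p assume p: "p \<in> Obj (bicategory C)"
    show "\<theta> p ` elems S p = elems T p"
      unfolding \<nu>surj[OF p, symmetric] \<mu>surj[OF p, symmetric] image_image
      by (rule image_cong[OF refl \<theta>\<nu>[OF p]])
  qed
  then show "((S, \<nu>), (T, \<mu>)) \<in> yoneda_isomorphism R \<U> C"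
    using S T \<theta>\<nu> unfolding yoneda_isomorphism_def by blast
qed

lemma annihilators_eq_kernels:
  "annihilator R C ` epi_coreflectives Mod = bifunctor_kernel R C ` yoneda_bifunctors R \<U> C"
proof (intro subset_antisym subsetI)
  fix K assume "K \<in> annihilator R C ` epi_coreflectives Mod"
  then obtain A where "A \<subseteq> Obj Mod" and K: "K = annihilator R C A"
    by (auto simp: epi_coreflectives_def epireflective_def)
  then show "K \<in> bifunctor_kernel R C ` yoneda_bifunctors R \<U> C"
    using annihilator_kernel_of_yoneda[of A] by (metis imageI)
next
  fix K assume "K \<in> bifunctor_kernel R C ` yoneda_bifunctors R \<U> C"
  then obtain T \<mu> where TY: "(T, \<mu>) \<in> yoneda_bifunctors R \<U> C"
    and K: "K = bifunctor_kernel R C (T, \<mu>)"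
    by auto
  show "K \<in> annihilator R C ` epi_coreflectives Mod"
    using imageI[OF kernel_is_annihilator(1)[OF TY], of "annihilator R C"]
    unfolding K kernel_is_annihilator(2)[OF TY] .
qed

end

section \<open>The correspondence\<close>

text \<open>
  Equivalence classes of a relation given by equality of an invariant correspond to the values of the
  invariant.
\<close>

lemma quotient_by_invariant_bij:
  assumes "\<And>x x'. (x, x') \<in> r \<longleftrightarrow> x \<in> X \<and> x' \<in> X \<and> f x = f x'"
  shows "bij_betw (\<lambda>z. {x \<in> X. f x = z}) (f ` X) (X // r)"
proof -
  have cls: "r `` {x} = {x' \<in> X. f x' = f x}" if "x \<in> X" for x
    using assms that by auto
  have "inj_on (\<lambda>z. {x \<in> X. f x = z}) (f ` X)"
    by (rule inj_onI) blast
  moreover have "(\<lambda>z. {x \<in> X. f x = z}) ` f ` X = X // r"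
    unfolding quotient_def image_image using cls by auto
  ultimately show ?thesis
    by (simp add: bij_betw_def)
qed

theorem proposition3p12:
  fixes R :: "'r ring" and \<U> :: "'u set set" and C :: "('o, 'a) category"
  assumes "universe \<U>"
    and "cring R" and "small \<U> (carrier R)"
    and "category C" and "essentially_small \<U> C"
  shows "\<exists>\<Phi>. bij_betw \<Phi>
    (epi_coreflectives (functor_mod R \<U> C) // subcategory_equiv (functor_mod R \<U> C))
    (yoneda_bifunctors R \<U> C // yoneda_isomorphism R \<U> C)"
proof -
  interpret linear_setting R \<U> C
    by (rule linear_setting.intro) (use assms in \<open>auto simp: essentially_small_def\<close>)
  have "bij_betw (\<lambda>K. {A \<in> epi_coreflectives Mod. annihilator R C A = K})
    (annihilator R C ` epi_coreflectives Mod) (epi_coreflectives Mod // subcategory_equiv Mod)"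
  proof (rule quotient_by_invariant_bij)
    fix A B :: "('o, 'a, 'r, 'u) mod_functor set"
    show "(A, B) \<in> subcategory_equiv Mod \<longleftrightarrow> A \<in> epi_coreflectives Mod \<and>
        B \<in> epi_coreflectives Mod \<and> annihilator R C A = annihilator R C B"
      using subcategory_equiv_iff[of A B] by (auto simp: subcategory_equiv_def)
  qed
  moreover have "bij_betw (\<lambda>K. {Y \<in> yoneda_bifunctors R \<U> C. bifunctor_kernel R C Y = K})
    (bifunctor_kernel R C ` yoneda_bifunctors R \<U> C)
    (yoneda_bifunctors R \<U> C // yoneda_isomorphism R \<U> C)"
  proof (rule quotient_by_invariant_bij)
    fix Y Z
    show "(Y, Z) \<in> yoneda_isomorphism R \<U> C \<longleftrightarrow> Y \<in> yoneda_bifunctors R \<U> C \<and>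
        Z \<in> yoneda_bifunctors R \<U> C \<and> bifunctor_kernel R C Y = bifunctor_kernel R C Z"
    proof (cases "Y \<in> yoneda_bifunctors R \<U> C \<and> Z \<in> yoneda_bifunctors R \<U> C")
      case True
      then show ?thesis
        using yoneda_isomorphism_iff[of "fst Y" "snd Y" "fst Z" "snd Z"] by simp
    next
      case False
      then show ?thesis by (auto simp: yoneda_isomorphism_def)
    qed
  qed
  ultimately show ?thesis
    unfolding annihilators_eq_kernels by (blast intro: bij_betw_trans bij_betw_inv_into)
qed

end
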